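(* There are absolute constants $C_1, C_2, C_3 > 0$ such that the following holds. Let $\lambda \geq 2$ be a real number, let $d \geq 5$ be an integer, and set $k = d/2$. There exist sequences of entire even functions $a_{k,\lambda,n}, \tilde{a}_{k,\lambda,n} : \mathbb{C} \to \mathbb{C}$, $n = 1,2,3,\dots$, such that for all $f \in \mathcal{S}_{\mathrm{rad}}(\mathbb{R}^d)$ and all $x \in \mathbb{R}^d$ we have $$f(x) = \sum_{n=1}^{\infty} a_{k,\lambda,n}(|x|)\, f(\sqrt{2n/\lambda}) + \sum_{n=1}^{\infty} \tilde{a}_{k,\lambda,n}(|x|)\, \widehat{f}(\sqrt{2n/\lambda}),$$ and both series converge absolutely and uniformly on $\mathbb{R}^d$. Moreover, $$\sup_{r \in \mathbb{R}} |a_{k,\lambda,n}(r)| + \sup_{r \in \mathbb{R}} |\tilde{a}_{k,\lambda,n}(r)| \leq C_1 (C_2/k)^{k/2} n^{k}$$ for all $n \geq 1$, and $$|a_{k,\lambda,n}(r)| + |\tilde{a}_{k,\lambda,n}(r)| \leq C_3\, n^{k/2+9/8}\, r^{-k+9/4}$$ for all $r > 0$ and $n \geq 1$.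
   Context: $\mathcal{S}_{\mathrm{rad}}(\mathbb{R}^d)$ is the space of radial complex-valued Schwartz functions on $\mathbb{R}^d$. For radial $f$ and a real number $\rho \geq 0$, $f(\rho)$ denotes the common value of $f$ on the vectors of Euclidean norm $\rho$ (likewise for $\widehat{f}$, which is radial). The Fourier transform is $\widehat{f}(\xi) = \int_{\mathbb{R}^d} f(x) e^{-2\pi i \langle x,\xi\rangle}dx$. *)

theory Defs
  imports "HOL-Complex_Analysis.Complex_Analysis"
begin

text \<open>
  The dimension must range over the naturals below quantified constants, so it cannot be a
  type. A point of $R^d$ is therefore an extensional function on \<open>{..<d}\<close>; this is the carrier
  of the product measure \<open>\<Pi>\<^sub>M i\<in>{..<d}. lborel\<close>, which is Borel-Lebesgue measure. On it, the
  product topology of \<open>nat \<Rightarrow> real\<close> (used by \<open>continuous_on\<close>) is the Euclidean one, and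
  \<open>L2_set x {..<d}\<close> is the Euclidean norm. Functions on $R^d$ are total functions whose
  values off the carrier play no role.
\<close>

definition euc :: "nat \<Rightarrow> (nat \<Rightarrow> real) set" where
  "euc d = PiE {..<d} (\<lambda>_. UNIV)"

abbreviation enorm :: "nat \<Rightarrow> (nat \<Rightarrow> real) \<Rightarrow> real" where
  "enorm d x \<equiv> L2_set x {..<d}"

definition lebesgue_euc :: "nat \<Rightarrow> (nat \<Rightarrow> real) measure" where
  "lebesgue_euc d = (\<Pi>\<^sub>M i\<in>{..<d}. lborel)"

definition partial :: "nat \<Rightarrow> ((nat \<Rightarrow> real) \<Rightarrow> complex) \<Rightarrow> (nat \<Rightarrow> real) \<Rightarrow> complex" where
  "partial i f x = vector_derivative (\<lambda>t. f (x(i := t))) (at (x i))"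

text \<open>\<open>partials [i, j, \<dots>] f\<close> is the iterated derivative \<open>partial i (partial j (\<dots> f))\<close>.\<close>

definition partials :: "nat list \<Rightarrow> ((nat \<Rightarrow> real) \<Rightarrow> complex) \<Rightarrow> (nat \<Rightarrow> real) \<Rightarrow> complex" where
  "partials js f = foldr partial js f"

definition smooth_euc :: "nat \<Rightarrow> ((nat \<Rightarrow> real) \<Rightarrow> complex) \<Rightarrow> bool" where
  "smooth_euc d f \<longleftrightarrow>
     (\<forall>js. set js \<subseteq> {..<d} \<longrightarrow>
        continuous_on (euc d) (partials js f) \<and>
        (\<forall>x\<in>euc d. \<forall>i<d. (\<lambda>t. partials js f (x(i := t))) differentiable (at (x i))))"

definition schwartz :: "nat \<Rightarrow> ((nat \<Rightarrow> real) \<Rightarrow> complex) set" where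
  "schwartz d = {f. smooth_euc d f \<and>
     (\<forall>js N. set js \<subseteq> {..<d} \<longrightarrow>
        bdd_above ((\<lambda>x. enorm d x ^ N * cmod (partials js f x)) ` euc d))}"

definition radial :: "nat \<Rightarrow> ((nat \<Rightarrow> real) \<Rightarrow> complex) \<Rightarrow> bool" where
  "radial d f \<longleftrightarrow> (\<forall>x\<in>euc d. \<forall>y\<in>euc d. enorm d x = enorm d y \<longrightarrow> f x = f y)"

definition schwartz_rad :: "nat \<Rightarrow> ((nat \<Rightarrow> real) \<Rightarrow> complex) set" where
  "schwartz_rad d = {f \<in> schwartz d. radial d f}"

text \<open>Well defined for radial \<open>f\<close>, \<open>\<rho> \<ge> 0\<close> and \<open>d \<ge> 1\<close>.\<close>

definition radial_value :: "nat \<Rightarrow> ((nat \<Rightarrow> real) \<Rightarrow> complex) \<Rightarrow> real \<Rightarrow> complex" where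
  "radial_value d f \<rho> = (THE c. \<forall>x\<in>euc d. enorm d x = \<rho> \<longrightarrow> f x = c)"

definition fourier :: "nat \<Rightarrow> ((nat \<Rightarrow> real) \<Rightarrow> complex) \<Rightarrow> (nat \<Rightarrow> real) \<Rightarrow> complex" where
  "fourier d f \<xi> =
     (LINT x|lebesgue_euc d. f x * exp (- 2 * pi * \<i> * complex_of_real (\<Sum>i<d. x i * \<xi> i)))"

definition entire_even :: "(complex \<Rightarrow> complex) \<Rightarrow> bool" where
  "entire_even g \<longleftrightarrow> g holomorphic_on UNIV \<and> (\<forall>z. g (- z) = g z)"

text \<open>For the series \<open>g 1 + g 2 + \<dots>\<close>, whose terms are indexed from 1.\<close>

definition abs_unif_convergent_on ::
    "'a set \<Rightarrow> (nat \<Rightarrow> 'a \<Rightarrow> complex) \<Rightarrow> bool" where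
  "abs_unif_convergent_on S g \<longleftrightarrow>
     (\<forall>x\<in>S. summable (\<lambda>n. cmod (g (Suc n) x))) \<and>
     uniformly_convergent_on S (\<lambda>N x. \<Sum>n=1..N. g n x)"

end

(*
  Write phi(t) = exp(pi i t r^2). For f(x) = exp(pi i t |x|^2) the interpolation formula says
  phi(t) = sum a_n(r) q^n + (-i t)^(-k) sum b_n(r) q'^n with q = exp(2 pi i t / l), q' = exp(2 pi i (-1/t) / l).
  So one needs l-periodic functions A, B on the upper half plane, vanishing at i infinity, with A + B|S = phi,
  where |S is the weight k action of S t = -1/t. Let B and -A be the sums of phi over the words
  S T^(m_1) S T^(m_2) ... S T^m (T t = t + l, m_1, m_2, ... nonzero, m arbitrary) with an even,
  respectively odd, number of letters m_i. The identity A + B|S = phi then holds term by term, and everything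
  rests on the absolute convergence of these sums in weight k > 9/4. Because l >= 2 the cusps of the words stay
  in (-1, 1), and weighting a word of lower left entry c and cusp x by c^(-9/4) (1 - x^2)^(-9/8) makes the
  total weight decrease with the length by a definite fraction of the sum of the c^(-9/4). The
  bounds on a_n and b_n are Cauchy's inequalities on the line Im t = y for suitable y.

  A radial Schwartz function is f(x) = Phi(|x|^2) with Phi smooth up to the boundary on [0, infinity), so by Weierstrass
  Phi and its first M derivatives are approximated, in a weighted sup norm, by combinations of the
  functions exp(-pi j u), j = 1, 2, .... This bounds the transforms of the approximants by a fixed multiple of
  rho^(-M), and the formula passes to the limit by dominated convergence.
*)

theory Submission
  imports Defs "HOL-Probability.Probability" "HOL-Real_Asymp.Real_Asymp"
begin

text \<open>The borderline exponent is 2. For \<open>l = 2\<close> the weight c^(-2) (1 - x^2)^(-1)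
  is preserved exactly when all nonzero letters are put in front of a word: the sum of 1 / ((2m +
  x)^2 - 1) over all integers m telescopes to 0, so the terms with m nonzero add up to 1 / (1 -
  x^2). Exact preservation alone yields no summability. The power 9/8 of this weight does decrease,
  since no single term exceeds 1 / (1 - x^2) - 1/2, and the loss 1/16 depends neither on x nor on
  \<open>l\<close>; this keeps the constants absolute. The exponent k is split into 9/4, spent on
  convergence, and k - 9/4, which is at least 1/4 for d >= 5. The second part either becomes a power
  of Im t (supremum bound) or is traded against the Gaussian factor exp(-pi r^2 Im t / radius^2)
  (decay in r). For complex z the summands may grow, and the orbit sums are controlled only for Im t
  >= 1, where words map into the unit disc. This is enough: the coefficients are Taylor coefficients
  at q = 0 and see only large Im t.\<close>

section \<open>The weights of words\<close>

text \<open>Bernoulli for the eighth power of 1 - 1/(16 P) gives P - 1/2 <= P (1 - 1/(16 P))^8. The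
  eighth root costs exactly that factor, so the gap is P^(9/8) / (16 P) = P^(1/8) / 16. It is
  applied with P = 1 / (1 - x^2).\<close>

lemma powr_nine_eighths_gap:
  fixes P :: real
  assumes "P \<ge> 1"
  shows "P * (P - 1/2) powr (1/8) \<le> P powr (9/8) - 1/16"
proof -
  define u where "u = 1 - 1 / (16 * P)"
  have u: "0 \<le> u" using assms by (simp add: u_def field_simps)
  have "1 - 1 / (2 * P) \<le> u ^ 8"
    using Bernoulli_inequality[of "- (1 / (16 * P))" 8] assms by (simp add: u_def field_simps)
  hence "P - 1/2 \<le> P * u ^ 8"
    using mult_left_mono[of "1 - 1 / (2 * P)" "u ^ 8" P] assms by (simp add: algebra_simps)
  hence "(P - 1/2) powr (1/8) \<le> (P * u ^ 8) powr (1/8)"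
    by (intro powr_mono2) (use assms in auto)
  also have "(P * u ^ 8) powr (1/8) = P powr (1/8) * (u powr 8) powr (1/8)"
    using assms u by (simp add: powr_mult powr_numeral)
  also have "(u powr 8) powr (1/8) = u"
    using u by (subst powr_powr) simp
  finally have "P * (P - 1/2) powr (1/8) \<le> P * (P powr (1/8) * u)"
    using assms by simp
  also have "\<dots> = P powr (9/8) - P powr (1/8) / 16"
  proof -
    have "P powr (9/8) = P * P powr (1/8)"
      using assms powr_add[of P 1 "1/8"] by simp
    thus ?thesis using assms by (simp add: u_def field_simps)
  qed
  also have "\<dots> \<le> P powr (9/8) - 1/16"
    using ge_one_powr_ge_zero[of P "1/8"] assms by simp
  finally show ?thesis .
qed

lemma power2_powr: "(x\<^sup>2) powr s = \<bar>x\<bar> powr (2 * s)" for x :: real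
proof -
  have "\<bar>x\<bar> powr 2 = x\<^sup>2" by (subst powr_numeral) auto
  thus ?thesis by (metis powr_powr)
qed

text \<open>Partial fractions make the sum telescope. It tends to 0 as \<open>N\<close> grows, and
  its term m = 0 is -1 / (1 - x^2), so in the limit the other terms add up to exactly 1 / (1 -
  x^2).\<close>

lemma sum_symmetric_odd_reciprocals:
  fixes x :: real
  assumes "\<bar>x\<bar> < 1"
  shows "(\<Sum>m\<in>{- int N..int N}. 1 / ((2 * of_int m + x)\<^sup>2 - 1)) =
    (1 / (x - 2 * real N - 1) - 1 / (x + 2 * real N + 1)) / 2"
proof (induction N)
  case 0
  have "x\<^sup>2 - 1 = (x - 1) * (x + 1)" by (simp add: power2_eq_square algebra_simps)
  moreover have "x - 1 \<noteq> 0" "x + 1 \<noteq> 0" using assms by auto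
  ultimately have "1 / (x\<^sup>2 - 1) = (1 / (x - 1) - 1 / (x + 1)) / 2"
    by (simp only:) (simp add: divide_simps)
  thus ?case by simp
next
  case (Suc N)
  have split: "1 / (u\<^sup>2 - 1) = (1 / (u - 1) - 1 / (u + 1)) / 2" if "u - 1 \<noteq> 0" "u + 1 \<noteq> 0" for u :: real
  proof -
    have "u\<^sup>2 - 1 = (u - 1) * (u + 1)" by (simp add: power2_eq_square algebra_simps)
    thus ?thesis using that by (simp only:) (simp add: divide_simps)
  qed
  have eq: "{- int (Suc N)..int (Suc N)} = insert (int (Suc N)) (insert (- int (Suc N)) {- int N..int N})"
    by auto
  have "(\<Sum>m\<in>{- int (Suc N)..int (Suc N)}. 1 / ((2 * of_int m + x)\<^sup>2 - 1)) =
      1 / ((2 * real (Suc N) + x)\<^sup>2 - 1) + (1 / ((- 2 * real (Suc N) + x)\<^sup>2 - 1) +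
      (1 / (x - 2 * real N - 1) - 1 / (x + 2 * real N + 1)) / 2)"
    unfolding eq by (subst sum.insert; (subst sum.insert)?) (auto simp: Suc.IH simp flip: of_nat_Suc)
  also have "1 / ((2 * real (Suc N) + x)\<^sup>2 - 1) =
      (1 / (2 * real (Suc N) + x - 1) - 1 / (2 * real (Suc N) + x + 1)) / 2"
    by (rule split) (use assms in auto)
  also have "1 / ((- 2 * real (Suc N) + x)\<^sup>2 - 1) =
      (1 / (- 2 * real (Suc N) + x - 1) - 1 / (- 2 * real (Suc N) + x + 1)) / 2"
    by (rule split) (use assms in auto)
  finally show ?case by (simp add: algebra_simps diff_divide_distrib add_divide_distrib)
qed

text \<open>The case \<open>l = 2\<close> is the worst one. There the reciprocals \<open>p m\<close>
  have total at most P = 1 / (1 - x^2) and each is at most P - 1/2, so (p m)^(9/8) <= p m (P -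
  1/2)^(1/8), and the sum falls short of P^(9/8).\<close>

lemma sum_translates_powr_le:
  fixes x l :: real and F :: "int set"
  assumes x: "\<bar>x\<bar> < 1" and l: "l \<ge> 2" and F: "finite F" "0 \<notin> F"
  shows "(\<Sum>m\<in>F. ((of_int m * l + x)\<^sup>2 - 1) powr (-9/8)) \<le> (1 - x\<^sup>2) powr (-9/8) - 1/16"
proof -
  define p where "p m = 1 / ((2 * of_int m + x)\<^sup>2 - 1)" for m :: int
  define P where "P = 1 / (1 - x\<^sup>2)"
  have x2: "x\<^sup>2 < 1" using x abs_square_less_1 by blast
  have P: "P \<ge> 1" unfolding P_def using x2 by (simp add: field_simps)
  have gt: "(2 * of_int m + x)\<^sup>2 > 1" if "m \<noteq> 0" for m :: int
  proof -
    have "real_of_int \<bar>m\<bar> \<ge> 1" using that by linarith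
    hence "\<bar>2 * of_int m + x\<bar> > 1" using x by linarith
    thus ?thesis using abs_square_le_1 not_less by blast
  qed
  have le_sq: "(2 * of_int m + x)\<^sup>2 \<le> (of_int m * l + x)\<^sup>2" if "m \<noteq> 0" for m :: int
  proof -
    have a: "real_of_int \<bar>m\<bar> \<ge> 1" using that by linarith
    have "\<bar>2 * of_int m + x\<bar> \<le> \<bar>of_int m * l + x\<bar>"
    proof (cases "m > 0")
      case True
      have "2 * real_of_int m \<le> of_int m * l" using True l by simp
      thus ?thesis using True x a by linarith
    next
      case False
      have "of_int m * l \<le> 2 * real_of_int m" using False l mult_right_mono_neg[of 2 l "real_of_int m"] by (simp add: mult.commute)
      thus ?thesis using False that x a by linarith
    qed
    thus ?thesis by (simp add: abs_le_square_iff)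
  qed
  have p_nonneg: "p m \<ge> 0" if "m \<noteq> 0" for m using gt[OF that] by (simp add: p_def)
  have p_le: "p m \<le> P - 1/2" if "m \<noteq> 0" for m
  proof -
    \<comment> \<open>Up to the sign of x this is the translate nearest to the origin. The
      difference of the two reciprocals is 2 / ((1 - y)(3 + y)), and (1 - y)(3 + y) = 4 - (1 + y)^2
      <= 4.\<close>
    have main: "1 / ((2 + y)\<^sup>2 - 1) \<le> 1 / (1 - y\<^sup>2) - 1/2" if "\<bar>y\<bar> < 1" for y :: real
    proof -
      have y2: "y\<^sup>2 < 1" using that abs_square_less_1 by blast
      have "(1 - y) * (3 + y) \<le> 4"
        using zero_le_power2[of "1 + y"] by (simp add: power2_eq_square algebra_simps)
      moreover have pos: "(1 - y) * (3 + y) > 0" "1 + y > 0" using that by (auto intro!: mult_pos_pos)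
      ultimately have "2 / ((1 - y) * (3 + y)) \<ge> 1/2" by (simp add: field_simps)
      moreover have "1 / (1 - y\<^sup>2) - 1 / ((2 + y)\<^sup>2 - 1) = 2 / ((1 - y) * (3 + y))"
      proof -
        have e: "1 - y\<^sup>2 = (1 - y) * (1 + y)" "(2 + y)\<^sup>2 - 1 = (1 + y) * (3 + y)"
          by (simp_all add: power2_eq_square algebra_simps)
        have nz: "1 - y \<noteq> 0" "1 + y \<noteq> 0" "3 + y \<noteq> 0" using that by auto
        show ?thesis unfolding e using nz by (simp add: divide_simps)
      qed
      ultimately show ?thesis by linarith
    qed
    define y where "y = (if m > 0 then x else - x)"
    have y: "\<bar>y\<bar> < 1" "y\<^sup>2 = x\<^sup>2" using x by (auto simp: y_def)
    have "(2 + y)\<^sup>2 \<le> (2 * of_int m + x)\<^sup>2"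
    proof -
      have a: "real_of_int \<bar>m\<bar> \<ge> 1" using that by linarith
      have "\<bar>2 + y\<bar> \<le> \<bar>2 * of_int m + x\<bar>" using x a that unfolding y_def by (auto split: if_splits)
      thus ?thesis by (simp add: abs_le_square_iff)
    qed
    moreover have "(2 + y)\<^sup>2 - 1 > 0"
      using y(1) power_strict_mono[of 1 "2 + y" 2] by simp
    ultimately have "p m \<le> 1 / ((2 + y)\<^sup>2 - 1)" unfolding p_def by (intro divide_left_mono) auto
    also have "\<dots> \<le> 1 / (1 - y\<^sup>2) - 1/2" by (rule main) (rule y)
    finally show ?thesis by (simp add: P_def y)
  qed
  have sum_p: "(\<Sum>m\<in>F. p m) \<le> P"
  proof -
    obtain N where N: "F \<subseteq> {- int N..int N}"
    proof -
      define N where "N = nat (Max (insert 0 (abs ` F)))"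
      have "\<bar>m\<bar> \<le> int N" if "m \<in> F" for m
        unfolding N_def using F that by (auto simp: Max_ge_iff)
      hence "F \<subseteq> {- int N..int N}" by (auto simp: abs_le_iff) (use abs_le_iff in force)
      thus ?thesis by (rule that)
    qed
    \<comment> \<open>The terms with m nonzero are nonnegative, so the sum may be enlarged to a
      symmetric range, where it telescopes.\<close>
    have "(\<Sum>m\<in>F. p m) \<le> (\<Sum>m\<in>{- int N..int N} - {0}. p m)"
      by (rule sum_mono2) (use N F p_nonneg in auto)
    also have "\<dots> = (\<Sum>m\<in>{- int N..int N}. p m) - p 0"
      by (subst sum_diff1) auto
    also have "(\<Sum>m\<in>{- int N..int N}. p m) = (1 / (x - 2 * real N - 1) - 1 / (x + 2 * real N + 1)) / 2"
      unfolding p_def by (rule sum_symmetric_odd_reciprocals[OF x])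
    also have "\<dots> \<le> 0"
    proof -
      have "1 / (x - 2 * real N - 1) \<le> 0" "1 / (x + 2 * real N + 1) \<ge> 0" using x by (auto simp: divide_simps)
      hence "1 / (x - 2 * real N - 1) - 1 / (x + 2 * real N + 1) \<le> 0" by linarith
      thus ?thesis by (rule divide_nonpos_pos) simp
    qed
    also have "0 - p 0 = P" by (simp add: p_def P_def minus_divide_right)
    finally show ?thesis by simp
  qed
  have "(\<Sum>m\<in>F. ((of_int m * l + x)\<^sup>2 - 1) powr (-9/8)) \<le> (\<Sum>m\<in>F. p m * (P - 1/2) powr (1/8))"
  proof (rule sum_mono)
    fix m assume "m \<in> F"
    hence m: "m \<noteq> 0" using F by auto
    have "((of_int m * l + x)\<^sup>2 - 1) powr (-9/8) \<le> ((2 * of_int m + x)\<^sup>2 - 1) powr (-9/8)"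
      by (rule powr_mono2') (use gt[OF m] le_sq[OF m] in auto)
    also have "\<dots> = p m powr (9/8)"
      using gt[OF m] by (simp add: p_def powr_divide powr_minus_divide)
    also have "\<dots> = p m * p m powr (1/8)"
      using gt[OF m] powr_add[of "p m" 1 "1/8"] by (simp add: p_def)
    also have "\<dots> \<le> p m * (P - 1/2) powr (1/8)"
      by (intro mult_left_mono powr_mono2) (use p_nonneg[OF m] p_le[OF m] in auto)
    finally show "((of_int m * l + x)\<^sup>2 - 1) powr (-9/8) \<le> p m * (P - 1/2) powr (1/8)" .
  qed
  also have "\<dots> = (\<Sum>m\<in>F. p m) * (P - 1/2) powr (1/8)" by (simp add: sum_distrib_right)
  also have "\<dots> \<le> P * (P - 1/2) powr (1/8)" by (intro mult_right_mono sum_p) auto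
  also have "\<dots> \<le> P powr (9/8) - 1/16" by (rule powr_nine_eighths_gap[OF P])
  also have "P powr (9/8) = (1 - x\<^sup>2) powr (-9/8)"
    using x2 by (simp add: P_def powr_divide powr_minus_divide)
  finally show ?thesis .
qed

text \<open>A word \<open>[m\<^sub>1, \<dots>, m\<^sub>r]\<close> stands for the map \<open>t \<mapsto> S (m\<^sub>r l + S (\<dots> (m\<^sub>1 l + S t)))\<close> with
  \<open>S t = - 1 / t\<close>; \<open>action\<close> is this map and \<open>cocycle\<close> its weight \<open>k\<close> automorphy factor. The map has its
  pole at \<open>- cusp\<close>, the lower left entry of its matrix is \<open>height\<close> up to sign, and \<open>radius\<close> is the
  modulus of the denominator.\<close>

primrec cusp :: "real \<Rightarrow> int list \<Rightarrow> real" where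
  "cusp l [] = 0"
| "cusp l (m # w) = - 1 / (of_int m * l + cusp l w)"

primrec height :: "real \<Rightarrow> int list \<Rightarrow> real" where
  "height l [] = 1"
| "height l (m # w) = height l w * \<bar>of_int m * l + cusp l w\<bar>"

abbreviation radius :: "real \<Rightarrow> int list \<Rightarrow> complex \<Rightarrow> real" where
  "radius l w t \<equiv> height l w * cmod (t + of_real (cusp l w))"

primrec action :: "real \<Rightarrow> int list \<Rightarrow> complex \<Rightarrow> complex" where
  "action l [] t = - 1 / t"
| "action l (m # w) t = action l w (of_int m * of_real l - 1 / t)"

primrec cocycle :: "real \<Rightarrow> real \<Rightarrow> int list \<Rightarrow> complex \<Rightarrow> complex" where
  "cocycle k l [] t = (- \<i> * t) powr (- of_real k)"
| "cocycle k l (m # w) t = (- \<i> * t) powr (- of_real k) * cocycle k l w (of_int m * of_real l - 1 / t)"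

definition words :: "int list set" where
  "words = {w. 0 \<notin> set w}"

lemma Nil_in_words [simp]: "[] \<in> words"
  and Cons_in_words [simp]: "m # w \<in> words \<longleftrightarrow> m \<noteq> 0 \<and> w \<in> words"
  by (auto simp: words_def)

lemma abs_translate_gt_1:
  fixes l x :: real
  assumes "l \<ge> 2" "\<bar>x\<bar> < 1" "m \<noteq> 0"
  shows "\<bar>of_int m * l + x\<bar> > 1"
proof -
  have "real_of_int \<bar>m\<bar> \<ge> 1" using assms by linarith
  hence "1 * l \<le> \<bar>of_int m\<bar> * l" by (intro mult_right_mono) (use assms in auto)
  hence "\<bar>of_int m * l\<bar> \<ge> 2" using assms by (simp only: abs_mult)
  thus ?thesis using assms by linarith
qed

lemma abs_cusp_less_1:
  assumes "l \<ge> 2" "w \<in> words"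
  shows "\<bar>cusp l w\<bar> < 1"
  using assms(2)
proof (induction w)
  case (Cons m w)
  thus ?case using abs_translate_gt_1[OF assms(1), of "cusp l w" m] by simp
qed auto

lemma height_ge_1:
  assumes "l \<ge> 2" "w \<in> words"
  shows "height l w \<ge> 1"
  using assms(2)
proof (induction w)
  case (Cons m w)
  have "1 * 1 \<le> height l w * \<bar>of_int m * l + cusp l w\<bar>"
    using Cons abs_translate_gt_1[OF assms(1) abs_cusp_less_1[OF assms(1)], of w m]
    by (intro mult_mono) auto
  thus ?case by simp
qed auto

text \<open>A word of cusp \<open>x\<close> has weight \<open>height l w powr (-9/4) * (1 - x\<^sup>2) powr (-9/8)\<close>. By
  \<open>sum_translates_powr_le\<close> the total weight of the words of length \<open>n\<close> loses at least a sixteenth of the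
  sum of the \<open>height l w powr (-9/4)\<close> when \<open>n\<close> increases by one.\<close>

lemma sum_height_powr_level_le:
  fixes l :: real and A :: "int set"
  assumes l: "l \<ge> 2" and A: "finite A" "0 \<notin> A"
  defines "L \<equiv> \<lambda>n. {w. set w \<subseteq> A \<and> length w = n}"
  defines "V \<equiv> \<lambda>w. height l w powr (-9/4) * (1 - (cusp l w)\<^sup>2) powr (-9/8)"
  shows "(\<Sum>i<n. \<Sum>w\<in>L i. height l w powr (-9/4)) / 16 + (\<Sum>w\<in>L n. V w) \<le> 1"
proof (induction n)
  case 0
  have "L 0 = {[]}" by (auto simp: L_def)
  thus ?case by (simp add: V_def)
next
  case (Suc n)
  have fin: "finite (L i)" for i unfolding L_def by (rule finite_lists_length_eq[OF A(1)])
  have L_words: "w \<in> words" if "w \<in> L i" for w i using that A by (auto simp: L_def words_def)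
  \<comment> \<open>The new height is the old one times |X| and the new cusp is -1/X; since X^2 (1 -
    1/X^2) = X^2 - 1, the weight takes the form estimated in
    \<open>sum_translates_powr_le\<close>.\<close>
  have V_Cons: "V (m # w) = height l w powr (-9/4) * ((of_int m * l + cusp l w)\<^sup>2 - 1) powr (-9/8)"
    if m: "m \<noteq> 0" and w: "w \<in> words" for m w
  proof -
    define X where "X = of_int m * l + cusp l w"
    have X: "\<bar>X\<bar> > 1" unfolding X_def using abs_translate_gt_1[OF l abs_cusp_less_1[OF l w] m] .
    hence X2: "X\<^sup>2 > 1" using abs_square_le_1 not_less by blast
    have s: "height l w > 0" using height_ge_1[OF l w] by simp
    have "V (m # w) = (height l w * \<bar>X\<bar>) powr (-9/4) * (1 - (1/X)\<^sup>2) powr (-9/8)"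
      by (simp add: V_def X_def power_divide)
    also have "\<dots> = height l w powr (-9/4) * (\<bar>X\<bar> powr (-9/4) * (1 - (1/X)\<^sup>2) powr (-9/8))"
      using s by (simp add: powr_mult)
    also have "\<bar>X\<bar> powr (-9/4) = (X\<^sup>2) powr (-9/8)" by (simp add: power2_powr)
    also have "(X\<^sup>2) powr (-9/8) * (1 - (1/X)\<^sup>2) powr (-9/8) = (X\<^sup>2 * (1 - (1/X)\<^sup>2)) powr (-9/8)"
      using X2 by (intro powr_mult[symmetric])
    also have "X\<^sup>2 * (1 - (1/X)\<^sup>2) = X\<^sup>2 - 1" using X by (auto simp: field_simps power_divide)
    finally show ?thesis by (simp add: X_def)
  qed
  have "L (Suc n) = (\<lambda>(w, m). m # w) ` (L n \<times> A)"
  proof (intro equalityI subsetI)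
    fix v assume "v \<in> L (Suc n)"
    then obtain m w where "v = m # w" "m \<in> A" "w \<in> L n" by (cases v) (auto simp: L_def)
    thus "v \<in> (\<lambda>(w, m). m # w) ` (L n \<times> A)" by force
  qed (auto simp: L_def)
  moreover have "inj_on (\<lambda>(w, m). m # w) (L n \<times> A)" by (auto simp: inj_on_def)
  ultimately have "(\<Sum>w\<in>L (Suc n). V w) = (\<Sum>(w, m)\<in>L n \<times> A. V (m # w))"
    by (simp add: sum.reindex case_prod_unfold)
  also have "\<dots> = (\<Sum>w\<in>L n. \<Sum>m\<in>A. V (m # w))"
    by (simp add: sum.cartesian_product)
  also have "\<dots> \<le> (\<Sum>w\<in>L n. V w - height l w powr (-9/4) / 16)"
  proof (rule sum_mono)
    fix w assume w: "w \<in> L n"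
    have "(\<Sum>m\<in>A. V (m # w)) =
        (\<Sum>m\<in>A. height l w powr (-9/4) * ((of_int m * l + cusp l w)\<^sup>2 - 1) powr (-9/8))"
      by (intro sum.cong refl V_Cons) (use A L_words[OF w] in auto)
    also have "\<dots> = height l w powr (-9/4) * (\<Sum>m\<in>A. ((of_int m * l + cusp l w)\<^sup>2 - 1) powr (-9/8))"
      by (simp add: sum_distrib_left)
    also have "\<dots> \<le> height l w powr (-9/4) * ((1 - (cusp l w)\<^sup>2) powr (-9/8) - 1/16)"
      by (intro mult_left_mono sum_translates_powr_le abs_cusp_less_1) (use A l L_words[OF w] in auto)
    finally show "(\<Sum>m\<in>A. V (m # w)) \<le> V w - height l w powr (-9/4) / 16"
      by (simp add: V_def algebra_simps)
  qed
  finally have "(\<Sum>w\<in>L (Suc n). V w) \<le> (\<Sum>w\<in>L n. V w) - (\<Sum>w\<in>L n. height l w powr (-9/4)) / 16"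
    by (simp add: sum_subtractf sum_divide_distrib)
  thus ?case using Suc by (simp add: add_divide_distrib)
qed

text \<open>The level sums start at 1, the weight of the empty word, and never become negative. Each
  level loses a sixteenth of its height sum, so all height sums together are at most 16. A finite
  set of words has finitely many letters and bounded length, hence lies in finitely many finite
  levels.\<close>

lemma sum_height_powr_le:
  assumes l: "l \<ge> 2" and F: "finite F" "F \<subseteq> words"
  shows "(\<Sum>w\<in>F. height l w powr (-9/4)) \<le> 16"
proof -
  define A where "A = (\<Union>w\<in>F. set w)"
  define n where "n = Suc (Max (insert 0 (length ` F)))"
  define L where "L i = {w. set w \<subseteq> A \<and> length w = i}" for i
  have A: "finite A" "0 \<notin> A" using F by (auto simp: A_def words_def)
  have fin: "finite (L i)" for i unfolding L_def by (rule finite_lists_length_eq[OF A(1)])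
  have "F \<subseteq> (\<Union>i<n. L i)"
  proof
    fix w assume w: "w \<in> F"
    have "length w \<le> Max (insert 0 (length ` F))" using F w by (intro Max_ge) auto
    thus "w \<in> (\<Union>i<n. L i)" using w by (auto simp: L_def A_def n_def)
  qed
  hence "(\<Sum>w\<in>F. height l w powr (-9/4)) \<le> (\<Sum>w\<in>(\<Union>i<n. L i). height l w powr (-9/4))"
    by (intro sum_mono2) (use fin in auto)
  also have "\<dots> = (\<Sum>i<n. \<Sum>w\<in>L i. height l w powr (-9/4))"
    by (rule sum.UNION_disjoint) (use fin in \<open>auto simp: L_def\<close>)
  also have "\<dots> \<le> 16"
  proof -
    have "0 \<le> (\<Sum>w\<in>L n. height l w powr (-9/4) * (1 - (cusp l w)\<^sup>2) powr (-9/8))"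
      by (intro sum_nonneg) auto
    thus ?thesis using sum_height_powr_level_le[OF l A, of n] unfolding L_def by linarith
  qed
  finally show ?thesis .
qed

lemma
  assumes "l \<ge> 2"
  shows summable_height_powr: "(\<lambda>w. height l w powr (-9/4)) summable_on words"
    and infsum_height_powr_le: "(\<Sum>\<^sub>\<infinity>w\<in>words. height l w powr (-9/4)) \<le> 16"
proof -
  show s: "(\<lambda>w. height l w powr (-9/4)) summable_on words"
  proof (rule nonneg_bdd_above_summable_on)
    show "bdd_above (sum (\<lambda>w. height l w powr (-9/4)) ` {F. F \<subseteq> words \<and> finite F})"
      by (rule bdd_aboveI2[of _ _ 16]) (use sum_height_powr_le[OF assms] in auto)
  qed auto
  show "(\<Sum>\<^sub>\<infinity>w\<in>words. height l w powr (-9/4)) \<le> 16"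
    by (rule infsum_le_finite_sums[OF s]) (use sum_height_powr_le[OF assms] in auto)
qed

section \<open>Action and automorphy factor of words on the upper half plane\<close>

lemma cmod_powr_of_real: "cmod (z powr of_real a) = cmod z powr a"
  by (auto simp: powr_def)

lemma inverse_upper_half_plane:
  assumes "Im t > 0"
  shows "Im (of_real a - 1 / t) = Im t / (cmod t)\<^sup>2" "Im (of_real a - 1 / t) > 0"
proof -
  have "t \<noteq> 0" using assms by auto
  show "Im (of_real a - 1 / t) = Im t / (cmod t)\<^sup>2"
    by (simp add: Im_divide cmod_power2)
  thus "Im (of_real a - 1 / t) > 0" using assms \<open>t \<noteq> 0\<close> by simp
qed

lemma cmod_translate_inverse:
  fixes a :: real
  assumes "Im t > 0" "a \<noteq> 0"
  shows "cmod (of_real a - 1 / t) * cmod t = \<bar>a\<bar> * cmod (t + of_real (- 1 / a))"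
proof -
  have "t \<noteq> 0" using assms by auto
  hence "(of_real a - 1 / t) * t = of_real a * (t + of_real (- 1 / a))"
    using assms by (simp add: field_simps)
  thus ?thesis by (metis norm_mult norm_of_real)
qed

lemma
  assumes l: "l \<ge> 2" and "w \<in> words" "Im t > 0"
  shows Im_action: "Im (action l w t) = Im t / (radius l w t)\<^sup>2"
    and cmod_cocycle: "cmod (cocycle k l w t) = radius l w t powr (- k)"
proof -
  have *: "Im (action l w t) = Im t / (radius l w t)\<^sup>2 \<and>
        cmod (cocycle k l w t) = radius l w t powr (- k)"
    using assms(2,3)
  proof (induction w arbitrary: t)
    case Nil
    show ?case using inverse_upper_half_plane(1)[OF Nil(2), of 0] cmod_powr_of_real[of "- \<i> * t" "- k"]
      by (simp add: norm_mult)
  next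
    case (Cons m w)
    define X where "X = of_int m * l + cusp l w"
    have X: "\<bar>X\<bar> > 1" unfolding X_def
      by (rule abs_translate_gt_1[OF l abs_cusp_less_1[OF l]]) (use Cons in auto)
    have t0: "t \<noteq> 0" using Cons by auto
    define s where "s = of_int m * of_real l - 1 / t"
    have s': "s = of_real (of_int m * l) - 1 / t" by (simp add: s_def)
    have s: "Im s > 0" "Im s = Im t / (cmod t)\<^sup>2" unfolding s' using inverse_upper_half_plane Cons by blast+
    \<comment> \<open>The chain rule for the moduli of the denominators; both claims follow by
      inserting it.\<close>
    have key: "height l w * cmod (s + cusp l w) * cmod t = height l (m # w) * cmod (t + cusp l (m # w))"
    proof -
      have e: "s + cusp l w = of_real X - 1 / t" by (simp add: s_def X_def)
      show ?thesis unfolding e mult.assoc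
        using cmod_translate_inverse[OF Cons.prems(2), of X] X by (simp add: X_def)
    qed
    have "Im (action l (m # w) t) = Im s / (radius l w s)\<^sup>2"
      using Cons s by (simp add: s_def)
    also have "\<dots> = Im t / (height l w * cmod (s + cusp l w) * cmod t)\<^sup>2"
      by (simp add: s power_mult_distrib mult_ac)
    finally have 1: "Im (action l (m # w) t) = Im t / (height l (m # w) * cmod (t + cusp l (m # w)))\<^sup>2"
      unfolding key .
    have "cmod (cocycle k l (m # w) t) = cmod t powr (- k) * radius l w s powr (- k)"
      using Cons s cmod_powr_of_real[of "- \<i> * t" "- k"] by (simp add: s_def norm_mult)
    also have "\<dots> = (height l w * cmod (s + cusp l w) * cmod t) powr (- k)"
      by (subst powr_mult[symmetric]) (use height_ge_1[OF l, of w] Cons in \<open>auto simp: mult_ac\<close>)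
    finally show ?case using 1 unfolding key by blast
  qed
  show "Im (action l w t) = Im t / (radius l w t)\<^sup>2"
    "cmod (cocycle k l w t) = radius l w t powr (- k)" using * by blast+
qed

text \<open>Ping-pong: t -> -1/t sends the outside of the unit circle into the closed disc, and a
  shift by m l with |m l| >= 2 leads out again. For nonreal z^2 this bounds exp(\<i> pi z^2
  \<open>action\<close>), where positivity of the imaginary part does not help.\<close>

lemma cmod_action_le_1:
  assumes l: "l \<ge> 2" and "w \<in> words" "cmod t \<ge> 1"
  shows "cmod (action l w t) \<le> 1"
  using assms(2,3)
proof (induction w arbitrary: t)
  case Nil
  hence "1 / cmod t \<le> 1" by (subst divide_le_eq_1) auto
  thus ?case by (simp add: norm_divide)
next
  case (Cons m w)
  have "real_of_int \<bar>m\<bar> \<ge> 1" using Cons by (auto simp del: of_int_abs)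
  hence "1 * 2 \<le> \<bar>real_of_int m\<bar> * l" by (intro mult_mono) (use assms in auto)
  hence "cmod (of_int m * of_real l) \<ge> 2" using l by (simp add: norm_mult)
  moreover have "cmod (1 / t) \<le> 1" using Cons.prems by (auto simp: norm_divide divide_le_eq_1)
  ultimately have "cmod (of_int m * of_real l - 1 / t) \<ge> 1"
    using norm_triangle_ineq2[of "of_int m * of_real l" "1 / t"] by linarith
  thus ?case using Cons by auto
qed

lemma holomorphic_action_cocycle:
  "action l w holomorphic_on {t. Im t > 0} \<and> cocycle k l w holomorphic_on {t. Im t > 0}"
proof (induction w)
  case Nil
  show ?case by (auto intro!: holomorphic_intros simp: complex_nonpos_Reals_iff)
next
  case (Cons m w)
  have g: "(\<lambda>t. of_int m * of_real l - 1 / t) holomorphic_on {t. Im t > 0}"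
    by (auto intro!: holomorphic_intros)
  have im: "(\<lambda>t. of_int m * of_real l - 1 / t) ` {t. Im t > 0} \<subseteq> {t. Im t > 0}"
    using inverse_upper_half_plane(2)[of _ "of_int m * l"] by auto
  have p: "(\<lambda>t. (- \<i> * t) powr (- of_real k)) holomorphic_on {t. Im t > 0}"
    by (auto intro!: holomorphic_intros simp: complex_nonpos_Reals_iff)
  show ?case
    using holomorphic_on_compose_gen[OF g _ im, of "action l w"]
      holomorphic_on_mult[OF p holomorphic_on_compose_gen[OF g _ im, of "cocycle k l w"]] Cons
    by (auto simp: o_def)
qed

section \<open>Orbit sums\<close>

definition lattice_const :: real where
  "lattice_const = (\<Sum>\<^sub>\<infinity>m\<in>(UNIV::int set). (1 + \<bar>of_int m\<bar>) powr (-9/4))"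

lemma summable_lattice: "(\<lambda>m::int. (1 + \<bar>real_of_int m\<bar>) powr (-9/4)) summable_on UNIV"
proof -
  define f where "f = (\<lambda>m::int. (1 + \<bar>real_of_int m\<bar>) powr (-9/4))"
  have "summable (\<lambda>n. real (Suc n) powr (-9/4))"
    by (subst summable_Suc_iff) (subst summable_real_powr_iff, simp)
  hence 1: "(\<lambda>n. f (int n)) summable_on UNIV"
    unfolding f_def by (subst summable_on_UNIV_nonneg_real_iff) (auto simp: add_ac)
  have "bij_betw int UNIV {0..}" by (rule bij_betwI[of _ _ _ nat]) auto
  from summable_on_reindex_bij_betw[OF this, of f] have a: "f summable_on {0..}" using 1 by simp
  have "bij_betw (\<lambda>n. - int n) UNIV {..0}" by (rule bij_betwI[of _ _ _ "\<lambda>m. nat (- m)"]) auto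
  from summable_on_reindex_bij_betw[OF this, of f] have b: "f summable_on {..0}"
    using 1 by (simp add: f_def)
  have "f summable_on ({..0} \<union> {0<..})"
    by (rule summable_on_Un_disjoint[OF b]) (auto intro: summable_on_subset_banach[OF a])
  moreover have "{..0} \<union> {0<..} = (UNIV :: int set)" by auto
  ultimately show ?thesis by (simp add: f_def)
qed

lemma lattice_const_nonneg: "lattice_const \<ge> 0"
  unfolding lattice_const_def by (rule infsum_nonneg) auto

abbreviation decay :: "real \<Rightarrow> int list \<Rightarrow> int \<Rightarrow> real" where
  "decay l w m \<equiv> height l w powr (-9/4) * (1 + \<bar>of_int m\<bar>) powr (-9/4)"

abbreviation shift :: "real \<Rightarrow> int \<Rightarrow> complex \<Rightarrow> complex" where
  "shift l m t \<equiv> t + of_int m * of_real l"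

text \<open>The Gaussian exp(\<i> pi z^2 t) under the weight \<open>k\<close> slash action of the
  word; for z = |x| it is the function phi moved by that word.\<close>

definition wave :: "real \<Rightarrow> real \<Rightarrow> complex \<Rightarrow> int list \<Rightarrow> complex \<Rightarrow> complex" where
  "wave k l z w t = cocycle k l w t * exp (\<i> * of_real pi * z\<^sup>2 * action l w t)"

text \<open>The arbitrary last letter is kept apart from the word, as a shift of the argument, so
  that invariance under t -> t + l is visible.\<close>

definition orbit_sum :: "real \<Rightarrow> real \<Rightarrow> int list set \<Rightarrow> complex \<Rightarrow> complex \<Rightarrow> complex" where
  "orbit_sum k l W z t = (\<Sum>\<^sub>\<infinity>(w, m)\<in>W \<times> UNIV. wave k l z w (shift l m t))"

lemma has_sum_word_lattice:
  assumes l: "l \<ge> 2"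
  shows "((\<lambda>(w, m::int). decay l w m)
     has_sum ((\<Sum>\<^sub>\<infinity>w\<in>words. height l w powr (-9/4)) * lattice_const)) (words \<times> UNIV)"
proof -
  define f where "f = (\<lambda>(w, m::int). decay l w m)"
  have 1: "((\<lambda>m. f (w, m)) has_sum (height l w powr (-9/4) * lattice_const)) UNIV" for w
    unfolding f_def lattice_const_def using has_sum_infsum[OF summable_lattice]
    by (auto intro!: has_sum_cmult_right)
  have 2: "((\<lambda>w. height l w powr (-9/4) * lattice_const) has_sum
      ((\<Sum>\<^sub>\<infinity>w\<in>words. height l w powr (-9/4)) * lattice_const)) words"
    by (intro has_sum_cmult_left has_sum_infsum summable_height_powr l)
  have "f summable_on (words \<times> UNIV)"
    by (rule summable_on_SigmaI[OF 1]) (use 2 in \<open>auto simp: f_def summable_on_def\<close>)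
  from has_sum_SigmaI[OF 1 2 this] show ?thesis by (simp add: f_def)
qed

text \<open>The Weierstrass test on one ball around one point, because the majorants used later
  depend on that point.\<close>

lemma infsum_field_differentiable:
  fixes f :: "'a \<Rightarrow> complex \<Rightarrow> complex"
  assumes r: "r > 0" and hol: "\<And>p. p \<in> I \<Longrightarrow> f p holomorphic_on cball z r"
    and bound: "\<And>p x. p \<in> I \<Longrightarrow> x \<in> cball z r \<Longrightarrow> cmod (f p x) \<le> M p" and M: "M summable_on I"
  shows "(\<lambda>x. \<Sum>\<^sub>\<infinity>p\<in>I. f p x) field_differentiable at z"
proof -
  have "(\<lambda>x. \<Sum>p\<in>X. f p x) holomorphic_on cball z r" if "X \<subseteq> I" for X
    by (intro holomorphic_intros hol) (use that in auto)
  hence "\<forall>\<^sub>F X in finite_subsets_at_top I. continuous_on (cball z r) (\<lambda>x. \<Sum>p\<in>X. f p x) \<and>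
      (\<lambda>x. \<Sum>p\<in>X. f p x) holomorphic_on ball z r"
    by (intro eventually_finite_subsets_at_top_weakI conjI holomorphic_on_imp_continuous_on)
       (auto intro: holomorphic_on_subset[OF _ ball_subset_cball])
  from holomorphic_uniform_limit[OF this Weierstrass_m_test_general[OF bound M]]
  have "(\<lambda>x. \<Sum>\<^sub>\<infinity>p\<in>I. f p x) holomorphic_on ball z r" by auto
  thus ?thesis using r holomorphic_on_imp_differentiable_at[of _ "ball z r" z] by auto
qed

text \<open>The right side is the maximum over u, attained at u = s / c; the inequality is v <= exp
  (v - 1) for v = c u / s.\<close>

lemma powr_mult_exp_le:
  fixes u c s :: real
  assumes "u > 0" "c > 0" "s > 0"
  shows "u powr s * exp (- c * u) \<le> (s / (exp 1 * c)) powr s"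
proof -
  define v where "v = c * u / s"
  have v: "v > 0" using assms by (simp add: v_def)
  have "v \<le> exp (v - 1)" using exp_ge_add_one_self[of "v - 1"] by simp
  hence "v powr s \<le> exp (v - 1) powr s" by (intro powr_mono2) (use assms v in auto)
  also have "exp (v - 1) powr s = exp (c * u) / exp 1 powr s"
    using assms by (simp add: powr_def v_def exp_diff[symmetric] algebra_simps)
  finally have "v powr s * exp 1 powr s \<le> exp (c * u)" by (simp add: field_simps)
  moreover have "u powr s = v powr s * exp 1 powr s * (s / (exp 1 * c)) powr s"
    using assms v by (simp add: v_def flip: powr_mult)
  ultimately have "u powr s \<le> exp (c * u) * (s / (exp 1 * c)) powr s"
    by (simp add: mult_right_mono)
  thus ?thesis by (simp add: exp_minus field_simps)
qed

text \<open>The bound 5/2 is the value of d / 2 for d = 5. It gives k - 9/4 >= 1/4, from which the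
  numbers 28, 54 and 8100 arise.\<close>

locale interpolation =
  fixes k l :: real
  assumes k_ge: "k \<ge> 5/2" and l_ge: "l \<ge> 2"
begin

text \<open>The radius is the height times the distance of the shifted t from minus the cusp. The
  hypothesis \<open>lat\<close> compares this distance with 1 + |m| uniformly over all cusps, so the
  double sum is dominated by the product of the height sum, at most 16, and
  \<open>lattice_const\<close>.\<close>

lemma abs_summable_orbit:
  assumes W: "W \<subseteq> words" and K: "K > 0"
    and lat: "\<And>m x. \<bar>x\<bar> < 1 \<Longrightarrow> 1 + \<bar>real_of_int m\<bar> \<le> K * cmod (t + of_int m * of_real l + of_real x)"
    and B: "B \<ge> 0" "\<And>w m. w \<in> W \<Longrightarrow> cmod (wave k l z w (shift l m t)) \<le>
        B * radius l w (shift l m t) powr (-9/4)"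
  shows wave_le: "\<And>w m. w \<in> W \<Longrightarrow> cmod (wave k l z w (shift l m t)) \<le>
        B * K powr (9/4) * (decay l w m)"
    and "(\<lambda>(w, m). cmod (wave k l z w (shift l m t))) summable_on (W \<times> UNIV)"
    and "cmod (orbit_sum k l W z t) \<le> 16 * lattice_const * B * K powr (9/4)"
proof -
  show le: "cmod (wave k l z w (shift l m t)) \<le>
        B * K powr (9/4) * (decay l w m)" if w: "w \<in> W" for w m
  proof -
    define c where "c = cmod (t + of_int m * of_real l + cusp l w)"
    have c: "1 + \<bar>real_of_int m\<bar> \<le> K * c"
      unfolding c_def by (rule lat) (use abs_cusp_less_1[OF l_ge] w W in auto)
    hence "K * c > 0" by linarith
    hence cpos: "c > 0" using K by (simp add: zero_less_mult_iff)
    have s: "height l w \<ge> 1" using height_ge_1[OF l_ge] w W by auto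
    have "c powr (-9/4) = K powr (9/4) * (K * c) powr (-9/4)"
      using K cpos by (simp add: powr_mult powr_minus field_simps)
    also have "\<dots> \<le> K powr (9/4) * (1 + \<bar>of_int m\<bar>) powr (-9/4)"
      by (intro mult_left_mono powr_mono2') (use c in auto)
    finally have "height l w powr (-9/4) * c powr (-9/4) \<le>
        height l w powr (-9/4) * (K powr (9/4) * (1 + \<bar>of_int m\<bar>) powr (-9/4))"
      by (intro mult_left_mono) auto
    moreover have "(height l w * c) powr (-9/4) = height l w powr (-9/4) * c powr (-9/4)"
      using s cpos by (simp add: powr_mult)
    ultimately have "B * (height l w * c) powr (-9/4) \<le>
        B * (height l w powr (-9/4) * (K powr (9/4) * (1 + \<bar>of_int m\<bar>) powr (-9/4)))"
      by (intro mult_left_mono) (use B in auto)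
    thus ?thesis using B(2)[OF w, of m] unfolding c_def by (simp add: mult_ac)
  qed
  define g where "g = (\<lambda>(w, m::int). decay l w m)"
  define C where "C = B * K powr (9/4)"
  note hs = has_sum_word_lattice[OF l_ge, folded g_def]
  have gs: "g summable_on (words \<times> UNIV)" using hs by (auto simp: summable_on_def)
  have gs': "g summable_on (W \<times> UNIV)" by (rule summable_on_subset_banach[OF gs]) (use W in auto)
  have Cgs: "(\<lambda>p. C * g p) summable_on (W \<times> UNIV)" by (rule summable_on_cmult_right[OF gs'])
  have le': "norm (case p of (w, m) \<Rightarrow> wave k l z w (shift l m t)) \<le> C * g p"
    if "p \<in> W \<times> UNIV" for p using le that by (auto simp: g_def C_def)
  have ab: "(\<lambda>p. norm (case p of (w, m) \<Rightarrow> wave k l z w (shift l m t))) summable_on (W \<times> UNIV)"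
    by (rule Infinite_Sum.abs_summable_on_comparison_test'[OF Cgs le'])
  thus "(\<lambda>(w, m). cmod (wave k l z w (shift l m t))) summable_on (W \<times> UNIV)"
    by (simp add: case_prod_unfold)
  have "cmod (orbit_sum k l W z t) \<le>
      (\<Sum>\<^sub>\<infinity>p\<in>W \<times> UNIV. norm (case p of (w, m) \<Rightarrow> wave k l z w (shift l m t)))"
    unfolding orbit_sum_def by (rule norm_infsum_bound[OF ab])
  also have "\<dots> \<le> (\<Sum>\<^sub>\<infinity>p\<in>W \<times> UNIV. C * g p)"
    by (rule infsum_mono[OF ab Cgs le'])
  also have "\<dots> = C * (\<Sum>\<^sub>\<infinity>p\<in>W \<times> UNIV. g p)" by (rule infsum_cmult_right[OF gs'])
  also have "\<dots> \<le> C * (16 * lattice_const)"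
  proof (rule mult_left_mono)
  have "(\<Sum>\<^sub>\<infinity>p\<in>W \<times> UNIV. g p) \<le> (\<Sum>\<^sub>\<infinity>p\<in>words \<times> UNIV. g p)"
    by (rule infsum_mono_neutral[OF gs' gs]) (use W in \<open>auto simp: g_def\<close>)
  also have "\<dots> = (\<Sum>\<^sub>\<infinity>w\<in>words. height l w powr (-9/4)) * lattice_const"
    using hs by (rule infsumI)
  also have "\<dots> \<le> 16 * lattice_const"
    by (intro mult_right_mono infsum_height_powr_le l_ge lattice_const_nonneg)
  finally show "(\<Sum>\<^sub>\<infinity>p\<in>W \<times> UNIV. g p) \<le> 16 * lattice_const" .
  qed (use B in \<open>auto simp: C_def\<close>)
  finally show "cmod (orbit_sum k l W z t) \<le> 16 * lattice_const * B * K powr (9/4)"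
    using B(1) by (simp add: C_def mult_ac)
qed

lemma summable_majorant:
  assumes "W \<subseteq> words"
  shows "(\<lambda>(w, m::int). C * (decay l w m)) summable_on (W \<times> UNIV)"
proof -
  have "(\<lambda>p. C * (case p of (w, m::int) \<Rightarrow> decay l w m))
      summable_on (words \<times> UNIV)"
    by (intro summable_on_cmult_right) (use has_sum_word_lattice[OF l_ge] in \<open>auto simp: summable_on_def\<close>)
  hence "(\<lambda>p. C * (case p of (w, m::int) \<Rightarrow> decay l w m))
      summable_on (W \<times> UNIV)"
    by (rule summable_on_subset_banach) (use assms in auto)
  thus ?thesis by (simp add: case_prod_unfold)
qed

text \<open>The constant depends on |Re t|, which is good enough for absolute and locally uniform
  convergence.\<close>

lemma lattice_point_le_local:
  assumes "\<bar>Re t\<bar> \<le> A" "Im t \<ge> y" "y > 0" "\<bar>x\<bar> < 1"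
  shows "1 + \<bar>real_of_int m\<bar> \<le> (1 + (A + 2) / y) * cmod (t + of_int m * of_real l + of_real x)"
proof -
  define c where "c = cmod (t + of_int m * of_real l + of_real x)"
  have "\<bar>real_of_int m\<bar> * 1 \<le> \<bar>real_of_int m\<bar> * l" by (intro mult_left_mono) (use l_ge in auto)
  also have "\<dots> = \<bar>of_int m * l\<bar>" using l_ge by (simp add: abs_mult)
  also have "\<dots> \<le> \<bar>Re t + of_int m * l + x\<bar> + A + 1" using assms by linarith
  also have "\<bar>Re t + of_int m * l + x\<bar> \<le> c"
    using abs_Re_le_cmod[of "t + of_int m * of_real l + of_real x"] by (simp add: c_def)
  finally have 1: "\<bar>real_of_int m\<bar> \<le> c + A + 1" by simp
  have "y \<le> c" using abs_Im_le_cmod[of "t + of_int m * of_real l + of_real x"] assms by (simp add: c_def)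
  hence "1 \<le> c / y" using assms by simp
  hence "(A + 2) * 1 \<le> (A + 2) * (c / y)" by (intro mult_left_mono) (use assms in auto)
  hence "A + 2 \<le> (A + 2) / y * c" by simp
  hence "1 + \<bar>real_of_int m\<bar> \<le> (1 + (A + 2) / y) * c" using 1 by (simp add: algebra_simps)
  thus ?thesis by (simp add: c_def)
qed

text \<open>With Re t in one period the constant is free of \<open>l\<close>: if c is the modulus on
  the right, then |m| l <= c + l, and c / l <= c. This keeps the final bounds absolute.\<close>

lemma lattice_point_le_periodic:
  assumes "\<bar>Re t\<bar> \<le> l / 2" "Im t > 0" "\<bar>x\<bar> < 1"
  shows "1 + \<bar>real_of_int m\<bar> \<le> (2 * (1 + 1 / Im t)) * cmod (t + of_int m * of_real l + of_real x)"
proof -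
  define c where "c = cmod (t + of_int m * of_real l + of_real x)"
  define y where "y = Im t"
  have "\<bar>real_of_int m\<bar> * l = \<bar>of_int m * l\<bar>" using l_ge by (simp add: abs_mult)
  also have "\<dots> \<le> \<bar>Re t + of_int m * l + x\<bar> + l" using assms l_ge by linarith
  also have "\<bar>Re t + of_int m * l + x\<bar> \<le> c"
    using abs_Re_le_cmod[of "t + of_int m * of_real l + of_real x"] by (simp add: c_def)
  finally have "\<bar>real_of_int m\<bar> * l \<le> c + l" by simp
  also have "c + l = (c / l + 1) * l" using l_ge by (simp add: distrib_right)
  finally have "\<bar>real_of_int m\<bar> \<le> c / l + 1" using l_ge by simp
  also have "c / l \<le> c" using l_ge mult_left_mono[of 1 l c] by (simp add: c_def field_simps)
  finally have 1: "\<bar>real_of_int m\<bar> \<le> c + 1" by simp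
  have "y \<le> c" using abs_Im_le_cmod[of "t + of_int m * of_real l + of_real x"] assms by (simp add: c_def y_def)
  hence "2 \<le> 2 / y * c" "c \<ge> 0" using assms by (simp_all add: field_simps y_def)
  hence "1 + \<bar>real_of_int m\<bar> \<le> (2 * (1 + 1 / y)) * c" using 1 by (simp add: algebra_simps)
  thus ?thesis by (simp add: c_def y_def)
qed

text \<open>The radius is at least Im t, because heights are at least 1. Of the power radius^(-k) in
  the automorphy factor, the part with exponent k - 9/4 becomes a power of Im t, and radius^(-9/4)
  is kept for the summation.\<close>

lemma cmod_wave_le_powr:
  assumes w: "w \<in> words" and t: "Im t > 0"
    and E: "cmod (exp (\<i> * of_real pi * z\<^sup>2 * action l w t)) \<le> E"
  shows "cmod (wave k l z w t) \<le> E * Im t powr (- (k - 9/4)) * radius l w t powr (-9/4)"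
proof -
  define q where "q = height l w * cmod (t + cusp l w)"
  have "1 * Im t \<le> q" unfolding q_def
    by (intro mult_mono) (use height_ge_1[OF l_ge w] t abs_Im_le_cmod[of "t + cusp l w"] in auto)
  hence q: "q \<ge> Im t" "q > 0" using t by auto
  have E0: "E \<ge> 0" using E norm_ge_zero order_trans by blast
  have "cmod (wave k l z w t) \<le> q powr (- k) * E"
    using E by (simp add: wave_def norm_mult cmod_cocycle[OF l_ge w t] q_def mult_left_mono)
  also have "q powr (- k) = q powr (- (k - 9/4)) * q powr (-9/4)"
    using powr_add[of q "- (k - 9/4)" "-9/4"] by simp
  also have "\<dots> \<le> Im t powr (- (k - 9/4)) * q powr (-9/4)"
    by (intro mult_right_mono powr_mono2') (use q t k_ge in auto)
  finally show ?thesis using E0 by (simp add: q_def mult_ac mult_right_mono)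
qed

lemma cmod_wave_real_le:
  assumes w: "w \<in> words" and t: "Im t > 0"
  shows "cmod (wave k l (of_real r) w t) \<le>
    Im t powr (- (k - 9/4)) * radius l w t powr (-9/4)"
proof -
  have "Im (action l w t) \<ge> 0" using Im_action[OF l_ge w t] t by simp
  hence "cmod (exp (\<i> * of_real pi * (of_real r)\<^sup>2 * action l w t)) \<le> 1"
    by (simp flip: of_real_power)
  from cmod_wave_le_powr[OF w t this] show ?thesis by simp
qed

text \<open>The restriction to Im t >= 1 keeps the orbit in the unit disc, so the exponential is
  bounded whatever the argument of z^2.\<close>

lemma cmod_wave_complex_le:
  assumes w: "w \<in> words" and t: "Im t \<ge> 1"
  shows "cmod (wave k l z w t) \<le>
    exp (pi * (cmod z)\<^sup>2) * Im t powr (- (k - 9/4)) * radius l w t powr (-9/4)"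
proof (rule cmod_wave_le_powr[OF w])
  have "cmod t \<ge> 1" using t abs_Im_le_cmod[of t] by linarith
  hence a: "cmod (action l w t) \<le> 1" by (rule cmod_action_le_1[OF l_ge w])
  have "cmod (exp (\<i> * of_real pi * z\<^sup>2 * action l w t)) \<le> exp (cmod (\<i> * of_real pi * z\<^sup>2 * action l w t))"
    by (rule norm_exp)
  also have "\<dots> \<le> exp (pi * (cmod z)\<^sup>2)"
    using mult_left_mono[OF a, of "pi * (cmod z)\<^sup>2"] by (simp add: norm_mult norm_power)
  finally show "cmod (exp (\<i> * of_real pi * z\<^sup>2 * action l w t)) \<le> exp (pi * (cmod z)\<^sup>2)" .
qed (use t in auto)

text \<open>Here the Gaussian is not simply bounded by 1: its modulus is exp(-pi r^2 Im t u) with u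
  = 1 / radius^2, and the surplus power radius^(-2 s) is u^s. Maximising their product over u
  removes the radius and yields the decay r^(-2 s).\<close>

lemma cmod_wave_decay_le:
  assumes w: "w \<in> words" and t: "Im t > 0" and r: "r > 0"
  defines "s \<equiv> (k - 9/4) / 2"
  shows "cmod (wave k l (of_real r) w t) \<le>
    (s / (exp 1 * (pi * r\<^sup>2 * Im t))) powr s * radius l w t powr (-9/4)"
proof -
  define q where "q = height l w * cmod (t + cusp l w)"
  have "1 * Im t \<le> q" unfolding q_def
    by (intro mult_mono) (use height_ge_1[OF l_ge w] t abs_Im_le_cmod[of "t + cusp l w"] in auto)
  hence q: "q > 0" using t by auto
  have s: "s > 0" using k_ge by (simp add: s_def)
  have "cmod (wave k l (of_real r) w t) = q powr (- k) * exp (- (pi * r\<^sup>2 * Im t / q\<^sup>2))"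
    by (simp add: wave_def norm_mult cmod_cocycle[OF l_ge w t] Im_action[OF l_ge w t] q_def flip: of_real_power)
  also have "q powr (- k) = q powr (- (2 * s)) * q powr (-9/4)"
  proof -
    have "- k = - (2 * s) + (-9/4)" by (simp add: s_def field_simps)
    thus ?thesis by (simp only: powr_add)
  qed
  also have "q powr (- (2 * s)) = (1 / q\<^sup>2) powr s"
  proof -
    have "(q\<^sup>2) powr s = q powr (2 * s)" using q by (simp add: power2_powr)
    thus ?thesis using q by (simp only: powr_minus_divide powr_divide) simp
  qed
  also have "(1 / q\<^sup>2) powr s * q powr (-9/4) * exp (- (pi * r\<^sup>2 * Im t / q\<^sup>2)) =
      (1 / q\<^sup>2) powr s * exp (- (pi * r\<^sup>2 * Im t) * (1 / q\<^sup>2)) * q powr (-9/4)" by simp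
  also have "\<dots> \<le> (s / (exp 1 * (pi * r\<^sup>2 * Im t))) powr s * q powr (-9/4)"
    by (intro mult_right_mono powr_mult_exp_le) (use q r t s in auto)
  finally show ?thesis by (simp add: q_def)
qed

section \<open>Periodicity, bounds and holomorphy of the orbit sums\<close>

lemma orbit_sum_periodic:
  "orbit_sum k l W z (t + of_real l) = orbit_sum k l W z t"
proof -
  define h where "h = (\<lambda>(w :: int list, m :: int). (w, m + 1))"
  have "bij_betw h (W \<times> UNIV) (W \<times> UNIV)"
    unfolding h_def by (rule bij_betwI[of _ _ _ "\<lambda>(w, m). (w, m - 1)"]) auto
  from infsum_reindex_bij_betw[OF this, of "\<lambda>(w, m). wave k l z w (shift l m t)"]
  show ?thesis by (simp add: orbit_sum_def h_def case_prod_unfold algebra_simps)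
qed

lemma orbit_sum_periodic_int:
  "orbit_sum k l W z (t + of_int j * of_real l) = orbit_sum k l W z t"
proof -
  have nat: "orbit_sum k l W z (t + of_nat n * of_real l) = orbit_sum k l W z t" for n t
  proof (induction n)
    case (Suc n)
    have "t + of_nat (Suc n) * of_real l = t + of_nat n * of_real l + of_real l" by (simp add: algebra_simps)
    thus ?case using Suc orbit_sum_periodic[of W z "t + of_nat n * of_real l"] by (simp only:)
  qed simp
  show ?thesis
  proof (cases j)
    case (nonneg n)
    thus ?thesis using nat[of t n] by simp
  next
    case (neg n)
    have "t + of_int j * of_real l + of_nat (Suc n) * of_real l = t" by (simp add: neg algebra_simps)
    thus ?thesis using nat[of "t + of_int j * of_real l" "Suc n"] by (simp only:)
  qed
qed

lemma cmod_orbit_sum_le: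
  assumes W: "W \<subseteq> words" and t: "Im t > 0" and B: "B \<ge> 0"
    "\<And>w s. w \<in> W \<Longrightarrow> Im s = Im t \<Longrightarrow>
      cmod (wave k l z w s) \<le> B * radius l w s powr (-9/4)"
  shows "cmod (orbit_sum k l W z t) \<le> 16 * lattice_const * B * (2 * (1 + 1 / Im t)) powr (9/4)"
proof -
  \<comment> \<open>Periodicity moves t into the strip |Re t| <= l/2, where the comparison constant
    does not involve \<open>l\<close>.\<close>
  define j where "j = - round (Re t / l)"
  define t' where "t' = t + of_int j * of_real l"
  have im: "Im t' = Im t" by (simp add: t'_def)
  have "\<bar>Re t'\<bar> \<le> l / 2"
  proof -
    have "\<bar>of_int (round (Re t / l)) - Re t / l\<bar> \<le> 1 / 2" by (rule of_int_round_abs_le)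
    hence "\<bar>of_int (round (Re t / l)) - Re t / l\<bar> * l \<le> 1 / 2 * l"
      by (intro mult_right_mono) (use l_ge in auto)
    moreover have "\<bar>of_int (round (Re t / l)) - Re t / l\<bar> * l = \<bar>(of_int (round (Re t / l)) - Re t / l) * l\<bar>"
      using l_ge by (simp add: abs_mult)
    moreover have "(of_int (round (Re t / l)) - Re t / l) * l = - Re t'"
      using l_ge by (simp add: t'_def j_def algebra_simps)
    ultimately show ?thesis by simp
  qed
  hence "cmod (orbit_sum k l W z t') \<le> 16 * lattice_const * B * (2 * (1 + 1 / Im t')) powr (9/4)"
    by (intro abs_summable_orbit(3)[OF W _ lattice_point_le_periodic])
       (use t im B in \<open>auto intro!: add_pos_pos\<close>)
  thus ?thesis by (simp add: im t'_def orbit_sum_periodic_int)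
qed

lemma abs_summable_orbit':
  assumes W: "W \<subseteq> words" and t: "Im t > 0" and B: "B \<ge> 0"
    "\<And>w s. w \<in> W \<Longrightarrow> Im s = Im t \<Longrightarrow>
      cmod (wave k l z w s) \<le> B * radius l w s powr (-9/4)"
  shows "(\<lambda>(w, m). cmod (wave k l z w (shift l m t))) summable_on (W \<times> UNIV)"
  by (rule abs_summable_orbit(2)[OF W _ lattice_point_le_local[OF order.refl order.refl t] B(1)])
     (use t B in \<open>auto intro!: add_pos_nonneg\<close>)

lemma orbit_sum_holomorphic_at:
  assumes W: "W \<subseteq> words" and y: "y > 0" and B: "B \<ge> 0"
    "\<And>w s. w \<in> W \<Longrightarrow> Im s > y \<Longrightarrow>
      cmod (wave k l z w s) \<le> B * radius l w s powr (-9/4)"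
  shows "orbit_sum k l W z holomorphic_on {t. Im t > y}"
proof -
  have "orbit_sum k l W z field_differentiable at t0" if t0: "Im t0 > y" for t0
  proof -
    define e where "e = (Im t0 - y) / 2"
    have e: "e > 0" using t0 by (simp add: e_def)
    have sub: "Im t > y \<and> \<bar>Re t\<bar> \<le> \<bar>Re t0\<bar> + e" if "t \<in> cball t0 e" for t
    proof -
      have "\<bar>Re (t - t0)\<bar> \<le> e" "\<bar>Im (t - t0)\<bar> \<le> e"
        using that abs_Re_le_cmod[of "t - t0"] abs_Im_le_cmod[of "t - t0"]
        by (auto simp: dist_norm norm_minus_commute)
      moreover have "Im t0 = 2 * e + y" by (simp add: e_def field_simps)
      ultimately show ?thesis using e by auto
    qed
    define K where "K = 1 + (\<bar>Re t0\<bar> + e + 2) / y"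
    have K: "K > 0" using e y by (auto simp: K_def intro!: add_pos_nonneg)
    have hw: "(\<lambda>t. wave k l z w (shift l m t)) holomorphic_on {t. Im t > 0}" for w m
    proof -
      have g: "(\<lambda>t. t + of_int m * of_real l) holomorphic_on {t. Im t > 0}" by (intro holomorphic_intros)
      have im: "(\<lambda>t. t + of_int m * of_real l) ` {t. Im t > 0} \<subseteq> {t. Im t > 0}" by auto
      have "wave k l z w holomorphic_on {t. Im t > 0}"
        unfolding wave_def [abs_def] using holomorphic_action_cocycle[of l w k]
        by (auto intro!: holomorphic_intros)
      from holomorphic_on_compose_gen[OF g this im] show ?thesis by (simp add: o_def)
    qed
    have pos: "cball t0 e \<subseteq> {t. Im t > 0}" using sub y by fastforce
    have "(\<lambda>t. \<Sum>\<^sub>\<infinity>p\<in>W \<times> UNIV. wave k l z (fst p) (t + of_int (snd p) * of_real l)) field_differentiable at t0"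
    proof (rule infsum_field_differentiable[OF e _ _ summable_majorant[OF W]])
      fix p :: "int list \<times> int" and t assume p: "p \<in> W \<times> UNIV" and t: "t \<in> cball t0 e"
      have "cmod (wave k l z (fst p) (t + of_int (snd p) * of_real l)) \<le>
          B * K powr (9/4) * (height l (fst p) powr (-9/4) * (1 + \<bar>of_int (snd p)\<bar>) powr (-9/4))"
        by (rule wave_le[OF W K _ B(1)])
           (use p lattice_point_le_local sub[OF t] y B in \<open>auto simp: K_def\<close>)
      thus "cmod (wave k l z (fst p) (t + of_int (snd p) * of_real l)) \<le>
          (case p of (w, m) \<Rightarrow> B * K powr (9/4) * (decay l w m))"
        by (simp add: case_prod_unfold)
    qed (use holomorphic_on_subset[OF hw pos] in blast)
    thus ?thesis by (simp add: orbit_sum_def [abs_def] case_prod_unfold)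
  qed
  thus ?thesis by (simp add: holomorphic_on_def field_differentiable_at_within)
qed

end

section \<open>Fourier coefficients of periodic functions\<close>

abbreviation nome_log :: "real \<Rightarrow> complex \<Rightarrow> complex" where
  "nome_log l q \<equiv> of_real l / (2 * of_real pi * \<i>) * Ln q"

text \<open>For \<open>l\<close>-periodic \<open>F\<close> this is \<open>F\<close> as a function of \<open>q = exp (2 \<pi> \<i> t / l)\<close>: the branch cut of \<open>Ln\<close>
  is invisible by periodicity, and the value at \<open>q = 0\<close> is the limit of \<open>F\<close> at \<open>\<i> \<infinity>\<close>.\<close>

definition nome_lift :: "real \<Rightarrow> (complex \<Rightarrow> complex) \<Rightarrow> complex \<Rightarrow> complex" where
  "nome_lift l F q = (if q = 0 then 0 else F (nome_log l q))"

definition fourier_coeff :: "real \<Rightarrow> (complex \<Rightarrow> complex) \<Rightarrow> nat \<Rightarrow> complex" where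
  "fourier_coeff l F n = (deriv ^^ n) (nome_lift l F) 0 / fact n"

text \<open>\<open>tendsto_0\<close> is uniform in Re t: it makes the lift to the nome disc
  continuous at q = 0 with value 0, so that the singularity there is removable. The orbit sums use
  every positive \<open>y0\<close> for real z, and \<open>y0\<close> = 1 for complex z.\<close>

locale periodic_upper =
  fixes l y0 :: real and F :: "complex \<Rightarrow> complex"
  assumes l_pos: "l > 0" and hol: "F holomorphic_on {t. Im t > y0}"
    and periodic: "\<And>t (j::int). F (t + of_int j * of_real l) = F t"
    and tendsto_0: "\<And>e. e > 0 \<Longrightarrow> \<exists>Y. \<forall>t. Im t > Y \<longrightarrow> cmod (F t) < e"
begin

lemma Im_nome_log:
  assumes "q \<noteq> 0"
  shows "Im (nome_log l q) = - (l / (2 * pi)) * ln (cmod q)"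
proof -
  have "nome_log l q = of_real (l / (2 * pi)) * (- \<i> * Ln q)"
    by (simp add: field_simps)
  hence "Im (nome_log l q) = l / (2 * pi) * Im (- \<i> * Ln q)"
    by (simp only: Im_complex_of_real times_complex.simps Re_complex_of_real mult_zero_left add_0_right)
  thus ?thesis using assms by simp
qed

lemma Im_nome_log_gt:
  assumes "q \<noteq> 0" "cmod q < exp (- 2 * pi * Y / l)"
  shows "Im (nome_log l q) > Y"
proof -
  have "ln (cmod q) < - 2 * pi * Y / l" using assms ln_less_cancel_iff[of "cmod q" "exp (- 2 * pi * Y / l)"] by simp
  hence "l / (2 * pi) * ln (cmod q) < l / (2 * pi) * (- 2 * pi * Y / l)"
    by (intro mult_strict_left_mono) (use l_pos in auto)
  also have "\<dots> = - Y" using l_pos by simp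
  finally show ?thesis unfolding Im_nome_log[OF assms(1)] by simp
qed

lemma nome_lift_exp: "nome_lift l F (exp (2 * of_real pi * \<i> * t / of_real l)) = F t"
proof -
  define u where "u = 2 * of_real pi * \<i> * t / of_real l"
  have "exp (Ln (exp u)) = exp u" by simp
  then obtain n :: int where n: "Ln (exp u) = u + of_int (2 * n) * of_real pi * \<i>"
    using exp_eq by force
  have "nome_log l (exp u) = t + of_int n * of_real l"
  proof -
    have "of_real l / (2 * of_real pi * \<i>) * u = t" using l_pos by (simp add: u_def)
    moreover have "of_real l / (2 * of_real pi * \<i>) * (of_int (2 * n) * of_real pi * \<i>) = of_int n * of_real l"
      by (simp, simp add: complex_eq_iff)
    ultimately show ?thesis unfolding n distrib_left by simp
  qed
  thus ?thesis by (simp add: nome_lift_def periodic flip: u_def)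
qed

text \<open>Near a nonzero q0 the logarithm of q / q0 avoids the branch cut and gives a holomorphic
  preimage in the half plane, even where \<open>Ln q\<close> jumps. At 0 continuity suffices, since
  the singularity is isolated.\<close>

lemma nome_lift_holomorphic: "nome_lift l F holomorphic_on ball 0 (exp (- 2 * pi * y0 / l))"
proof (rule no_isolated_singularity[of _ _ "{0}"])
  let ?B = "ball (0::complex) (exp (- 2 * pi * y0 / l))"
  have fd: "nome_lift l F field_differentiable (at q0)" if q0: "q0 \<in> ?B" "q0 \<noteq> 0" for q0
  proof -
    define t0 where "t0 = of_real l / (2 * of_real pi * \<i>) * Ln q0"
    define T where "T q = t0 + of_real l / (2 * of_real pi * \<i>) * Ln (q / q0)" for q
    define S where "S = ?B \<inter> ball q0 (cmod q0)"
    have S: "open S" "q0 \<in> S" using q0 by (auto simp: S_def)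
    have Re: "Re (q / q0) > 0" if "q \<in> S" for q
    proof -
      have "cmod (q / q0 - 1) = cmod (q - q0) / cmod q0" using q0 by (simp add: diff_divide_distrib flip: norm_divide)
      also have "\<dots> < 1" using that q0 by (simp add: S_def dist_norm norm_minus_commute)
      finally have "\<bar>Re (q / q0 - 1)\<bar> < 1" using abs_Re_le_cmod[of "q / q0 - 1"] by linarith
      thus ?thesis by simp
    qed
    have qnz: "q \<noteq> 0" if "q \<in> S" for q using Re[OF that] by auto
    have expT: "exp (2 * of_real pi * \<i> * T q / of_real l) = q" if "q \<in> S" for q
    proof -
      have "2 * of_real pi * \<i> * T q / of_real l = Ln q0 + Ln (q / q0)"
        unfolding T_def t0_def using l_pos by (simp add: field_simps)
      thus ?thesis using q0 qnz[OF that] by (simp add: exp_add)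
    qed
    have ImT: "Im (T q) > y0" if "q \<in> S" for q
    proof -
      have "Im (nome_log l q) = Im (T q)"
      proof -
        have "T q = of_real l / (2 * of_real pi * \<i>) * Ln q0 + of_real l / (2 * of_real pi * \<i>) * Ln (q / q0)"
          by (simp add: T_def t0_def)
        hence "Im (T q) = - (l / (2 * pi)) * ln (cmod q0) + - (l / (2 * pi)) * ln (cmod (q / q0))"
          using q0 qnz[OF that] Im_nome_log by simp
        also have "ln (cmod (q / q0)) = ln (cmod q) - ln (cmod q0)"
          using q0 qnz[OF that] by (simp add: norm_divide ln_div)
        also have "- (l / (2 * pi)) * ln (cmod q0) + - (l / (2 * pi)) * (ln (cmod q) - ln (cmod q0)) =
            - (l / (2 * pi)) * ln (cmod q)" by (simp only: right_diff_distrib)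
        finally show ?thesis unfolding Im_nome_log[OF qnz[OF that]] by simp
      qed
      thus ?thesis using Im_nome_log_gt[OF qnz[OF that], of y0] that by (auto simp: S_def)
    qed
    have "T holomorphic_on S" unfolding T_def
      using Re by (auto intro!: holomorphic_intros simp: complex_nonpos_Reals_iff) (metis not_le)
    moreover have "T ` S \<subseteq> {t. Im t > y0}" using ImT by auto
    ultimately have "(F \<circ> T) holomorphic_on S" by (rule holomorphic_on_compose_gen[OF _ hol])
    hence "nome_lift l F holomorphic_on S"
      by (rule holomorphic_transform) (metis comp_apply expT nome_lift_exp)
    thus ?thesis using S holomorphic_on_imp_differentiable_at by blast
  qed
  show "nome_lift l F holomorphic_on ?B - {0}"
    unfolding holomorphic_on_def by (rule ballI, rule field_differentiable_at_within, rule fd) auto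
  have "isCont (nome_lift l F) q" if "q \<in> ?B" for q
  proof (cases "q = 0")
    case False
    thus ?thesis using fd[OF that] field_differentiable_imp_continuous_at by blast
  next
    case True
    have "(nome_lift l F \<longlongrightarrow> nome_lift l F 0) (at 0)"
      unfolding LIM_def
    proof (intro allI impI)
      fix e :: real assume "e > 0"
      then obtain Y where Y: "\<And>t. Im t > Y \<Longrightarrow> cmod (F t) < e" using tendsto_0 by blast
      have "dist (nome_lift l F x) (nome_lift l F 0) < e"
        if "x \<noteq> 0" "dist x 0 < exp (- 2 * pi * Y / l)" for x
        using Y[OF Im_nome_log_gt[of x Y]] that by (simp add: nome_lift_def)
      thus "\<exists>s>0. \<forall>x. x \<noteq> 0 \<and> dist x 0 < s \<longrightarrow> dist (nome_lift l F x) (nome_lift l F 0) < e"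
        by (intro exI[of _ "exp (- 2 * pi * Y / l)"]) auto
    qed
    thus ?thesis by (simp add: True isCont_def)
  qed
  thus "continuous_on ?B (nome_lift l F)" by (simp add: continuous_at_imp_continuous_on)
qed auto

lemma fourier_coeff_0: "fourier_coeff l F 0 = 0"
  by (simp add: fourier_coeff_def nome_lift_def)

lemma fourier_sums:
  assumes "Im t > y0"
  shows "(\<lambda>n. fourier_coeff l F n * exp (2 * of_real pi * \<i> * of_nat n * t / of_real l)) sums F t"
proof -
  define q where "q = exp (2 * of_real pi * \<i> * t / of_real l)"
  have "Re (2 * of_real pi * \<i> * t / of_real l) = - 2 * pi * Im t / l"
    by (simp add: Re_divide_of_real)
  hence "cmod q = exp (- 2 * pi * Im t / l)" by (simp add: q_def)
  also have "\<dots> < exp (- 2 * pi * y0 / l)" using assms l_pos by (simp add: divide_strict_right_mono)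
  finally have "q \<in> ball 0 (exp (- 2 * pi * y0 / l))" by simp
  from holomorphic_power_series[OF nome_lift_holomorphic this]
  have "(\<lambda>n. fourier_coeff l F n * q ^ n) sums nome_lift l F q" by (simp add: fourier_coeff_def)
  moreover have "q ^ n = exp (2 * of_real pi * \<i> * of_nat n * t / of_real l)" for n
    by (simp add: q_def mult_ac flip: exp_of_nat_mult)
  moreover have "nome_lift l F q = F t" unfolding q_def by (rule nome_lift_exp)
  ultimately show ?thesis by simp
qed

lemma cmod_fourier_coeff_le:
  assumes y: "y > y0" and B: "\<And>t. Im t = y \<Longrightarrow> cmod (F t) \<le> B"
  shows "cmod (fourier_coeff l F n) \<le> B * exp (2 * pi * n * y / l)"
proof -
  define r where "r = exp (- 2 * pi * y / l)"
  have r: "0 < r" "r < exp (- 2 * pi * y0 / l)" using y l_pos by (auto simp: r_def divide_strict_right_mono)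
  have sub: "cball 0 r \<subseteq> ball 0 (exp (- 2 * pi * y0 / l))" using r by auto
  have "cmod ((deriv ^^ n) (nome_lift l F) 0) \<le> fact n * B / r ^ n"
  proof (rule Cauchy_inequality[OF _ _ r(1)])
    show "nome_lift l F holomorphic_on ball 0 r"
      using nome_lift_holomorphic by (rule holomorphic_on_subset) (use r in auto)
    show "continuous_on (cball 0 r) (nome_lift l F)"
      using nome_lift_holomorphic sub holomorphic_on_imp_continuous_on continuous_on_subset by blast
    fix x assume "cmod (0 - x) = r"
    hence x: "cmod x = r" by simp
    hence "x \<noteq> 0" using r by auto
    have "Im (nome_log l x) = y"
      unfolding Im_nome_log[OF \<open>x \<noteq> 0\<close>] x using l_pos by (simp add: r_def)
    thus "cmod (nome_lift l F x) \<le> B" using B \<open>x \<noteq> 0\<close> by (simp add: nome_lift_def)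
  qed
  hence "cmod (fourier_coeff l F n) \<le> B / r ^ n"
    by (simp add: fourier_coeff_def norm_divide field_simps)
  also have "r ^ n = exp (- (2 * pi * n * y / l))" by (simp add: r_def mult_ac flip: exp_of_nat_mult)
  finally show ?thesis by (simp add: exp_minus field_simps)
qed

end

text \<open>Inductively, the \<open>n\<close>-th coefficient is the locally uniform limit, as \<open>q\<close> tends to 0, of the \<open>n\<close>-th
  Taylor remainder divided by \<open>q ^ n\<close>.\<close>

lemma taylor_coeff_holomorphic_parameter:
  fixes G :: "complex \<Rightarrow> complex \<Rightarrow> complex"
  assumes rho: "\<rho> > 0"
    and hol_q: "\<And>z. (\<lambda>q. G q z) holomorphic_on ball 0 \<rho>"
    and hol_z: "\<And>q. cmod q < \<rho> \<Longrightarrow> G q holomorphic_on UNIV"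
    and bdd: "\<And>R. \<exists>B. \<forall>q z. cmod q < \<rho> \<longrightarrow> cmod z \<le> R \<longrightarrow> cmod (G q z) \<le> B"
  shows "(\<lambda>z. (deriv ^^ n) (\<lambda>q. G q z) 0 / fact n) holomorphic_on UNIV"
proof -
  define c where "c n z = (deriv ^^ n) (\<lambda>q. G q z) 0 / fact n" for n z
  define r where "r = \<rho> / 2"
  have r: "0 < r" "r < \<rho>" using rho by (auto simp: r_def)
  have sums: "(\<lambda>n. c n z * q ^ n) sums G q z" if "cmod q < \<rho>" for q z
    using holomorphic_power_series[OF hol_q, of q z] that by (simp add: c_def)
  have c_bound: "cmod (c n z) \<le> B / r ^ n"
    if B: "\<And>q z. cmod q < \<rho> \<Longrightarrow> cmod z \<le> R \<Longrightarrow> cmod (G q z) \<le> B" and z: "cmod z \<le> R" for n z B R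
  proof -
    have "cmod ((deriv ^^ n) (\<lambda>q. G q z) 0) \<le> fact n * B / r ^ n"
    proof (rule Cauchy_inequality[OF _ _ r(1)])
      show "(\<lambda>q. G q z) holomorphic_on ball 0 r" using hol_q by (rule holomorphic_on_subset) (use r in auto)
      show "continuous_on (cball 0 r) (\<lambda>q. G q z)"
        using holomorphic_on_imp_continuous_on[OF hol_q] by (rule continuous_on_subset) (use r in auto)
    qed (use B z r in auto)
    thus ?thesis by (simp add: c_def norm_divide field_simps)
  qed
  have "c n holomorphic_on UNIV"
  proof (induction n rule: less_induct)
    case (less n)
    \<comment> \<open>Sample points tending to 0 within half the radius \<open>r\<close>, so that
      Taylor tails are dominated by a geometric series of ratio 1/2.\<close>
    define q where "q i = complex_of_real (r / 2 / real (Suc i))" for i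
    have q: "q i \<noteq> 0" "cmod (q i) \<le> r / 2" for i
    proof -
      have "r / 2 / real (Suc i) \<le> r / 2 / 1" by (intro divide_left_mono) (use r in auto)
      moreover have "cmod (q i) = r / 2 / real (Suc i)" unfolding q_def norm_of_real using r by simp
      ultimately show "cmod (q i) \<le> r / 2" by simp
      show "q i \<noteq> 0" using r by (simp add: q_def del: of_nat_Suc)
    qed
    have q0: "(\<lambda>i. cmod (q i)) \<longlonglongrightarrow> 0"
    proof -
      have "(\<lambda>i. r / 2 * inverse (real (Suc i))) \<longlonglongrightarrow> r / 2 * 0"
        by (intro tendsto_mult tendsto_const LIMSEQ_inverse_real_of_nat)
      moreover have "cmod (q i) = r / 2 * inverse (real (Suc i))" for i
        unfolding q_def norm_of_real using r by (simp add: field_simps del: of_nat_Suc)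
      ultimately show ?thesis by (simp only: mult_zero_right)
    qed
    define h where "h i z = (G (q i) z - (\<Sum>j<n. c j z * q i ^ j)) / q i ^ n" for i z
    have h_hol: "h i holomorphic_on UNIV" for i
      unfolding h_def using less.IH q(1) hol_z[of "q i"] q(2)[of i] r by (auto intro!: holomorphic_intros)
    show ?case
    proof (rule holomorphic_uniform_sequence[OF open_UNIV h_hol])
      fix z0 :: complex
      define R where "R = cmod z0 + 1"
      obtain B where B: "\<And>q z. cmod q < \<rho> \<Longrightarrow> cmod z \<le> R \<Longrightarrow> cmod (G q z) \<le> B" using bdd by blast
      have B0: "B \<ge> 0" using B[of 0 z0] rho by (simp add: R_def) (meson norm_ge_zero order_trans)
      have zR: "cmod z \<le> R" if "z \<in> cball z0 1" for z
        using that norm_triangle_ineq2[of z z0] by (simp add: R_def dist_norm norm_minus_commute)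
      \<comment> \<open>The tail starts at index n + 1, so division by q^n leaves one factor |q i|
        in front; it makes the convergence uniform in z.\<close>
      have est: "cmod (h i z - c n z) \<le> B / r ^ n * 2 / r * cmod (q i)" if z: "z \<in> cball z0 1" for i z
      proof -
        define x where "x = cmod (q i) / r"
        have x: "0 \<le> x" "x \<le> 1/2" using q(2)[of i] r by (auto simp: x_def field_simps)
        have "(\<lambda>j. c j z * q i ^ j) sums G (q i) z" using sums[of "q i" z] q(2)[of i] r by simp
        from sums_split_initial_segment[OF this, of "Suc n"]
        have "(\<lambda>j. c (j + Suc n) z * q i ^ (j + Suc n)) sums (G (q i) z - (\<Sum>j<Suc n. c j z * q i ^ j))" .
        from sums_divide[OF this, of "q i ^ n"]
        have s: "(\<lambda>j. c (j + Suc n) z * q i ^ Suc j) sums (h i z - c n z)"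
          using q(1)[of i] by (simp add: h_def power_add diff_divide_distrib add_divide_distrib mult_ac diff_diff_eq)
        have b: "cmod (c (j + Suc n) z * q i ^ Suc j) \<le> B / r ^ n * x * (1/2) ^ j" for j
        proof -
          have "cmod (c (j + Suc n) z * q i ^ Suc j) \<le> B / r ^ (j + Suc n) * cmod (q i) ^ Suc j"
            unfolding norm_mult norm_power by (intro mult_right_mono c_bound[OF B zR[OF z]]) auto
          also have "\<dots> = B / r ^ n * x * x ^ j"
            using r by (simp add: x_def power_add power_divide field_simps)
          also have "\<dots> \<le> B / r ^ n * x * (1/2) ^ j"
            by (intro mult_left_mono power_mono) (use x B0 r in auto)
          finally show ?thesis .
        qed
        have g: "(\<lambda>j. B / r ^ n * x * (1/2) ^ j) sums (B / r ^ n * x * (1 / (1 - 1/2)))"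
          by (intro sums_mult geometric_sums) auto
        have "cmod (suminf (\<lambda>j. c (j + Suc n) z * q i ^ Suc j)) \<le> (\<Sum>j. B / r ^ n * x * (1/2) ^ j)"
          by (rule norm_suminf_le) (use b g sums_summable in auto)
        also have "\<dots> = B / r ^ n * x * 2" using g sums_unique by fastforce
        finally show ?thesis using sums_unique[OF s] by (simp add: x_def mult_ac)
      qed
      have "uniform_limit (cball z0 1) h (c n) sequentially"
      proof (rule uniform_limitI)
        fix e :: real assume e: "e > 0"
        have "(\<lambda>i. B / r ^ n * 2 / r * cmod (q i)) \<longlonglongrightarrow> B / r ^ n * 2 / r * 0"
          by (intro tendsto_mult tendsto_const q0)
        hence "\<forall>\<^sub>F i in sequentially. B / r ^ n * 2 / r * cmod (q i) < e"
          using e by (intro order_tendstoD(2)) auto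
        thus "\<forall>\<^sub>F i in sequentially. \<forall>z\<in>cball z0 1. dist (h i z) (c n z) < e"
        proof eventually_elim
          case (elim i)
          show ?case
          proof
            fix z assume "z \<in> cball z0 1"
            from est[OF this, of i] elim show "dist (h i z) (c n z) < e" by (simp add: dist_norm)
          qed
        qed
      qed
      thus "\<exists>d>0. cball z0 d \<subseteq> UNIV \<and> uniform_limit (cball z0 d) h (c n) sequentially"
        by (intro exI[of _ 1]) auto
    qed
  qed
  thus ?thesis by (simp add: c_def [abs_def])
qed

section \<open>The interpolation basis\<close>

definition even_words :: "int list set" where "even_words = {w \<in> words. even (length w)}"
definition odd_words :: "int list set" where "odd_words = {w \<in> words. odd (length w)}"

definition coeff_f :: "real \<Rightarrow> real \<Rightarrow> nat \<Rightarrow> complex \<Rightarrow> complex" where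
  "coeff_f k l n z = - fourier_coeff l (orbit_sum k l odd_words z) n"

definition coeff_fhat :: "real \<Rightarrow> real \<Rightarrow> nat \<Rightarrow> complex \<Rightarrow> complex" where
  "coeff_fhat k l n z = fourier_coeff l (orbit_sum k l even_words z) n"

context interpolation
begin

text \<open>Composing with \<open>S\<close> exchanges the terms of the two orbit sums: a term \<open>(w, m)\<close> with \<open>m \<noteq> 0\<close> becomes the
  term of the longer word \<open>m # w\<close>, a term \<open>(m # w, 0)\<close> becomes \<open>(w, m)\<close>. Only \<open>([], 0)\<close> has no partner;
  it gives the Gaussian.\<close>

lemma orbit_sum_functional_equation:
  assumes t: "Im t > 0"
  shows "(- \<i> * t) powr (- of_real k) * orbit_sum k l even_words (of_real r) (- 1 / t) =
    exp (\<i> * of_real pi * (of_real r)\<^sup>2 * t) + orbit_sum k l odd_words (of_real r) t"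
proof -
  define z where "z = complex_of_real r"
  define J where "J = (- \<i> * t) powr (- of_real k)"
  define T where "T = (\<lambda>(w, m). J * wave k l z w (- 1 / t + of_int m * of_real l))"
  define U where "U = (\<lambda>(w, m). wave k l z w (shift l m t))"
  \<comment> \<open>\<open>g\<close> serves as its own inverse. The unspecified \<open>hd []\<close>
    occurs only at \<open>([], 0)\<close>, the excluded pair.\<close>
  define g :: "int list \<times> int \<Rightarrow> int list \<times> int"
    where "g = (\<lambda>(w, m). if m = 0 then (tl w, hd w) else (m # w, 0))"
  have t0: "t \<noteq> 0" using t by auto
  \<comment> \<open>Both -\<i> t and its inverse lie in the right half plane, where the principal
    logarithm changes sign under inversion; the two principal powers therefore cancel without a
    phase.\<close>
  have JJ: "J * (- \<i> * (- 1 / t)) powr (- of_real k) = 1"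
  proof -
    have u: "Re (- \<i> * t) > 0" "Re (- \<i> * (- 1 / t)) > 0"
      using t t0 by (auto simp: Re_divide Im_divide complex_neq_0)
    have "Ln (- \<i> * (- 1 / t)) = - Ln (- \<i> * t)"
    proof -
      have e: "- \<i> * (- 1 / t) = inverse (- \<i> * t)" using t0 by (simp add: field_simps)
      have "- \<i> * t \<notin> \<real>\<^sub>\<le>\<^sub>0" using u(1) unfolding complex_nonpos_Reals_iff by linarith
      thus ?thesis unfolding e by (rule Ln_inverse)
    qed
    thus ?thesis using t0 unfolding J_def by (simp add: powr_def exp_minus field_simps flip: exp_add)
  qed
  have wave_Cons: "wave k l z (m # w) s = (- \<i> * s) powr (- of_real k) * wave k l z w (- 1 / s + of_int m * of_real l)"
    for m w s by (simp add: wave_def algebra_simps)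
  have T_Nil: "T ([], 0) = exp (\<i> * of_real pi * z\<^sup>2 * t)"
  proof -
    have "T ([], 0) = (J * (- \<i> * (- 1 / t)) powr (- of_real k)) * exp (\<i> * of_real pi * z\<^sup>2 * t)"
      by (simp add: T_def wave_def)
    thus ?thesis by (simp only: JJ mult_1_left)
  qed
  have T_eq: "U (g p) = T p" if pE: "p \<in> even_words \<times> UNIV - {([], 0)}" for p
  proof -
    obtain w m where p: "p = (w, m)" by (cases p)
    show ?thesis
    proof (cases "m = 0")
      case False
      thus ?thesis by (simp add: p U_def g_def T_def wave_Cons J_def)
    next
      case True
      then obtain m' w' where w: "w = m' # w'" using pE by (cases w) (auto simp: p)
      have "T p = (J * (- \<i> * (- 1 / t)) powr (- of_real k)) * wave k l z w' (t + of_int m' * of_real l)"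
        using True t0 by (simp add: p w T_def wave_Cons add.commute)
      thus ?thesis using True by (simp only: JJ) (simp add: p w U_def g_def)
    qed
  qed
  have bij: "bij_betw g (even_words \<times> UNIV - {([], 0)}) (odd_words \<times> UNIV)"
  proof (rule bij_betwI[of _ _ _ g])
    show "g \<in> even_words \<times> UNIV - {([], 0)} \<rightarrow> odd_words \<times> UNIV"
    proof
      fix p :: "int list \<times> int" assume "p \<in> even_words \<times> UNIV - {([], 0)}"
      thus "g p \<in> odd_words \<times> UNIV"
        by (cases p; cases "fst p") (auto simp: g_def even_words_def odd_words_def)
    qed
    show "g \<in> odd_words \<times> UNIV \<rightarrow> even_words \<times> UNIV - {([], 0)}"
    proof
      fix p :: "int list \<times> int" assume "p \<in> odd_words \<times> UNIV"
      thus "g p \<in> even_words \<times> UNIV - {([], 0)}"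
        by (cases p; cases "fst p") (auto simp: g_def even_words_def odd_words_def)
    qed
    show "g (g p) = p" if "p \<in> even_words \<times> UNIV - {([], 0)}" for p
      using that by (cases p; cases "fst p") (auto simp: g_def even_words_def)
    show "g (g p) = p" if "p \<in> odd_words \<times> UNIV" for p
      using that by (cases p; cases "fst p") (auto simp: g_def odd_words_def)
  qed
  have ab: "(\<lambda>p. norm (U p)) summable_on (odd_words \<times> UNIV)"
  proof -
    have "(\<lambda>(w, m). cmod (wave k l z w (shift l m t))) summable_on (odd_words \<times> UNIV)"
    proof (rule abs_summable_orbit'[of odd_words t "Im t powr (- (k - 9/4))" z, OF _ t])
      fix w s assume "w \<in> odd_words" "Im s = Im t"
      thus "cmod (wave k l z w s) \<le> Im t powr (- (k - 9/4)) * radius l w s powr (-9/4)"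
        using cmod_wave_real_le[of w s r] t by (simp add: odd_words_def z_def)
    qed (auto simp: odd_words_def)
    thus ?thesis by (simp add: U_def case_prod_unfold)
  qed
  have "(U has_sum orbit_sum k l odd_words z t) (odd_words \<times> UNIV)"
  proof -
    have "orbit_sum k l odd_words z t = infsum U (odd_words \<times> UNIV)" by (simp add: orbit_sum_def U_def)
    thus ?thesis using has_sum_infsum[OF abs_summable_summable[OF ab]] by simp
  qed
  hence "((\<lambda>p. U (g p)) has_sum orbit_sum k l odd_words z t) (even_words \<times> UNIV - {([], 0)})"
    by (subst has_sum_reindex_bij_betw[OF bij])
  hence "(T has_sum orbit_sum k l odd_words z t) (even_words \<times> UNIV - {([], 0)})"
    by (subst has_sum_cong[of _ T "\<lambda>p. U (g p)"]) (use T_eq in auto)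
  hence "(T has_sum (T ([], 0) + orbit_sum k l odd_words z t)) (insert ([], 0) (even_words \<times> UNIV - {([], 0)}))"
    by (intro has_sum_insert) auto
  also have "insert ([], 0) (even_words \<times> UNIV - {([], 0)}) = even_words \<times> UNIV"
    by (auto simp: even_words_def)
  finally have "(\<Sum>\<^sub>\<infinity>p\<in>even_words \<times> UNIV. T p) = T ([], 0) + orbit_sum k l odd_words z t"
    by (rule infsumI)
  moreover have "(\<Sum>\<^sub>\<infinity>p\<in>even_words \<times> UNIV. T p) = J * orbit_sum k l even_words z (- 1 / t)"
    unfolding orbit_sum_def T_def case_prod_unfold
    by (rule infsum_cmult_right')
  ultimately show ?thesis by (simp add: T_Nil J_def z_def)
qed

lemma cmod_orbit_sum_complex_le:
  assumes "W \<subseteq> words" "Im t \<ge> 1"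
  shows "cmod (orbit_sum k l W z t) \<le>
    16 * lattice_const * (exp (pi * (cmod z)\<^sup>2) * Im t powr (- (k - 9/4))) * 4 powr (9/4)"
proof -
  have "cmod (orbit_sum k l W z t) \<le>
      16 * lattice_const * (exp (pi * (cmod z)\<^sup>2) * Im t powr (- (k - 9/4))) * (2 * (1 + 1 / Im t)) powr (9/4)"
  proof (rule cmod_orbit_sum_le)
    fix w s assume "w \<in> W" "Im s = Im t"
    thus "cmod (wave k l z w s) \<le> exp (pi * (cmod z)\<^sup>2) * Im t powr (- (k - 9/4)) *
        radius l w s powr (-9/4)"
      using cmod_wave_complex_le[of w s z] assms by auto
  qed (use assms in auto)
  also have "\<dots> \<le> 16 * lattice_const * (exp (pi * (cmod z)\<^sup>2) * Im t powr (- (k - 9/4))) * 4 powr (9/4)"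
    by (intro mult_left_mono powr_mono2) (use assms lattice_const_nonneg in \<open>auto simp: divide_le_eq\<close>)
  finally show ?thesis .
qed

lemma orbit_sum_tendsto_0:
  assumes "W \<subseteq> words" "e > 0"
  shows "\<exists>Y. \<forall>t. Im t > Y \<longrightarrow> cmod (orbit_sum k l W z t) < e"
proof -
  define C where "C = 16 * lattice_const * exp (pi * (cmod z)\<^sup>2) * 4 powr (9/4)"
  have "((\<lambda>y. C * y powr (- (k - 9/4))) \<longlongrightarrow> C * 0) at_top"
    by (intro tendsto_mult tendsto_const tendsto_neg_powr filterlim_ident) (use k_ge in auto)
  hence "\<forall>\<^sub>F y in at_top. C * y powr (- (k - 9/4)) < e" using assms by (intro order_tendstoD(2)) auto
  then obtain Y where Y: "\<And>y. y \<ge> Y \<Longrightarrow> C * y powr (- (k - 9/4)) < e"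
    by (auto simp: eventually_at_top_linorder)
  show ?thesis
  proof (intro exI[of _ "max 1 Y"] allI impI)
    fix t assume t: "Im t > max 1 Y"
    have "cmod (orbit_sum k l W z t) \<le> C * Im t powr (- (k - 9/4))"
      using cmod_orbit_sum_complex_le[OF assms(1), of t z] t by (simp add: C_def mult_ac)
    also have "\<dots> < e" using Y t by simp
    finally show "cmod (orbit_sum k l W z t) < e" .
  qed
qed

lemma periodic_upper_real:
  assumes "W \<subseteq> words" "y0 > 0"
  shows "periodic_upper l y0 (orbit_sum k l W (of_real r))"
proof
  show "orbit_sum k l W (of_real r) holomorphic_on {t. Im t > y0}"
  proof (rule orbit_sum_holomorphic_at[OF assms])
    fix w s assume "w \<in> W" and s: "Im s > y0"
    hence w: "w \<in> words" using assms by auto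
    have "cmod (wave k l (of_real r) w s) \<le>
        Im s powr (- (k - 9/4)) * radius l w s powr (-9/4)"
      by (rule cmod_wave_real_le[OF w]) (use s assms in auto)
    also have "\<dots> \<le> y0 powr (- (k - 9/4)) * radius l w s powr (-9/4)"
      by (intro mult_right_mono powr_mono2') (use s assms k_ge in auto)
    finally show "cmod (wave k l (of_real r) w s) \<le>
        y0 powr (- (k - 9/4)) * radius l w s powr (-9/4)" .
  qed auto
qed (use l_ge orbit_sum_periodic_int orbit_sum_tendsto_0[OF assms(1)] in auto)

text \<open>Only Im t > 1 is available here, that is, a smaller nome disc than in
  \<open>periodic_upper_real\<close>. The Fourier coefficients are derivatives at its centre, so for
  real z they are the same numbers as those estimated on lines closer to the real axis.\<close>

lemma periodic_upper_complex:
  assumes "W \<subseteq> words"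
  shows "periodic_upper l 1 (orbit_sum k l W z)"
proof
  show "orbit_sum k l W z holomorphic_on {t. Im t > 1}"
  proof (rule orbit_sum_holomorphic_at[OF assms])
    fix w s assume "w \<in> W" and s: "Im s > 1"
    hence w: "w \<in> words" using assms by auto
    have "cmod (wave k l z w s) \<le>
        exp (pi * (cmod z)\<^sup>2) * Im s powr (- (k - 9/4)) * radius l w s powr (-9/4)"
      by (rule cmod_wave_complex_le[OF w]) (use s assms in auto)
    also have "\<dots> \<le> exp (pi * (cmod z)\<^sup>2) * 1 powr (- (k - 9/4)) * radius l w s powr (-9/4)"
      by (intro mult_right_mono mult_left_mono powr_mono2') (use s assms k_ge in auto)
    finally show "cmod (wave k l z w s) \<le>
        exp (pi * (cmod z)\<^sup>2) * radius l w s powr (-9/4)" by simp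
  qed auto
qed (use l_ge orbit_sum_periodic_int orbit_sum_tendsto_0[OF assms(1)] in auto)

lemma orbit_sum_holomorphic_in_z:
  assumes W: "W \<subseteq> words" and t: "Im t > 1"
  shows "(\<lambda>z. orbit_sum k l W z t) holomorphic_on UNIV"
proof -
  have "(\<lambda>z. orbit_sum k l W z t) field_differentiable at z0" for z0
  proof -
    define B where "B = exp (pi * (cmod z0 + 1)\<^sup>2) * Im t powr (- (k - 9/4))"
    define K where "K = 1 + (\<bar>Re t\<bar> + 2) / Im t"
    have K: "K > 0" using t by (auto simp: K_def intro!: add_pos_nonneg)
    have "(\<lambda>z. \<Sum>\<^sub>\<infinity>p\<in>W \<times> UNIV. wave k l z (fst p) (t + of_int (snd p) * of_real l)) field_differentiable at z0"
    proof (rule infsum_field_differentiable[OF zero_less_one _ _ summable_majorant[OF W]])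
      fix p :: "int list \<times> int"
      show "(\<lambda>z. wave k l z (fst p) (t + of_int (snd p) * of_real l)) holomorphic_on cball z0 1"
        unfolding wave_def by (intro holomorphic_intros)
      fix z assume p: "p \<in> W \<times> UNIV" and z: "z \<in> cball z0 1"
      have zn: "cmod z \<le> cmod z0 + 1"
        using z norm_triangle_ineq2[of z z0] by (simp add: dist_norm norm_minus_commute)
      have "cmod (wave k l z (fst p) (t + of_int (snd p) * of_real l)) \<le>
          B * K powr (9/4) * (height l (fst p) powr (-9/4) * (1 + \<bar>of_int (snd p)\<bar>) powr (-9/4))"
      proof (rule wave_le[OF W K])
        show "1 + \<bar>real_of_int m\<bar> \<le> K * cmod (t + of_int m * of_real l + of_real x)" if "\<bar>x\<bar> < 1" for m x
          using lattice_point_le_local[OF order.refl order.refl _ that, of t m] t by (simp add: K_def)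
        show "B \<ge> 0" by (simp add: B_def)
        fix w m assume "w \<in> W"
        hence w: "w \<in> words" using W by auto
        have "cmod (wave k l z w (shift l m t)) \<le> exp (pi * (cmod z)\<^sup>2) * Im t powr (- (k - 9/4)) *
            radius l w (shift l m t) powr (-9/4)"
          using cmod_wave_complex_le[OF w, of "t + of_int m * of_real l" z] t by simp
        also have "\<dots> \<le> B * radius l w (shift l m t) powr (-9/4)"
          unfolding B_def by (intro mult_right_mono) (use zn in \<open>auto intro!: power_mono\<close>)
        finally show "cmod (wave k l z w (shift l m t)) \<le>
            B * radius l w (shift l m t) powr (-9/4)" .
      qed (use p in auto)
      thus "cmod (wave k l z (fst p) (t + of_int (snd p) * of_real l)) \<le>
          (case p of (w, m) \<Rightarrow> B * K powr (9/4) * (decay l w m))"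
        by (simp add: case_prod_unfold)
    qed
    thus ?thesis by (simp add: orbit_sum_def case_prod_unfold)
  qed
  thus ?thesis by (simp add: holomorphic_on_def field_differentiable_at_within)
qed

text \<open>\<open>taylor_coeff_holomorphic_parameter\<close> applies on the nome disc of Im t > 1,
  where the lift is bounded uniformly for z in a bounded set. Evenness holds because z enters
  through z^2 only.\<close>

lemma fourier_coeff_orbit_sum_entire_even:
  assumes W: "W \<subseteq> words"
  shows "entire_even (\<lambda>z. fourier_coeff l (orbit_sum k l W z) n)"
proof -
  define G where "G q z = nome_lift l (orbit_sum k l W z) q" for q z
  define \<rho> where "\<rho> = exp (- 2 * pi * 1 / l)"
  have "(\<lambda>z. (deriv ^^ n) (\<lambda>q. G q z) 0 / fact n) holomorphic_on UNIV"
  proof (rule taylor_coeff_holomorphic_parameter[of \<rho>])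
    show "\<rho> > 0" by (simp add: \<rho>_def)
    fix z
    interpret periodic_upper l 1 "orbit_sum k l W z" by (rule periodic_upper_complex[OF W])
    show "(\<lambda>q. G q z) holomorphic_on ball 0 \<rho>"
      using nome_lift_holomorphic by (simp add: G_def \<rho>_def)
  next
    fix q assume q: "cmod q < \<rho>"
    interpret periodic_upper l 1 "orbit_sum k l W 0" by (rule periodic_upper_complex[OF W])
    show "G q holomorphic_on UNIV"
    proof (cases "q = 0")
      case False
      from orbit_sum_holomorphic_in_z[OF W Im_nome_log_gt[OF False, of 1]] q
      show ?thesis using False by (simp add: G_def [abs_def] nome_lift_def \<rho>_def)
    qed (simp add: G_def [abs_def] nome_lift_def)
  next
    fix R :: real
    interpret periodic_upper l 1 "orbit_sum k l W 0" by (rule periodic_upper_complex[OF W])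
    define B where "B = 16 * lattice_const * (exp (pi * \<bar>R\<bar>\<^sup>2) * 1) * 4 powr (9/4)"
    have "cmod (G q z) \<le> B" if "cmod q < \<rho>" "cmod z \<le> R" for q z
    proof (cases "q = 0")
      case True
      thus ?thesis using lattice_const_nonneg by (simp add: G_def nome_lift_def B_def)
    next
      case False
      define t where "t = nome_log l q"
      have t: "Im t > 1" unfolding t_def by (rule Im_nome_log_gt[OF False]) (use that in \<open>simp add: \<rho>_def\<close>)
      have "cmod (orbit_sum k l W z t) \<le>
          16 * lattice_const * (exp (pi * (cmod z)\<^sup>2) * Im t powr (- (k - 9/4))) * 4 powr (9/4)"
        by (rule cmod_orbit_sum_complex_le) (use W t in auto)
      also have "\<dots> \<le> B" unfolding B_def
      proof (intro mult_left_mono mult_right_mono mult_mono)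
        show "exp (pi * (cmod z)\<^sup>2) \<le> exp (pi * \<bar>R\<bar>\<^sup>2)"
          using that by (auto intro!: power_mono)
        show "Im t powr (- (k - 9/4)) \<le> 1"
          using powr_mono2'[of "- (k - 9/4)" 1 "Im t"] t k_ge by simp
      qed (use lattice_const_nonneg in auto)
      finally show ?thesis using False by (simp add: G_def nome_lift_def t_def)
    qed
    thus "\<exists>B. \<forall>q z. cmod q < \<rho> \<longrightarrow> cmod z \<le> R \<longrightarrow> cmod (G q z) \<le> B" by blast
  qed
  moreover have "orbit_sum k l W (- z) = orbit_sum k l W z" for z
    by (simp add: orbit_sum_def [abs_def] wave_def)
  ultimately show ?thesis by (simp add: entire_even_def fourier_coeff_def G_def)
qed

text \<open>With p = k - 9/4, the line Im t = y contributes y^(-p), and Cauchy's inequality costs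
  exp(2 pi n y / l) <= exp(pi n y). The product is smallest at y = p / (pi n). The factor (1 +
  1/y)^(9/4) from the lattice turns n^p into n^k.\<close>

lemma fourier_coeff_orbit_sum_sup:
  assumes W: "W \<subseteq> words" and n: "n \<ge> 1"
  shows "cmod (fourier_coeff l (orbit_sum k l W (of_real r)) n) \<le>
    16 * lattice_const * 28 powr (9/4) * (8100 / k) powr (k / 2) * real n powr k"
proof -
  define p where "p = k - 9/4"
  define y where "y = p / (pi * n)"
  have p: "p \<ge> 1/4" using k_ge by (simp add: p_def)
  have y: "y > 0" using p n by (simp add: y_def)
  interpret periodic_upper l "y / 2" "orbit_sum k l W (of_real r)"
    by (rule periodic_upper_real[OF W]) (use y in simp)
  have pi_le: "pi \<le> 13/4" using pi_less_4 pi_approx by simp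
  have e_le: "exp 1 \<le> (11/4 :: real)" using e_less_272 by simp
  have "cmod (fourier_coeff l (orbit_sum k l W (of_real r)) n) \<le>
      16 * lattice_const * y powr (- p) * (2 * (1 + 1 / y)) powr (9/4) * exp (2 * pi * n * y / l)"
  proof (rule cmod_fourier_coeff_le)
    fix t assume t: "Im t = y"
    have "cmod (wave k l (of_real r) w s) \<le> y powr (- p) * radius l w s powr (-9/4)"
      if "w \<in> W" "Im s = Im t" for w s
      using cmod_wave_real_le[of w s r] that t W y by (auto simp: p_def)
    from cmod_orbit_sum_le[OF W _ _ this]
    show "cmod (orbit_sum k l W (of_real r) t) \<le> 16 * lattice_const * y powr (- p) * (2 * (1 + 1 / y)) powr (9/4)"
      using t y by auto
  qed (use y in auto)
  also have "\<dots> \<le> 16 * lattice_const * y powr (- p) * (28 * real n) powr (9/4) * exp p"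
  proof -
    \<comment> \<open>From p >= 1/4 and pi <= 13/4 follows 1/y <= 13 n, and 28 = 2 (1 + 13).\<close>
    have "1 / y = pi * n * (1 / p)" by (simp add: y_def)
    also have "\<dots> \<le> 13/4 * n * 4" by (intro mult_mono) (use p pi_le in \<open>auto simp: field_simps\<close>)
    finally have "2 * (1 + 1 / y) \<le> 28 * real n" using n by simp
    hence 1: "(2 * (1 + 1 / y)) powr (9/4) \<le> (28 * real n) powr (9/4)"
      by (intro powr_mono2) (use y in auto)
    have "2 * pi * n * y / l \<le> 2 * pi * n * y / 2" by (intro divide_left_mono) (use l_ge y in auto)
    also have "\<dots> = p" using n by (simp add: y_def)
    finally have 2: "exp (2 * pi * n * y / l) \<le> exp p" by simp
    show ?thesis by (intro mult_mono 1 2 order.refl) (use y lattice_const_nonneg in \<open>auto\<close>)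
  qed
  also have "y powr (- p) = (pi / p) powr p * real n powr p"
    using p n by (simp add: y_def powr_minus_divide powr_divide powr_mult)
  also have "exp p = exp 1 powr p" by (simp add: powr_def)
  also have "16 * lattice_const * ((pi / p) powr p * real n powr p) * (28 * real n) powr (9/4) * exp 1 powr p =
      16 * lattice_const * 28 powr (9/4) * (exp 1 * pi / p) powr p * (real n powr p * real n powr (9/4))"
    using p n by (simp add: powr_mult powr_divide)
  also have "real n powr p * real n powr (9/4) = real n powr k" by (simp add: p_def flip: powr_add)
  \<comment> \<open>Since e pi <= 9 and k <= 10 p, with equality at k = 5/2, the base is at most 90
    / k. The exponent is p = k/2 + (k/2 - 9/4). The second part, negative for small k, contributes
    at most 90^(k/2), and 90 * 90 = 8100.\<close>
  also have "(exp 1 * pi / p) powr p \<le> (8100 / k) powr (k / 2)"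
  proof -
    have kpos: "k > 0" using k_ge by simp
    have "exp 1 * pi / p \<le> 90 / k"
    proof -
      have "exp 1 * pi \<le> 11/4 * (13/4)" by (intro mult_mono e_le pi_le) auto
      hence "exp 1 * pi \<le> 9" by simp
      hence "exp 1 * pi / p \<le> 9 / p" using p by (intro divide_right_mono) auto
      also have "\<dots> \<le> 90 / k" using p kpos by (simp add: field_simps p_def)
      finally show ?thesis .
    qed
    hence "(exp 1 * pi / p) powr p \<le> (90 / k) powr p" by (intro powr_mono2) (use p in auto)
    also have "\<dots> = (90 / k) powr (k / 2) * (90 / k) powr (k / 2 - 9/4)"
      by (simp add: p_def flip: powr_add)
    also have "(90 / k) powr (k / 2 - 9/4) \<le> 90 powr (k / 2)"
    proof (cases "k \<ge> 9/2")
      case True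
      have "(90 / k) powr (k / 2 - 9/4) \<le> 90 powr (k / 2 - 9/4)"
        by (intro powr_mono2) (use True in \<open>auto simp: field_simps\<close>)
      also have "\<dots> \<le> 90 powr (k / 2)" by (intro powr_mono) auto
      finally show ?thesis .
    next
      case False
      have "(90 / k) powr (k / 2 - 9/4) \<le> (90 / k) powr 0"
        by (intro powr_mono) (use False kpos in \<open>auto simp: field_simps\<close>)
      also have "\<dots> \<le> 1" using kpos by simp
      also have "1 \<le> 90 powr (k / 2)" using kpos by (intro ge_one_powr_ge_zero) auto
      finally show ?thesis .
    qed
    also have "(90 / k) powr (k / 2) * 90 powr (k / 2) = (8100 / k) powr (k / 2)"
      using kpos by (simp flip: powr_mult)
    finally show ?thesis by (simp add: mult_left_mono)
  qed
  finally show ?thesis using lattice_const_nonneg by (simp add: mult_left_mono mult_right_mono)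
qed

text \<open>Now y^(-s) exp(pi n y) is minimised, with s = (k - 9/4) / 2. The factor exp s coming
  from Cauchy's inequality cancels the power of e in \<open>powr_mult_exp_le\<close>, so no constant
  raised to a multiple of k remains. From s >= 1/8 follows 1/y <= 26 n, and 54 = 2 (1 + 26).\<close>

lemma fourier_coeff_orbit_sum_decay:
  assumes W: "W \<subseteq> words" and n: "n \<ge> 1" and r: "r > 0"
  shows "cmod (fourier_coeff l (orbit_sum k l W (of_real r)) n) \<le>
    16 * lattice_const * 54 powr (9/4) * real n powr (k / 2 + 9/8) * r powr (- k + 9/4)"
proof -
  define s where "s = (k - 9/4) / 2"
  define y where "y = s / (pi * n)"
  have s: "s \<ge> 1/8" using k_ge by (simp add: s_def)
  have y: "y > 0" using s n by (simp add: y_def)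
  interpret periodic_upper l "y / 2" "orbit_sum k l W (of_real r)"
    by (rule periodic_upper_real[OF W]) (use y in simp)
  have pi_le: "pi \<le> 13/4" using pi_less_4 pi_approx by simp
  define B where "B = (s / (exp 1 * (pi * r\<^sup>2 * y))) powr s"
  have "cmod (fourier_coeff l (orbit_sum k l W (of_real r)) n) \<le>
      16 * lattice_const * B * (2 * (1 + 1 / y)) powr (9/4) * exp (2 * pi * n * y / l)"
  proof (rule cmod_fourier_coeff_le)
    fix t assume t: "Im t = y"
    have "cmod (wave k l (of_real r) w u) \<le> B * radius l w u powr (-9/4)"
      if "w \<in> W" "Im u = Im t" for w u
      using cmod_wave_decay_le[of w u r] that t W y r by (auto simp: s_def B_def)
    from cmod_orbit_sum_le[OF W _ _ this]
    show "cmod (orbit_sum k l W (of_real r) t) \<le> 16 * lattice_const * B * (2 * (1 + 1 / y)) powr (9/4)"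
      using t y by (auto simp: B_def)
  qed (use y in auto)
  also have "\<dots> \<le> 16 * lattice_const * B * (54 * real n) powr (9/4) * exp s"
  proof -
    have "1 / y = pi * n * (1 / s)" by (simp add: y_def)
    also have "\<dots> \<le> 13/4 * n * 8" by (intro mult_mono) (use s pi_le in \<open>auto simp: field_simps\<close>)
    finally have "2 * (1 + 1 / y) \<le> 54 * real n" using n by simp
    hence 1: "(2 * (1 + 1 / y)) powr (9/4) \<le> (54 * real n) powr (9/4)"
      by (intro powr_mono2) (use y in auto)
    have "2 * pi * n * y / l \<le> 2 * pi * n * y / 2" by (intro divide_left_mono) (use l_ge y in auto)
    also have "\<dots> = s" using n by (simp add: y_def)
    finally have 2: "exp (2 * pi * n * y / l) \<le> exp s" by simp
    show ?thesis by (intro mult_mono 1 2 order.refl) (use y lattice_const_nonneg in \<open>auto simp: B_def\<close>)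
  qed
  also have "B = (real n / (exp 1 * r\<^sup>2)) powr s"
    using s n r by (simp add: B_def y_def field_simps)
  also have "exp s = exp 1 powr s" by (simp add: powr_def)
  also have "16 * lattice_const * (real n / (exp 1 * r\<^sup>2)) powr s * (54 * real n) powr (9/4) * exp 1 powr s =
      16 * lattice_const * 54 powr (9/4) * (real n powr s * real n powr (9/4)) / (r\<^sup>2) powr s"
    using s n r by (simp add: powr_mult powr_divide)
  also have "(r\<^sup>2) powr s = r powr (k - 9/4)"
  proof -
    have "2 * s = k - 9/4" by (simp add: s_def field_simps)
    thus ?thesis using r by (simp add: power2_powr)
  qed
  also have "real n powr s * real n powr (9/4) = real n powr (k / 2 + 9/8)"
  proof -
    have "s + 9/4 = k / 2 + 9/8" by (simp add: s_def field_simps)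
    thus ?thesis by (metis powr_add)
  qed
  also have "16 * lattice_const * 54 powr (9/4) * real n powr (k / 2 + 9/8) / r powr (k - 9/4) =
      16 * lattice_const * 54 powr (9/4) * real n powr (k / 2 + 9/8) * r powr (- k + 9/4)"
    using powr_minus_divide[of r "k - 9/4"] by simp
  finally show ?thesis .
qed

lemma gaussian_interpolation:
  assumes t: "Im t > 0"
  defines "e \<equiv> \<lambda>n s. exp (2 * of_real pi * \<i> * of_nat n * s / of_real l)"
  shows "(\<lambda>n. coeff_f k l (Suc n) (of_real r) * e (Suc n) t +
      (- \<i> * t) powr (- of_real k) * (coeff_fhat k l (Suc n) (of_real r) * e (Suc n) (- 1 / t)))
    sums exp (\<i> * of_real pi * (of_real r)\<^sup>2 * t)"
proof -
  have t': "Im (- 1 / t) > 0" using inverse_upper_half_plane(2)[OF t, of 0] by simp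
  define y where "y = min (Im t) (Im (- 1 / t)) / 2"
  have y: "y > 0" "Im t > y" "Im (- 1 / t) > y" using t t' by (auto simp: y_def min_def)
  interpret o: periodic_upper l y "orbit_sum k l odd_words (of_real r)"
    by (rule periodic_upper_real) (use y in \<open>auto simp: odd_words_def\<close>)
  interpret e: periodic_upper l y "orbit_sum k l even_words (of_real r)"
    by (rule periodic_upper_real) (use y in \<open>auto simp: even_words_def\<close>)
  have 1: "(\<lambda>n. coeff_f k l n (of_real r) * e n t) sums (- orbit_sum k l odd_words (of_real r) t)"
    using sums_minus[OF o.fourier_sums[OF y(2)]] by (simp add: coeff_f_def e_def)
  have 2: "(\<lambda>n. coeff_fhat k l n (of_real r) * e n (- 1 / t)) sums (orbit_sum k l even_words (of_real r) (- 1 / t))"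
    using e.fourier_sums[OF y(3)] unfolding coeff_fhat_def e_def .
  have 3: "(\<lambda>n. coeff_f k l n (of_real r) * e n t +
      (- \<i> * t) powr (- of_real k) * (coeff_fhat k l n (of_real r) * e n (- 1 / t))) sums
      (- orbit_sum k l odd_words (of_real r) t + (- \<i> * t) powr (- of_real k) * orbit_sum k l even_words (of_real r) (- 1 / t))"
    by (intro sums_add 1 sums_mult 2)
  \<comment> \<open>The lifts vanish at q = 0, which lets both series start at n = 1.\<close>
  have 4: "coeff_f k l 0 (of_real r) = 0" "coeff_fhat k l 0 (of_real r) = 0"
    by (simp_all add: coeff_f_def coeff_fhat_def o.fourier_coeff_0 e.fourier_coeff_0)
  show ?thesis
    using 3 unfolding orbit_sum_functional_equation[OF t] by (subst sums_Suc_iff) (simp add: 4)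
qed

end

section \<open>Radial Schwartz functions\<close>

text \<open>\<open>D n\<close> plays the role of the \<open>n\<close>-th derivative of \<open>D 0\<close>, a Schwartz function on the line.\<close>

definition rapid :: "(nat \<Rightarrow> real \<Rightarrow> complex) \<Rightarrow> bool" where
  "rapid D \<longleftrightarrow> (\<forall>n r. (D n has_vector_derivative D (Suc n) r) (at r)) \<and>
     (\<forall>n N. \<exists>C. \<forall>r. \<bar>r\<bar> ^ N * cmod (D n r) \<le> C)"

text \<open>The value \<open>undefined\<close> beyond the first \<open>d\<close> coordinates is what
  membership in the extensional set \<open>euc d\<close> demands.\<close>

definition axis_point :: "nat \<Rightarrow> real \<Rightarrow> nat \<Rightarrow> real" where
  "axis_point d r = (\<lambda>i. if i < d then 0 else undefined)(0 := r)"

lemma axis_point_in_euc: "d \<ge> 1 \<Longrightarrow> axis_point d r \<in> euc d"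
  by (auto simp: axis_point_def euc_def PiE_def extensional_def)

lemma enorm_axis_point: "d \<ge> 1 \<Longrightarrow> enorm d (axis_point d r) = \<bar>r\<bar>"
proof -
  assume d: "d \<ge> 1"
  have "(\<Sum>i<d. (axis_point d r i)\<^sup>2) = (\<Sum>i<d. if i = 0 then r\<^sup>2 else 0)"
    by (intro sum.cong) (auto simp: axis_point_def)
  also have "\<dots> = r\<^sup>2" using d by (subst sum.delta) auto
  finally show ?thesis by (simp add: L2_set_def)
qed

text \<open>The profile is the restriction to the first coordinate axis, negative r included.
  Radiality makes it even, and iterated partial derivatives in direction 0 become ordinary
  derivatives.\<close>

lemma radial_schwartz_profile:
  assumes d: "d \<ge> 1" and f: "f \<in> schwartz_rad d"
  obtains D where "rapid D" "\<And>r. D 0 (- r) = D 0 r" "\<And>x. x \<in> euc d \<Longrightarrow> f x = D 0 (enorm d x)"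
proof -
  define D where "D n r = partials (replicate n 0) f (axis_point d r)" for n r
  have sm: "smooth_euc d f" and rd: "radial d f"
    and bd: "\<And>js N. set js \<subseteq> {..<d} \<Longrightarrow> bdd_above ((\<lambda>x. enorm d x ^ N * cmod (partials js f x)) ` euc d)"
    using f by (auto simp: schwartz_rad_def schwartz_def)
  have upd: "(axis_point d r)(0 := t) = axis_point d t" for r t by (simp add: axis_point_def)
  have at0: "axis_point d r 0 = r" for r by (simp add: axis_point_def)
  have sub: "set (replicate n 0) \<subseteq> {..<d}" for n using d by (cases n) auto
  have "(D n has_vector_derivative D (Suc n) r) (at r)" for n r
  proof -
    have "(\<lambda>t. partials (replicate n 0) f ((axis_point d r)(0 := t))) differentiable (at (axis_point d r 0))"
      using sm sub[of n] axis_point_in_euc[OF d, of r] d unfolding smooth_euc_def by (metis less_le_trans zero_less_one)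
    hence "D n differentiable (at r)" by (simp add: upd at0 D_def [abs_def])
    moreover have "D (Suc n) r = vector_derivative (D n) (at r)"
      by (simp add: D_def [abs_def] partials_def partial_def upd at0)
    ultimately show ?thesis by (simp add: vector_derivative_works)
  qed
  moreover have "\<exists>C. \<forall>r. \<bar>r\<bar> ^ N * cmod (D n r) \<le> C" for n N
  proof -
    obtain C where C: "\<And>x. x \<in> euc d \<Longrightarrow> enorm d x ^ N * cmod (partials (replicate n 0) f x) \<le> C"
      using bd[OF sub, of N n] by (auto simp: bdd_above_def)
    show ?thesis
      by (rule exI[of _ C]) (use C[OF axis_point_in_euc[OF d]] in \<open>auto simp: D_def enorm_axis_point[OF d]\<close>)
  qed
  ultimately have "rapid D" by (simp add: rapid_def)
  moreover have D0: "D 0 r = f (axis_point d r)" for r by (simp add: D_def partials_def)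
  moreover have "D 0 (- r) = D 0 r" for r
  proof -
    have "enorm d (axis_point d (- r)) = enorm d (axis_point d r)" by (simp only: enorm_axis_point[OF d] abs_minus_cancel)
    thus ?thesis using rd axis_point_in_euc[OF d] unfolding radial_def D0 by blast
  qed
  moreover have "f x = D 0 (enorm d x)" if "x \<in> euc d" for x
  proof -
    have "enorm d x = enorm d (axis_point d (enorm d x))" by (simp only: enorm_axis_point[OF d] abs_of_nonneg[OF L2_set_nonneg])
    thus ?thesis using rd that axis_point_in_euc[OF d] unfolding radial_def D0 by blast
  qed
  ultimately show ?thesis using that by blast
qed

lemma rapid_continuous:
  assumes "rapid D" shows "continuous_on A (D n)"
  using assms unfolding rapid_def
  by (meson continuous_at_imp_continuous_on has_vector_derivative_continuous)

text \<open>In the variable u = r^2 differentiation is (1 / (2 r)) d/dr, so \<open>E 0\<close> is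
  the derivative of the profile with respect to u. Iterated, this is Whitney's theorem that a smooth
  even function is a smooth function of the square.\<close>

lemma rapid_division_step:
  assumes D: "rapid D" and even: "\<And>r. D 0 (- r) = D 0 r"
  obtains E where "rapid E" "\<And>r. E 0 (- r) = E 0 r" "\<And>r. D 1 r = 2 * of_real r * E 0 r"
proof -
  \<comment> \<open>\<open>D 1 r / (2 r)\<close> is half the mean of \<open>D 2\<close> over \<open>[0, r]\<close>, which is smooth at 0.\<close>
  define E where "E n r = integral (cbox 0 1) (\<lambda>s. of_real (s ^ n / 2) * D (n + 2) (r * s))" for n r
  have der: "(D n has_vector_derivative D (Suc n) r) (at r)" for n r using D by (auto simp: rapid_def)
  have der': "((\<lambda>r. D n (g r)) has_vector_derivative g' *\<^sub>R D (Suc n) (g r)) (at r within S)"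
    if "(g has_vector_derivative g') (at r within S)" for n g g' r S
    using vector_diff_chain_within[OF that has_vector_derivative_at_within[OF der]] by (simp add: o_def)
  have cont: "continuous_on A (\<lambda>x. D n (g x))" if "continuous_on A g" for A n and g :: "'b::topological_space \<Rightarrow> real"
    using continuous_on_compose2[OF rapid_continuous[OF D, of UNIV n] that] by simp
  have derE: "(E n has_vector_derivative E (Suc n) r) (at r)" for n r
    unfolding E_def
  proof (rule leibniz_rule_vector_derivative[where U = UNIV and fx = "\<lambda>r s. of_real (s ^ Suc n / 2) * D (Suc n + 2) (r * s)"])
    fix x s :: real
    have "((\<lambda>r. r * s) has_vector_derivative s) (at x)"
      by (auto intro!: derivative_eq_intros simp flip: has_real_derivative_iff_has_vector_derivative)
    from has_vector_derivative_mult_right[OF der'[OF this, of "n + 2"], of "of_real (s ^ n / 2)"]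
    show "((\<lambda>x. of_real (s ^ n / 2) * D (n + 2) (x * s)) has_vector_derivative
        of_real (s ^ Suc n / 2) * D (Suc n + 2) (x * s)) (at x)"
      by (simp add: scaleR_conv_of_real mult_ac)
  next
    fix x
    show "(\<lambda>s. of_real (s ^ n / 2) * D (n + 2) (x * s)) integrable_on cbox 0 1"
      by (intro integrable_continuous continuous_intros cont) auto
  next
    show "continuous_on (UNIV \<times> cbox 0 1) (\<lambda>(r, s). of_real (s ^ Suc n / 2) * D (Suc n + 2) (r * s))"
      unfolding case_prod_unfold by (intro continuous_intros cont) auto
  qed auto
  have odd1: "D 1 (- r) = - D 1 r" for r
  proof -
    have "((\<lambda>r. - r) has_vector_derivative (- 1)) (at r)"
      by (auto intro!: derivative_eq_intros simp flip: has_real_derivative_iff_has_vector_derivative)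
    from der'[OF this, of 0] have "(D 0 has_vector_derivative - D 1 (- r)) (at r)" by (simp add: even)
    from vector_derivative_unique_at[OF this der] show ?thesis by (simp add: minus_equation_iff)
  qed
  have D1: "D 1 r = 2 * of_real r * E 0 r" for r
  proof -
    have "((\<lambda>s. of_real r * D 2 (r * s)) has_integral (D 1 (r * 1) - D 1 (r * 0))) {0..1}"
    proof (rule fundamental_theorem_of_calculus)
      fix s :: real
      have "((\<lambda>s. r * s) has_vector_derivative r) (at s within {0..1})"
        by (auto intro!: derivative_eq_intros simp flip: has_real_derivative_iff_has_vector_derivative)
      from der'[OF this, of 1]
      show "((\<lambda>s. D 1 (r * s)) has_vector_derivative of_real r * D 2 (r * s)) (at s within {0..1})"
        by (simp add: scaleR_conv_of_real numeral_2_eq_2)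
    qed auto
    moreover have "D 1 0 = 0" using odd1[of 0] by simp
    ultimately have "((\<lambda>s. of_real r * D 2 (r * s)) has_integral D 1 r) {0..1}" by simp
    hence "D 1 r = integral {0..1} (\<lambda>s. of_real r * D 2 (r * s))"
      by (rule integral_unique[symmetric])
    also have "\<dots> = integral {0..1} (\<lambda>s. (2 * of_real r) * (of_real (s ^ 0 / 2) * D 2 (r * s)))"
      by (intro integral_cong) simp
    also have "\<dots> = 2 * of_real r * E 0 r"
      unfolding integral_mult_right by (simp add: E_def flip: numeral_2_eq_2)
    finally show ?thesis .
  qed
  have even': "E 0 (- r) = E 0 r" for r
    using D1[of r] D1[of "- r"] odd1[of r] by (cases "r = 0") auto
  \<comment> \<open>Leibniz: the relation D 1 = 2 r E 0 differentiated n times. It transfers the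
    decay of \<open>D\<close> to \<open>E\<close>, which the integral formula does not show. For n =
    0 the term with \<open>n - 1\<close> carries the factor 0.\<close>
  have rec: "2 * of_real r * E n r + 2 * of_nat n * E (n - 1) r = D (n + 1) r" for n r
  proof (induction n arbitrary: r)
    case 0
    show ?case using D1[of r] by simp
  next
    case (Suc n)
    have "((\<lambda>r. 2 * complex_of_real r) has_vector_derivative 2) (at r)"
      using has_vector_derivative_mult_right[OF has_vector_derivative_of_real[OF DERIV_ident[of "at r"]], of "2::complex"]
      by simp
    from has_vector_derivative_add[OF has_vector_derivative_mult[OF this derE[of n]]
        has_vector_derivative_mult_right[OF derE[of "n - 1"], of "2 * of_nat n"]]
    have "(D (n + 1) has_vector_derivative
        2 * of_real r * E (Suc n) r + 2 * E n r + 2 * of_nat n * E (Suc (n - 1)) r) (at r)"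
      unfolding Suc .
    from vector_derivative_unique_at[OF this der] show ?case
      by (cases n) (auto simp: algebra_simps)
  qed
  have from_mult: "\<exists>C. \<forall>r. \<bar>r\<bar> ^ N * cmod (E n r) \<le> C"
    if mult: "\<And>N. \<exists>C. \<forall>r. \<bar>r\<bar> ^ N * cmod (of_real r * E n r) \<le> C" for n N
  proof -
    obtain C where C: "\<And>r. \<bar>r\<bar> ^ N * cmod (of_real r * E n r) \<le> C" using mult by blast
    have "continuous_on {-1..1} (E n)"
      by (meson continuous_at_imp_continuous_on derE has_vector_derivative_continuous)
    hence "bounded (E n ` {-1..1})" by (intro compact_imp_bounded compact_continuous_image) auto
    then obtain B where B: "\<And>r. r \<in> {-1..1} \<Longrightarrow> cmod (E n r) \<le> B" unfolding bounded_iff by blast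
    have "\<bar>r\<bar> ^ N * cmod (E n r) \<le> max B C" for r
    proof (cases "\<bar>r\<bar> \<le> 1")
      case True
      have "\<bar>r\<bar> ^ N * cmod (E n r) \<le> 1 * B"
        by (intro mult_mono power_le_one B) (use True in auto)
      thus ?thesis by simp
    next
      case False
      have "\<bar>r\<bar> ^ N * cmod (E n r) * 1 \<le> \<bar>r\<bar> ^ N * cmod (E n r) * \<bar>r\<bar>"
        by (intro mult_left_mono) (use False in auto)
      also have "\<dots> \<le> C" using C[of r] by (simp add: norm_mult mult_ac)
      finally show ?thesis by simp
    qed
    thus ?thesis by blast
  qed
  have "\<exists>C. \<forall>r. \<bar>r\<bar> ^ N * cmod (E n r) \<le> C" for n N
  proof (induction n arbitrary: N rule: less_induct)
    case (less n)
    show ?case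
    proof (rule from_mult)
      fix N
      obtain C where C: "\<And>r. \<bar>r\<bar> ^ N * cmod (D (n + 1) r) \<le> C" using D unfolding rapid_def by blast
      obtain B where B: "\<And>r. \<bar>r\<bar> ^ N * (real n * cmod (E (n - 1) r)) \<le> B"
      proof (cases n)
        case (Suc m)
        then obtain B where "\<And>r. \<bar>r\<bar> ^ N * cmod (E m r) \<le> B" using less by blast
        hence "\<bar>r\<bar> ^ N * (real n * cmod (E (n - 1) r)) \<le> real n * B" for r
          using mult_left_mono[of "\<bar>r\<bar> ^ N * cmod (E m r)" B "real n"] by (simp add: Suc mult_ac)
        thus ?thesis by (rule that)
      qed (use that in auto)
      have "\<bar>r\<bar> ^ N * cmod (of_real r * E n r) \<le> C / 2 + B" for r
      proof -
        have "of_real r * E n r = D (n + 1) r / 2 - of_nat n * E (n - 1) r"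
          unfolding rec[of r n, symmetric] by (simp add: field_simps)
        hence "cmod (of_real r * E n r) \<le> cmod (D (n + 1) r) / 2 + real n * cmod (E (n - 1) r)"
          using norm_triangle_ineq4[of "D (n + 1) r / 2" "of_nat n * E (n - 1) r"]
          by (simp only: norm_divide norm_mult norm_of_nat norm_numeral)
        hence "\<bar>r\<bar> ^ N * cmod (of_real r * E n r) \<le>
            \<bar>r\<bar> ^ N * (cmod (D (n + 1) r) / 2 + real n * cmod (E (n - 1) r))"
          by (intro mult_left_mono) auto
        also have "\<dots> = (\<bar>r\<bar> ^ N * cmod (D (n + 1) r)) / 2 + \<bar>r\<bar> ^ N * (real n * cmod (E (n - 1) r))"
          by (simp add: distrib_left)
        also have "\<dots> \<le> C / 2 + B" by (intro add_mono divide_right_mono B C) auto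
        finally show ?thesis .
      qed
      thus "\<exists>C. \<forall>r. \<bar>r\<bar> ^ N * cmod (of_real r * E n r) \<le> C" by blast
    qed
  qed
  hence "rapid E" using derE by (auto simp: rapid_def)
  thus ?thesis using even' D1 that by blast
qed

text \<open>\<open>\<Phi> j\<close> is the \<open>j\<close>-th derivative of the function \<open>u \<mapsto> D 0 (sqrt u)\<close>; the point is that it stays
  bounded at \<open>u = 0\<close>.\<close>

lemma rapid_function_of_square:
  assumes D: "rapid D" and even: "\<And>r. D 0 (- r) = D 0 r"
  obtains \<Phi> where "\<And>u. u \<ge> 0 \<Longrightarrow> \<Phi> 0 u = D 0 (sqrt u)"
    "\<And>j u. u > 0 \<Longrightarrow> (\<Phi> j has_vector_derivative \<Phi> (Suc j) u) (at u)"
    "\<And>j. continuous_on {0..} (\<Phi> j)"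
    "\<And>j N. \<exists>C. \<forall>u\<ge>0. cmod (\<Phi> j u) \<le> C / (1 + u) ^ N"
proof -
  \<comment> \<open>The last conjunct pins the first function of the sequence to \<open>D\<close>:
    dependent choice only guarantees that the j-th member satisfies \<open>P j\<close>.\<close>
  define P where "P = (\<lambda>(j::nat) E. rapid E \<and> (\<forall>r. E 0 (- r) = E 0 r) \<and> (j = 0 \<longrightarrow> E = D))"
  have "\<exists>H. \<forall>j. P j (H j) \<and> (\<forall>r. H j 1 r = 2 * of_real r * H (Suc j) 0 r)"
  proof (rule dependent_nat_choice)
    show "\<exists>E. P 0 E" using D even by (auto simp: P_def)
    fix E and j :: nat assume "P j E"
    hence "rapid E" "\<And>r. E 0 (- r) = E 0 r" by (auto simp: P_def)
    from rapid_division_step[OF this] obtain E' where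
      "rapid E'" "\<And>r. E' 0 (- r) = E' 0 r" "\<And>r. E 1 r = 2 * of_real r * E' 0 r" by metis
    thus "\<exists>E'. P (Suc j) E' \<and> (\<forall>r. E 1 r = 2 * of_real r * E' 0 r)" by (auto simp: P_def)
  qed
  then obtain H where H: "\<And>j. rapid (H j)" "H 0 = D" "\<And>j r. H j 1 r = 2 * of_real r * H (Suc j) 0 r"
    unfolding P_def by blast
  define \<Phi> where "\<Phi> j u = H j 0 (sqrt u)" for j u
  show ?thesis
  proof (rule that)
    show "\<Phi> 0 u = D 0 (sqrt u)" for u by (simp add: \<Phi>_def H)
  next
    fix j :: nat and u :: real assume u: "u > 0"
    have 1: "(sqrt has_vector_derivative (inverse (sqrt u) / 2)) (at u)"
      using DERIV_real_sqrt[OF u] by (simp add: has_real_derivative_iff_has_vector_derivative)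
    have 2: "(H j 0 has_vector_derivative H j 1 (sqrt u)) (at (sqrt u))"
      using H(1)[of j] unfolding rapid_def One_nat_def by blast
    have "(inverse (sqrt u) / 2) *\<^sub>R H j 1 (sqrt u) = \<Phi> (Suc j) u"
      unfolding H(3) using u by (simp add: \<Phi>_def scaleR_conv_of_real)
    with vector_diff_chain_at[OF 1 2]
    show "(\<Phi> j has_vector_derivative \<Phi> (Suc j) u) (at u)"
      by (simp only: o_def \<Phi>_def [abs_def])
  next
    fix j
    show "continuous_on {0..} (\<Phi> j)"
      unfolding \<Phi>_def [abs_def]
      by (rule continuous_on_compose2[OF rapid_continuous[OF H(1)[of j], of UNIV 0]]) (auto intro!: continuous_intros)
  next
    fix j N
    obtain C0 where C0: "\<And>r. \<bar>r\<bar> ^ 0 * cmod (H j 0 r) \<le> C0" using H(1)[of j] unfolding rapid_def by blast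
    obtain C1 where C1: "\<And>r. \<bar>r\<bar> ^ (2 * N) * cmod (H j 0 r) \<le> C1" using H(1)[of j] unfolding rapid_def by blast
    have "cmod (\<Phi> j u) \<le> 2 ^ N * max C0 C1 / (1 + u) ^ N" if u: "u \<ge> 0" for u
    proof -
      have "(1 + u) ^ N * cmod (\<Phi> j u) \<le> 2 ^ N * max C0 C1"
      proof (cases "u \<le> 1")
        case True
        have "(1 + u) ^ N * cmod (\<Phi> j u) \<le> 2 ^ N * C0"
          by (intro mult_mono power_mono) (use True u C0[of "sqrt u"] in \<open>auto simp: \<Phi>_def\<close>)
        also have "\<dots> \<le> 2 ^ N * max C0 C1" by (intro mult_left_mono) auto
        finally show ?thesis .
      next
        case False
        have "(1 + u) ^ N * cmod (\<Phi> j u) \<le> (2 * u) ^ N * cmod (\<Phi> j u)"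
          by (intro mult_right_mono power_mono) (use False u in auto)
        also have "\<dots> = 2 ^ N * (\<bar>sqrt u\<bar> ^ (2 * N) * cmod (H j 0 (sqrt u)))"
          using u by (simp add: \<Phi>_def power_mult_distrib power_mult)
        also have "\<dots> \<le> 2 ^ N * max C0 C1" by (intro mult_left_mono) (use C1[of "sqrt u"] in auto)
        finally show ?thesis .
      qed
      thus ?thesis using u by (simp add: field_simps)
    qed
    thus "\<exists>C. \<forall>u\<ge>0. cmod (\<Phi> j u) \<le> C / (1 + u) ^ N" by blast
  qed
qed

section \<open>Approximation by Gaussians\<close>

lemma exp_neg_le_inverse_power:
  fixes c :: real
  assumes c: "c > 0"
  obtains K where "K > 0" "\<And>u. u \<ge> 0 \<Longrightarrow> exp (- c * u) \<le> K / (1 + u) ^ N"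
proof (rule that[of "(real (Suc N) / c) ^ Suc N * exp c"])
  show "(real (Suc N) / c) ^ Suc N * exp c > 0" using c by simp
  fix u :: real assume u: "u \<ge> 0"
  \<comment> \<open>N + 1 in place of N keeps the divisor positive when N = 0.\<close>
  define n where "n = Suc N"
  have n: "n > 0" "real n > 0" by (simp_all add: n_def)
  have "(c * (1 + u) / real n) ^ n \<le> (1 + c * (1 + u) / real n) ^ n"
    by (intro power_mono) (use c u in auto)
  also have "\<dots> \<le> exp (c * (1 + u))"
  proof (rule exp_ge_one_plus_x_over_n_power_n)
    have "c * (1 + u) \<ge> 0" using c u by simp
    thus "c * (1 + u) \<ge> - real n" using n by linarith
  qed (use n in auto)
  finally have le: "(c * (1 + u) / real n) ^ n \<le> exp (c * (1 + u))" .
  have "(1 + u) ^ N \<le> (1 + u) ^ n" unfolding n_def by (rule power_increasing) (use u in auto)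
  also have "(1 + u) ^ n = (real n / c) ^ n * (c * (1 + u) / real n) ^ n"
    using c n by (simp flip: power_mult_distrib)
  also have "\<dots> \<le> (real n / c) ^ n * exp (c * (1 + u))"
    by (intro mult_left_mono le) (use c in auto)
  also have "\<dots> = (real n / c) ^ n * exp c * exp (c * u)" by (simp add: distrib_left exp_add)
  finally have "(1 + u) ^ N \<le> (real n / c) ^ n * exp c * exp (c * u)" .
  hence "exp (- c * u) * (1 + u) ^ N \<le> exp (- c * u) * ((real n / c) ^ n * exp c * exp (c * u))"
    by (intro mult_left_mono) auto
  also have "\<dots> = (real n / c) ^ n * exp c" by (simp add: exp_minus)
  finally show "exp (- c * u) \<le> (real (Suc N) / c) ^ Suc N * exp c / (1 + u) ^ N"
  proof (subst pos_le_divide_eq)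
    show "(1 + u) ^ N > 0" using u by simp
  qed (simp add: n_def)
qed

lemma complex_polynomial_approximation:
  fixes h :: "real \<Rightarrow> complex"
  assumes h: "continuous_on {0..1} h" and e: "e > 0"
  obtains p :: "nat \<Rightarrow> complex" and n where "\<And>x. x \<in> {0..1} \<Longrightarrow> cmod (h x - (\<Sum>i\<le>n. p i * of_real x ^ i)) < e"
proof -
  have e2: "e / 2 > 0" using e by simp
  obtain g1 where g1: "real_polynomial_function g1" "\<And>x. x \<in> {0..1} \<Longrightarrow> \<bar>Re (h x) - g1 x\<bar> < e / 2"
    by (rule Stone_Weierstrass_real_polynomial_function[OF _ _ e2, where f = "\<lambda>x. Re (h x)" and S = "{0..1}"])
       (use h in \<open>auto intro!: continuous_intros\<close>)
  obtain g2 where g2: "real_polynomial_function g2" "\<And>x. x \<in> {0..1} \<Longrightarrow> \<bar>Im (h x) - g2 x\<bar> < e / 2"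
    by (rule Stone_Weierstrass_real_polynomial_function[OF _ _ e2, where f = "\<lambda>x. Im (h x)" and S = "{0..1}"])
       (use h in \<open>auto intro!: continuous_intros\<close>)
  obtain a1 n1 where a1: "g1 = (\<lambda>x. \<Sum>i\<le>n1. a1 i * x ^ i)" using g1(1) by (auto simp: real_polynomial_function_iff_sum)
  obtain a2 n2 where a2: "g2 = (\<lambda>x. \<Sum>i\<le>n2. a2 i * x ^ i)" using g2(1) by (auto simp: real_polynomial_function_iff_sum)
  define n where "n = max n1 n2"
  define p where "p i = Complex (if i \<le> n1 then a1 i else 0) (if i \<le> n2 then a2 i else 0)" for i
  have extend: "(\<Sum>i\<le>m. a i * x ^ i) = (\<Sum>i\<le>n. (if i \<le> m then a i else 0) * x ^ i)" if "m \<le> n"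
    for m and a :: "nat \<Rightarrow> real" and x
    by (rule sum.mono_neutral_cong_left) (use that in auto)
  show ?thesis
  proof (rule that)
    fix x :: real assume x: "x \<in> {0..1}"
    have "(\<Sum>i\<le>n. p i * of_real x ^ i) = Complex (g1 x) (g2 x)"
      unfolding a1 a2 by (subst (1 2) extend) (auto simp: n_def complex_eq_iff p_def simp flip: of_real_power)
    hence "cmod (h x - (\<Sum>i\<le>n. p i * of_real x ^ i)) \<le> \<bar>Re (h x) - g1 x\<bar> + \<bar>Im (h x) - g2 x\<bar>"
      using cmod_le[of "h x - (\<Sum>i\<le>n. p i * of_real x ^ i)"] by simp
    also have "\<dots> < e" using g1(2)[OF x] g2(2)[OF x] by linarith
    finally show "cmod (h x - (\<Sum>i\<le>n. p i * of_real x ^ i)) < e" .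
  qed
qed

text \<open>Cut \<open>\<Phi>\<close> off at infinity and apply Weierstrass to it as a function of \<open>v = exp (- \<pi> u)\<close>, divided by
  \<open>v\<^sup>2\<close>: the factor \<open>v\<^sup>2\<close> put back at the end pays for the weight.\<close>

lemma weighted_exponential_approximation:
  fixes \<Phi> :: "real \<Rightarrow> complex"
  assumes cont: "continuous_on {0..} \<Phi>" and C: "\<And>u. u \<ge> 0 \<Longrightarrow> cmod (\<Phi> u) \<le> C / (1 + u) ^ Suc N"
    and delta: "\<delta> > 0"
  obtains b :: "nat \<Rightarrow> complex" and I where
    "\<And>u. u \<ge> 0 \<Longrightarrow> cmod (\<Phi> u - (\<Sum>i=1..I. b i * of_real (exp (- pi * real i * u)))) \<le> \<delta> / (1 + u) ^ N"
proof -
  have C0: "C \<ge> 0" using order_trans[OF norm_ge_zero C[of 0]] by simp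
  \<comment> \<open>For u > R one factor 1 + u of the decay exceeds 2 C / \<delta>, so the cut-off
    costs at most half of the allowed error.\<close>
  define R where "R = 2 * C / \<delta>"
  have R: "R \<ge> 0" using C0 delta by (simp add: R_def)
  define cut where "cut u = max 0 (min 1 (R + 1 - u))" for u :: real
  define g where "g u = \<Phi> u * of_real (cut u)" for u
  \<comment> \<open>The value of v at u = R + 1, where the cut-off has reached 0. Replacing v by
    \<open>max v \<epsilon>\<close> avoids division by 0 and leaves g / v^2 unchanged for v >
    0.\<close>
  define \<epsilon> where "\<epsilon> = exp (- pi * (R + 1))"
  define U where "U v = - ln (max v \<epsilon>) / pi" for v
  define h where "h v = (if v \<in> {0..1} then g (U v) / of_real ((max v \<epsilon>)\<^sup>2) else 0)" for v
  have eps: "\<epsilon> > 0" "\<epsilon> \<le> 1" using R by (auto simp: \<epsilon>_def)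
  have gc: "continuous_on {0..} g" unfolding g_def cut_def by (intro continuous_intros cont)
  have U0: "U v \<ge> 0" if "v \<in> {0..1}" for v
    using that eps by (auto simp: U_def divide_le_0_iff)
  have max_pos: "max v \<epsilon> > 0" for v using eps by (simp add: less_max_iff_disj)
  have Uc: "continuous_on {0..1} U"
    unfolding U_def by (intro continuous_intros ballI) (use max_pos less_irrefl pi_neq_zero in \<open>metis+\<close>)
  have "continuous_on {0..1} (\<lambda>v. g (U v) / of_real ((max v \<epsilon>)\<^sup>2))"
  proof (intro continuous_intros)
    show "continuous_on {0..1} (\<lambda>v. g (U v))"
      by (rule continuous_on_compose2[OF gc]) (use U0 Uc in auto)
  qed (use eps in auto)
  hence "continuous_on {0..1} h" by (rule continuous_on_eq) (simp add: h_def)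
  obtain K where K: "K > 0" "\<And>u. u \<ge> 0 \<Longrightarrow> exp (- 2 * pi * u) \<le> K / (1 + u) ^ N"
    by (rule exp_neg_le_inverse_power[of "2 * pi" N]) auto
  obtain p n where p: "\<And>x. x \<in> {0..1} \<Longrightarrow> cmod (h x - (\<Sum>i\<le>n. p i * of_real x ^ i)) < \<delta> / (2 * K)"
    using complex_polynomial_approximation[OF \<open>continuous_on {0..1} h\<close>, of "\<delta> / (2 * K)"] delta K by auto
  \<comment> \<open>Multiplication by v^2 shifts the exponents by 2; no constant term arises, which
    would not decay.\<close>
  define b where "b i = (if i \<ge> 2 then p (i - 2) else 0)" for i
  show ?thesis
  proof (rule that[of b "n + 2"])
    fix u :: real assume u: "u \<ge> 0"
    define v where "v = exp (- pi * u)"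
    have v: "v \<in> {0..1}" "v > 0" using u by (auto simp: v_def)
    have lnv: "- ln v / pi = u" by (simp add: v_def)
    have v2: "v\<^sup>2 = exp (- 2 * pi * u)" by (simp add: v_def power2_eq_square flip: exp_add)
    have "(\<Sum>i=1..n+2. b i * of_real (exp (- pi * real i * u))) = (\<Sum>i=1..n+2. b i * of_real v ^ i)"
      by (intro sum.cong refl) (simp add: v_def mult_ac flip: exp_of_nat_mult of_real_power)
    also have "\<dots> = (\<Sum>i=2..n+2. b i * of_real v ^ i)"
      by (rule sum.mono_neutral_right) (auto simp: b_def)
    also have "\<dots> = (\<Sum>i=0..n. p i * of_real v ^ (i + 2))"
    proof -
      have "(\<Sum>i=2..n+2. b i * of_real v ^ i) = (\<Sum>i=0+2..n+2. b i * of_real v ^ i)" by (simp only: add_0)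
      also have "\<dots> = (\<Sum>i=0..n. b (i + 2) * of_real v ^ (i + 2))" by (rule sum.shift_bounds_cl_nat_ivl)
      also have "\<dots> = (\<Sum>i=0..n. p i * of_real v ^ (i + 2))" by (intro sum.cong refl) (simp add: b_def)
      finally show ?thesis .
    qed
    also have "\<dots> = of_real (v\<^sup>2) * (\<Sum>i\<le>n. p i * of_real v ^ i)"
      by (simp add: atLeast0AtMost sum_distrib_left power_add power2_eq_square mult_ac)
    finally have eq: "(\<Sum>i=1..n+2. b i * of_real (exp (- pi * real i * u))) =
        of_real (v\<^sup>2) * (\<Sum>i\<le>n. p i * of_real v ^ i)" .
    have gv: "g u = of_real (v\<^sup>2) * h v"
    proof (cases "v \<ge> \<epsilon>")
      case True
      thus ?thesis using v lnv by (simp add: h_def U_def max_def)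
    next
      case False
      hence "u > R + 1" by (simp add: v_def \<epsilon>_def)
      hence "g u = 0" by (simp add: g_def cut_def)
      moreover have "U v = R + 1" using False by (simp add: U_def max_def \<epsilon>_def)
      ultimately show ?thesis using v by (simp add: h_def g_def cut_def)
    qed
    have 1: "cmod (g u - of_real (v\<^sup>2) * (\<Sum>i\<le>n. p i * of_real v ^ i)) \<le> \<delta> / 2 / (1 + u) ^ N"
    proof -
      have "cmod (g u - of_real (v\<^sup>2) * (\<Sum>i\<le>n. p i * of_real v ^ i)) =
          v\<^sup>2 * cmod (h v - (\<Sum>i\<le>n. p i * of_real v ^ i))"
        unfolding gv by (simp add: norm_mult norm_power flip: right_diff_distrib)
      also have "\<dots> \<le> K / (1 + u) ^ N * (\<delta> / (2 * K))"
        unfolding v2 by (intro mult_mono K less_imp_le[OF p] u v) (use K u in auto)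
      also have "\<dots> = \<delta> / 2 / (1 + u) ^ N" using K by simp
      finally show ?thesis .
    qed
    have 2: "cmod (\<Phi> u - g u) \<le> \<delta> / 2 / (1 + u) ^ N"
    proof (cases "u \<le> R")
      case True
      thus ?thesis using delta u by (simp add: g_def cut_def)
    next
      case False
      have "cmod (\<Phi> u - g u) = cmod (\<Phi> u) * \<bar>1 - cut u\<bar>"
      proof -
        have "\<Phi> u - g u = \<Phi> u * of_real (1 - cut u)" by (simp add: g_def algebra_simps)
        thus ?thesis by (simp only: norm_mult norm_of_real)
      qed
      also have "\<dots> \<le> C / (1 + u) ^ Suc N * 1"
        by (intro mult_mono C u) (use C0 u in \<open>auto simp: cut_def\<close>)
      also have "\<dots> = C / (1 + u) / (1 + u) ^ N" by simp
      also have "C / (1 + u) \<le> \<delta> / 2"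
      proof -
        have "2 * C / \<delta> \<le> 1 + u" using False by (simp add: R_def)
        hence "2 * C \<le> (1 + u) * \<delta>" using delta by (simp add: pos_divide_le_eq)
        thus ?thesis using u by (simp add: pos_divide_le_eq mult.commute)
      qed
      finally show ?thesis using u by (simp add: divide_right_mono)
    qed
    have "cmod (\<Phi> u - of_real (v\<^sup>2) * (\<Sum>i\<le>n. p i * of_real v ^ i)) \<le>
        cmod (\<Phi> u - g u) + cmod (g u - of_real (v\<^sup>2) * (\<Sum>i\<le>n. p i * of_real v ^ i))"
      using norm_triangle_ineq[of "\<Phi> u - g u" "g u - of_real (v\<^sup>2) * (\<Sum>i\<le>n. p i * of_real v ^ i)"] by simp
    also have "\<dots> \<le> \<delta> / (1 + u) ^ N" using 1 2 by simp
    finally show "cmod (\<Phi> u - (\<Sum>i=1..n+2. b i * of_real (exp (- pi * real i * u)))) \<le> \<delta> / (1 + u) ^ N"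
      unfolding eq .
  qed
qed

text \<open>Integration from infinity: the mean value inequality with the comparison function
  \<open>\<phi>\<close>, whose derivative is N + 1 times the bound on \<open>e'\<close>, is applied
  on [a, b], and b tends to infinity. One power of 1 + u is lost.\<close>

lemma bound_from_derivative_at_infinity:
  fixes e e' :: "real \<Rightarrow> complex"
  assumes cont: "continuous_on {0..} e" and lim: "(e \<longlongrightarrow> 0) at_top" and delta: "\<delta> \<ge> 0"
    and der: "\<And>u. u > 0 \<Longrightarrow> (e has_vector_derivative e' u) (at u)"
    and bd: "\<And>u. u \<ge> 0 \<Longrightarrow> cmod (e' u) \<le> \<delta> / (1 + u) ^ (N + 2)" and a: "a \<ge> 0"
  shows "cmod (e a) \<le> \<delta> / (1 + a) ^ (N + 1)"
proof -
  define \<phi> where "\<phi> v = - \<delta> / (1 + v) ^ (N + 1)" for v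
  have "cmod (e a) \<le> cmod (e b) + \<delta> / (1 + a) ^ (N + 1)" if b: "b > a" for b
  proof -
    have "norm (e b - e a) \<le> \<phi> b - \<phi> a"
    proof (rule differentiable_bound_general[OF b])
      show "continuous_on {a..b} e" using cont by (rule continuous_on_subset) (use a in auto)
      show "continuous_on {a..b} \<phi>" unfolding \<phi>_def by (intro continuous_intros) (use a in auto)
      fix x assume x: "a < x" "x < b"
      show "(e has_vector_derivative e' x) (at x)" using der a x by simp
      have "((\<lambda>x. 1 + x) has_real_derivative 1) (at x)" by (auto intro!: derivative_eq_intros)
      from DERIV_power_Suc[OF this, of N]
      have p: "((\<lambda>x. (1 + x) ^ (N + 1)) has_real_derivative (real (N + 1) * (1 + x) ^ N)) (at x)" by simp
      have "(\<phi> has_real_derivative (\<delta> * (real (N + 1) * (1 + x) ^ N) / ((1 + x) ^ (N + 1))\<^sup>2)) (at x)"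
        using DERIV_divide[OF DERIV_const[of "- \<delta>"] p] a x by (simp add: \<phi>_def [abs_def] power2_eq_square)
      thus "(\<phi> has_vector_derivative (\<delta> * (real (N + 1) * (1 + x) ^ N) / ((1 + x) ^ (N + 1))\<^sup>2)) (at x)"
        by (simp add: has_real_derivative_iff_has_vector_derivative)
      have "((1 + x) ^ (N + 1))\<^sup>2 = (1 + x) ^ N * (1 + x) ^ (N + 2)"
        by (simp add: power2_eq_square flip: power_add)
      hence "\<delta> * (real (N + 1) * (1 + x) ^ N) / ((1 + x) ^ (N + 1))\<^sup>2 = real (N + 1) * (\<delta> / (1 + x) ^ (N + 2))"
        using a x by simp
      moreover have "1 * (\<delta> / (1 + x) ^ (N + 2)) \<le> real (N + 1) * (\<delta> / (1 + x) ^ (N + 2))"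
        by (intro mult_right_mono) (use delta a x in auto)
      ultimately show "norm (e' x) \<le> \<delta> * (real (N + 1) * (1 + x) ^ N) / ((1 + x) ^ (N + 1))\<^sup>2"
        using bd[of x] a x by simp
    qed
    moreover have "\<phi> b \<le> 0" using delta a b by (simp add: \<phi>_def)
    ultimately have "norm (e b - e a) \<le> \<delta> / (1 + a) ^ (N + 1)" by (simp add: \<phi>_def)
    thus ?thesis using norm_triangle_sub[of "e a" "e b"] by (simp add: norm_minus_commute)
  qed
  hence "\<forall>\<^sub>F b in at_top. cmod (e a) \<le> cmod (e b) + \<delta> / (1 + a) ^ (N + 1)"
    by (auto intro: eventually_mono[OF eventually_gt_at_top[of a]])
  moreover have "((\<lambda>b. cmod (e b) + \<delta> / (1 + a) ^ (N + 1)) \<longlongrightarrow> 0 + \<delta> / (1 + a) ^ (N + 1)) at_top"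
    by (intro tendsto_add tendsto_const tendsto_norm_zero lim)
  ultimately have "cmod (e a) \<le> 0 + \<delta> / (1 + a) ^ (N + 1)"
    by (intro tendsto_lowerbound) auto
  thus ?thesis by simp
qed

text \<open>The j-th derivative in u of a combination of exponentials; for j = 0 and u = |x|^2 it is
  a combination of Gaussians.\<close>

definition exp_sum :: "(nat \<Rightarrow> complex) \<Rightarrow> nat \<Rightarrow> nat \<Rightarrow> real \<Rightarrow> complex" where
  "exp_sum c I j u = (\<Sum>i=1..I. c i * of_real ((- pi * real i) ^ j * exp (- pi * real i * u)))"

lemma exp_sum_derivative: "(exp_sum c I j has_vector_derivative exp_sum c I (Suc j) u) (at u)"
proof -
  have "((\<lambda>u. complex_of_real ((- pi * real i) ^ j * exp (- pi * real i * u))) has_vector_derivative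
      of_real ((- pi * real i) ^ Suc j * exp (- pi * real i * u))) (at u)" for i u
    by (rule has_vector_derivative_of_real)
       (auto intro!: derivative_eq_intros simp flip: has_real_derivative_iff_has_vector_derivative)
  thus ?thesis unfolding exp_sum_def [abs_def]
    by (intro has_vector_derivative_sum has_vector_derivative_mult_right)
qed

lemma exp_sum_tendsto_0: "(exp_sum c I j \<longlongrightarrow> 0) at_top"
proof -
  have "((\<lambda>u. \<Sum>i=1..I. c i * of_real ((- pi * real i) ^ j * exp (- pi * real i * u))) \<longlongrightarrow>
      (\<Sum>i=1..I. c i * of_real ((- pi * real i) ^ j * 0))) at_top"
  proof (intro tendsto_sum tendsto_mult tendsto_const tendsto_of_real)
    fix i assume "i \<in> {1..I}"
    hence "- pi * real i < 0" by simp
    hence "filterlim (\<lambda>u. - pi * real i * u) at_bot at_top"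
      by (intro filterlim_tendsto_neg_mult_at_bot[OF tendsto_const _ filterlim_ident])
    thus "((\<lambda>u. exp (- pi * real i * u)) \<longlongrightarrow> 0) at_top" by (rule filterlim_compose[OF exp_at_bot])
  qed
  thus ?thesis by (simp add: exp_sum_def [abs_def])
qed

text \<open>The highest derivative is approximated first and the lower ones follow by integrating
  from infinity, where both sides vanish. M integrations cost M powers of 1 + u, which the initial N
  = L + M + 1 provides for.\<close>

lemma simultaneous_exponential_approximation:
  fixes \<Phi> :: "nat \<Rightarrow> real \<Rightarrow> complex"
  assumes der: "\<And>j u. u > 0 \<Longrightarrow> (\<Phi> j has_vector_derivative \<Phi> (Suc j) u) (at u)"
    and cont: "\<And>j. continuous_on {0..} (\<Phi> j)"
    and decay: "\<And>j N. \<exists>C. \<forall>u\<ge>0. cmod (\<Phi> j u) \<le> C / (1 + u) ^ N"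
    and delta: "\<delta> > 0"
  obtains c I where "\<And>j u. j \<le> M \<Longrightarrow> u \<ge> 0 \<Longrightarrow> cmod (\<Phi> j u - exp_sum c I j u) \<le> \<delta> / (1 + u) ^ L"
proof -
  define N where "N = L + M + 1"
  obtain C where C: "\<And>u. u \<ge> 0 \<Longrightarrow> cmod (\<Phi> M u) \<le> C / (1 + u) ^ Suc N" using decay by blast
  obtain b I where b: "\<And>u. u \<ge> 0 \<Longrightarrow>
      cmod (\<Phi> M u - (\<Sum>i=1..I. b i * of_real (exp (- pi * real i * u)))) \<le> \<delta> / (1 + u) ^ N"
    using weighted_exponential_approximation[OF cont C delta] by metis
  \<comment> \<open>Division by the factor that M differentiations produce, nonzero since i >= 1,
    makes the M-th derivative of the new sum the approximant just found.\<close>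
  define c where "c i = b i / of_real ((- pi * real i) ^ M)" for i
  have lim: "(\<Phi> j \<longlongrightarrow> 0) at_top" for j
  proof -
    obtain C where C: "\<And>u. u \<ge> 0 \<Longrightarrow> cmod (\<Phi> j u) \<le> C / (1 + u) ^ 1" using decay by blast
    have "((\<lambda>u. C / (1 + u)) \<longlongrightarrow> 0) at_top"
      by (intro tendsto_divide_0[OF tendsto_const] filterlim_at_top_imp_at_infinity
        filterlim_tendsto_add_at_top[OF tendsto_const filterlim_ident])
    thus ?thesis
      by (rule Lim_null_comparison[rotated]) (use C in \<open>auto intro!: eventually_mono[OF eventually_ge_at_top[of 0]]\<close>)
  qed
  have main: "\<forall>u\<ge>0. cmod (\<Phi> (M - i) u - exp_sum c I (M - i) u) \<le> \<delta> / (1 + u) ^ (N - i)" if "i \<le> M" for i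
    using that
  proof (induction i)
    case 0
    have "exp_sum c I M u = (\<Sum>i=1..I. b i * of_real (exp (- pi * real i * u)))" for u
      unfolding exp_sum_def by (intro sum.cong refl) (auto simp: c_def)
    thus ?case using b by simp
  next
    case (Suc i)
    define j where "j = M - Suc i"
    have j: "M - i = Suc j" using Suc by (simp add: j_def)
    have N: "N - i = N - Suc i - 1 + 2" "N - Suc i = N - Suc i - 1 + 1" using Suc by (auto simp: N_def)
    show ?case
    proof (intro allI impI)
      fix u :: real assume u: "u \<ge> 0"
      have "cmod (\<Phi> j u - exp_sum c I j u) \<le> \<delta> / (1 + u) ^ (N - Suc i - 1 + 1)"
      proof (rule bound_from_derivative_at_infinity[where e = "\<lambda>u. \<Phi> j u - exp_sum c I j u"
            and e' = "\<lambda>u. \<Phi> (Suc j) u - exp_sum c I (Suc j) u"])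
        show "continuous_on {0..} (\<lambda>u. \<Phi> j u - exp_sum c I j u)"
          by (intro continuous_on_diff cont)
             (meson continuous_at_imp_continuous_on exp_sum_derivative has_vector_derivative_continuous)
        show "((\<lambda>u. \<Phi> j u - exp_sum c I j u) \<longlongrightarrow> 0) at_top"
          using tendsto_diff[OF lim exp_sum_tendsto_0] by simp
        show "((\<lambda>u. \<Phi> j u - exp_sum c I j u) has_vector_derivative \<Phi> (Suc j) u - exp_sum c I (Suc j) u) (at u)"
          if "u > 0" for u by (intro has_vector_derivative_diff der exp_sum_derivative that)
        show "cmod (\<Phi> (Suc j) u - exp_sum c I (Suc j) u) \<le> \<delta> / (1 + u) ^ (N - Suc i - 1 + 2)" if "u \<ge> 0" for u
          using Suc that unfolding j N(1) by auto
      qed (use delta u in auto)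
      thus "cmod (\<Phi> (M - Suc i) u - exp_sum c I (M - Suc i) u) \<le> \<delta> / (1 + u) ^ (N - Suc i)"
        unfolding j_def using N(2) by metis
    qed
  qed
  show ?thesis
  proof (rule that)
    fix j u assume j: "j \<le> M" and u: "(u::real) \<ge> 0"
    have "cmod (\<Phi> j u - exp_sum c I j u) \<le> \<delta> / (1 + u) ^ (N - (M - j))"
      using main[of "M - j"] j u by simp
    also have "\<dots> \<le> \<delta> / (1 + u) ^ L"
      by (intro divide_left_mono power_increasing) (use j u delta in \<open>auto simp: N_def\<close>)
    finally show "cmod (\<Phi> j u - exp_sum c I j u) \<le> \<delta> / (1 + u) ^ L" .
  qed
qed

section \<open>Fourier transforms of Gaussians\<close>

lemma integrable_inverse_one_plus_square: "integrable lborel (\<lambda>x::real. 1 / (1 + x\<^sup>2))"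
  using integrable_inverse_1_plus_square by (simp add: set_integrable_def inverse_eq_divide)

abbreviation mode :: "real \<Rightarrow> real \<Rightarrow> complex" where
  "mode \<xi> x \<equiv> exp (- 2 * pi * \<i> * of_real (x * \<xi>))"

text \<open>Scaling by sqrt(2 pi a) reduces this to the characteristic function of the standard
  normal distribution.\<close>

lemma gaussian_fourier_1d:
  fixes a \<xi> :: real
  assumes a: "a > 0"
  shows "(LINT x|lborel. of_real (exp (- pi * a * x\<^sup>2)) * mode \<xi> x) =
    complex_of_real (exp (- pi * \<xi>\<^sup>2 / a) / sqrt a)"
proof -
  define c where "c = sqrt (2 * pi * a)"
  define t where "t = - 2 * pi * \<xi> / c"
  have c: "c > 0" "c\<^sup>2 = 2 * pi * a" using a by (auto simp: c_def)
  have ct: "c * t = - 2 * pi * \<xi>" using c by (simp add: t_def)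
  have "t\<^sup>2 = (2 * pi * \<xi>)\<^sup>2 / c\<^sup>2" by (simp add: t_def power_divide)
  hence t2: "t\<^sup>2 / 2 = pi * \<xi>\<^sup>2 / a" unfolding c(2) using a by (simp add: field_simps power2_eq_square)
  have "complex_of_real (exp (- (t\<^sup>2) / 2)) = char std_normal_distribution t"
    by (simp add: char_std_normal_distribution)
  also have "\<dots> = (LINT x|lborel. std_normal_density x *\<^sub>R exp (\<i> * of_real (t * x)))"
    unfolding char_def by (subst integral_density) auto
  also have "\<dots> = c *\<^sub>R (LINT x|lborel. std_normal_density (0 + c * x) *\<^sub>R exp (\<i> * of_real (t * (0 + c * x))))"
    using lborel_integral_real_affine[of c "\<lambda>x. std_normal_density x *\<^sub>R exp (\<i> * of_real (t * x))" 0] c by simp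
  also have "(\<lambda>x. std_normal_density (0 + c * x) *\<^sub>R exp (\<i> * of_real (t * (0 + c * x)))) =
      (\<lambda>x. of_real (1 / sqrt (2 * pi)) * (of_real (exp (- pi * a * x\<^sup>2)) * mode \<xi> x))"
  proof
    fix x
    have "t * (0 + c * x) = (c * t) * x" by simp
    also have "\<dots> = - 2 * pi * (x * \<xi>)" unfolding ct by simp
    finally have "t * (0 + c * x) = - 2 * pi * (x * \<xi>)" .
    hence 1: "\<i> * of_real (t * (0 + c * x)) = - 2 * pi * \<i> * of_real (x * \<xi>)" by simp
    have "- (c * x)\<^sup>2 / 2 = - pi * a * x\<^sup>2" by (simp add: power_mult_distrib c)
    hence 2: "std_normal_density (0 + c * x) = 1 / sqrt (2 * pi) * exp (- pi * a * x\<^sup>2)"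
      unfolding std_normal_density_def by simp
    show "std_normal_density (0 + c * x) *\<^sub>R exp (\<i> * of_real (t * (0 + c * x))) =
      of_real (1 / sqrt (2 * pi)) * (of_real (exp (- pi * a * x\<^sup>2)) * mode \<xi> x)"
      unfolding 1 2 by (simp add: scaleR_conv_of_real)
  qed
  also have "(LINT x|lborel. of_real (1 / sqrt (2 * pi)) * (of_real (exp (- pi * a * x\<^sup>2)) * mode \<xi> x)) =
      of_real (1 / sqrt (2 * pi)) * (LINT x|lborel. of_real (exp (- pi * a * x\<^sup>2)) * mode \<xi> x)"
    by (rule integral_mult_right_zero)
  finally have "complex_of_real (exp (- pi * \<xi>\<^sup>2 / a)) = of_real (c / sqrt (2 * pi)) *
      (LINT x|lborel. of_real (exp (- pi * a * x\<^sup>2)) * mode \<xi> x)"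
    using t2 by (simp add: scaleR_conv_of_real)
  moreover have "c / sqrt (2 * pi) = sqrt a" by (simp add: c_def real_sqrt_mult)
  ultimately show ?thesis using a by (simp add: field_simps)
qed

text \<open>For smooth \<open>A\<close>, the \<open>M\<close>-th derivative of \<open>x \<mapsto> A (x\<^sup>2)\<close> is the sum over \<open>j\<close> of \<open>hermite M j\<close> times the
  \<open>j\<close>-th derivative of \<open>A\<close> at \<open>x\<^sup>2\<close>.\<close>

fun hermite :: "nat \<Rightarrow> nat \<Rightarrow> real poly" where
  "hermite 0 j = (if j = 0 then 1 else 0)"
| "hermite (Suc M) j = pderiv (hermite M j) + (if j = 0 then 0 else [:0, 2:] * hermite M (j - 1))"

lemma hermite_eq_0: "j > M \<Longrightarrow> hermite M j = 0"
  by (induction M arbitrary: j) auto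

definition gauss_deriv :: "real \<Rightarrow> nat \<Rightarrow> real \<Rightarrow> real" where
  "gauss_deriv a M x = (\<Sum>j\<le>M. poly (hermite M j) x * ((- pi * a) ^ j * exp (- pi * a * x\<^sup>2)))"

lemma gauss_deriv_0: "gauss_deriv a 0 x = exp (- pi * a * x\<^sup>2)"
  by (simp add: gauss_deriv_def)

lemma gauss_deriv_derivative:
  "(gauss_deriv a M has_real_derivative gauss_deriv a (Suc M) x) (at x)"
proof -
  define e where "e x = exp (- pi * a * x\<^sup>2)" for x
  have e: "(e has_real_derivative (- pi * a * (2 * x)) * e x) (at x)" for x
    unfolding e_def [abs_def] by (auto intro!: derivative_eq_intros)
  have "(gauss_deriv a M has_real_derivative (\<Sum>j\<le>M. poly (pderiv (hermite M j)) x * ((- pi * a) ^ j * e x) +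
      (- pi * a) ^ j * ((- pi * a * (2 * x)) * e x) * poly (hermite M j) x)) (at x)"
    unfolding gauss_deriv_def [abs_def] e_def[symmetric]
    by (intro DERIV_sum DERIV_mult poly_DERIV DERIV_cmult e)
  also have "(\<Sum>j\<le>M. poly (pderiv (hermite M j)) x * ((- pi * a) ^ j * e x) +
      (- pi * a) ^ j * ((- pi * a * (2 * x)) * e x) * poly (hermite M j) x) =
      (\<Sum>j\<le>M. poly (pderiv (hermite M j)) x * ((- pi * a) ^ j * e x)) +
      (\<Sum>j\<le>M. (2 * x * poly (hermite M j) x) * ((- pi * a) ^ Suc j * e x))"
    unfolding sum.distrib[symmetric] by (intro sum.cong refl) (simp add: algebra_simps)
  also have "(\<Sum>j\<le>M. poly (pderiv (hermite M j)) x * ((- pi * a) ^ j * e x)) =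
      (\<Sum>j\<le>Suc M. poly (pderiv (hermite M j)) x * ((- pi * a) ^ j * e x))"
    by (simp add: hermite_eq_0)
  also have "(\<Sum>j\<le>M. (2 * x * poly (hermite M j) x) * ((- pi * a) ^ Suc j * e x)) =
      (\<Sum>j\<le>Suc M. poly (if j = 0 then 0 else [:0, 2:] * hermite M (j - 1)) x * ((- pi * a) ^ j * e x))"
    unfolding sum.atMost_Suc_shift by (simp add: mult_ac)
  also have "(\<Sum>j\<le>Suc M. poly (pderiv (hermite M j)) x * ((- pi * a) ^ j * e x)) + \<dots> = gauss_deriv a (Suc M) x"
    unfolding sum.distrib[symmetric] gauss_deriv_def e_def hermite.simps(2) poly_add
    by (intro sum.cong refl) (simp only: distrib_right)
  finally show ?thesis .
qed

lemma poly_le_power: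
  fixes p :: "real poly"
  obtains C where "C \<ge> 0" "\<And>x. \<bar>poly p x\<bar> \<le> C * (1 + x\<^sup>2) ^ degree p"
proof (rule that[of "\<Sum>i\<le>degree p. \<bar>coeff p i\<bar>"])
  fix x :: real
  have x1: "\<bar>x\<bar> \<le> 1 + x\<^sup>2"
  proof -
    have "0 \<le> (\<bar>x\<bar> - 1)\<^sup>2" by simp
    hence "2 * \<bar>x\<bar> \<le> 1 + x\<^sup>2" by (simp add: power2_eq_square algebra_simps)
    thus ?thesis by linarith
  qed
  have "\<bar>poly p x\<bar> \<le> (\<Sum>i\<le>degree p. \<bar>coeff p i\<bar> * \<bar>x\<bar> ^ i)"
    unfolding poly_altdef by (rule order_trans[OF sum_abs]) (simp add: abs_mult power_abs)
  also have "\<dots> \<le> (\<Sum>i\<le>degree p. \<bar>coeff p i\<bar> * (1 + x\<^sup>2) ^ degree p)"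
  proof (intro sum_mono mult_left_mono)
    fix i assume i: "i \<in> {..degree p}"
    have "\<bar>x\<bar> ^ i \<le> (1 + x\<^sup>2) ^ i" by (intro power_mono x1) auto
    also have "\<dots> \<le> (1 + x\<^sup>2) ^ degree p" by (intro power_increasing) (use i in auto)
    finally show "\<bar>x\<bar> ^ i \<le> (1 + x\<^sup>2) ^ degree p" .
  qed auto
  finally show "\<bar>poly p x\<bar> \<le> (\<Sum>i\<le>degree p. \<bar>coeff p i\<bar>) * (1 + x\<^sup>2) ^ degree p"
    by (simp add: sum_distrib_right)
qed (auto intro: sum_nonneg)

lemma hermite_le_power:
  obtains C D where "C \<ge> 0" "\<And>j x. \<bar>poly (hermite M j) x\<bar> \<le> C * (1 + x\<^sup>2) ^ D"
proof -
  have "\<exists>C\<ge>0. \<forall>x. \<bar>poly (hermite M j) x\<bar> \<le> C * (1 + x\<^sup>2) ^ degree (hermite M j)" for j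
    using poly_le_power[of "hermite M j"] by metis
  then obtain c where c: "\<And>j. c j \<ge> 0" "\<And>j x. \<bar>poly (hermite M j) x\<bar> \<le> c j * (1 + x\<^sup>2) ^ degree (hermite M j)"
    by metis
  show ?thesis
  proof (rule that[of "\<Sum>j\<le>M. c j" "\<Sum>j\<le>M. degree (hermite M j)"])
    fix j x
    show "\<bar>poly (hermite M j) x\<bar> \<le> (\<Sum>j\<le>M. c j) * (1 + x\<^sup>2) ^ (\<Sum>j\<le>M. degree (hermite M j))"
    proof (cases "j \<le> M")
      case True
      have "\<bar>poly (hermite M j) x\<bar> \<le> c j * (1 + x\<^sup>2) ^ degree (hermite M j)" by (rule c)
      also have "\<dots> \<le> (\<Sum>j\<le>M. c j) * (1 + x\<^sup>2) ^ (\<Sum>j\<le>M. degree (hermite M j))"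
        by (intro mult_mono power_increasing member_le_sum) (use True c in \<open>auto intro!: sum_nonneg\<close>)
      finally show ?thesis .
    qed (use c in \<open>auto simp: hermite_eq_0 intro!: mult_nonneg_nonneg sum_nonneg\<close>)
  qed (use c in \<open>auto intro: sum_nonneg\<close>)
qed

lemma gauss_deriv_le:
  assumes a: "a > 0"
  obtains C where "\<And>x. \<bar>gauss_deriv a M x\<bar> \<le> C / (1 + x\<^sup>2)"
proof -
  obtain C D where C: "C \<ge> 0" "\<And>j x. \<bar>poly (hermite M j) x\<bar> \<le> C * (1 + x\<^sup>2) ^ D"
    using hermite_le_power by metis
  obtain K where K: "K > 0" "\<And>u. u \<ge> 0 \<Longrightarrow> exp (- (pi * a) * u) \<le> K / (1 + u) ^ Suc D"
    by (rule exp_neg_le_inverse_power[of "pi * a" "Suc D"]) (use a in auto)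
  have "\<bar>gauss_deriv a M x\<bar> \<le> (\<Sum>j\<le>M. C * (pi * a) ^ j * K) / (1 + x\<^sup>2)" for x
  proof -
    have "\<bar>gauss_deriv a M x\<bar> \<le> (\<Sum>j\<le>M. \<bar>poly (hermite M j) x\<bar> * ((pi * a) ^ j * exp (- (pi * a) * x\<^sup>2)))"
      unfolding gauss_deriv_def using a
      by (intro order_trans[OF sum_abs] sum_mono) (simp add: abs_mult power_abs)
    also have "\<dots> \<le> (\<Sum>j\<le>M. C * (1 + x\<^sup>2) ^ D * ((pi * a) ^ j * (K / (1 + x\<^sup>2) ^ Suc D)))"
      by (intro sum_mono mult_mono C mult_left_mono K) (use a C in auto)
    also have "\<dots> = (\<Sum>j\<le>M. C * (pi * a) ^ j * K / (1 + x\<^sup>2))"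
    proof (intro sum.cong refl)
      fix j
      have "C * w ^ D * (P * (K / w ^ Suc D)) = C * P * K / w" if "w > 0" for w P :: real
        using that by (simp add: field_simps)
      thus "C * (1 + x\<^sup>2) ^ D * ((pi * a) ^ j * (K / (1 + x\<^sup>2) ^ Suc D)) = C * (pi * a) ^ j * K / (1 + x\<^sup>2)"
        by (simp only: add_pos_nonneg zero_less_one zero_le_power2)
    qed
    finally show ?thesis by (simp add: sum_divide_distrib)
  qed
  thus ?thesis by (rule that)
qed

lemma gauss_deriv_continuous: "continuous_on A (gauss_deriv a M)"
  by (meson DERIV_isCont continuous_at_imp_continuous_on gauss_deriv_derivative)

lemma integrable_gauss_deriv_fourier:
  assumes a: "a > 0"
  shows "integrable lborel (\<lambda>x. of_real (gauss_deriv a M x) * mode \<xi> x)"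
proof -
  obtain C where C: "\<And>x. \<bar>gauss_deriv a M x\<bar> \<le> C / (1 + x\<^sup>2)" using gauss_deriv_le[OF a] by metis
  have "integrable lborel (\<lambda>x::real. C * (1 / (1 + x\<^sup>2)))"
    by (intro integrable_mult_right integrable_inverse_one_plus_square)
  thus ?thesis
  proof (rule Bochner_Integration.integrable_bound)
    show "(\<lambda>x. of_real (gauss_deriv a M x) * mode \<xi> x) \<in> borel_measurable lborel"
    proof -
      have "(\<lambda>x. of_real (gauss_deriv a M x) * mode \<xi> x) \<in> borel_measurable borel"
        by (intro borel_measurable_continuous_onI continuous_intros gauss_deriv_continuous)
      thus ?thesis by simp
    qed
    show "AE x in lborel. norm (of_real (gauss_deriv a M x) * mode \<xi> x) \<le> norm (C * (1 / (1 + x\<^sup>2)))"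
    proof (intro AE_I2)
      fix x
      have "\<bar>gauss_deriv a M x\<bar> \<le> \<bar>C\<bar> / (1 + x\<^sup>2)"
        by (rule order_trans[OF C divide_right_mono]) auto
      thus "norm (of_real (gauss_deriv a M x) * mode \<xi> x) \<le> norm (C * (1 / (1 + x\<^sup>2)))"
        by (simp add: norm_mult)
    qed
  qed
qed

lemma integral_derivative_eq_0:
  fixes G :: "real \<Rightarrow> complex"
  assumes G: "\<And>x. (G has_vector_derivative g x) (at x)" and g: "continuous_on UNIV g" "integrable lborel g"
    and lim: "(G \<longlongrightarrow> 0) at_top" "(G \<longlongrightarrow> 0) at_bot"
  shows "(LINT x|lborel. g x) = 0"
proof -
  have "(LBINT x=-\<infinity>..\<infinity>. g x) = 0 - 0"
  proof (rule interval_integral_FTC_integrable)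
    show "isCont g x" for x using g(1) by (simp add: continuous_on_eq_continuous_at)
    show "set_integrable lborel (einterval (-\<infinity>) \<infinity>) g" using g(2) by (simp add: set_integrable_def)
    show "((G \<circ> real_of_ereal) \<longlongrightarrow> 0) (at_right (-\<infinity>))" "((G \<circ> real_of_ereal) \<longlongrightarrow> 0) (at_left \<infinity>)"
      using lim by (simp_all add: ereal_tendsto_simps)
  qed (use G in auto)
  thus ?thesis by (simp add: interval_lebesgue_integral_def set_lebesgue_integral_def)
qed

text \<open>Integration by parts, in the form that the derivative of \<open>G\<close>, which
  vanishes at both ends, has integral 0.\<close>

lemma gauss_deriv_fourier_Suc:
  assumes a: "a > 0"
  shows "(LINT x|lborel. of_real (gauss_deriv a (Suc M) x) * mode \<xi> x) =
    (2 * pi * \<i> * \<xi>) * (LINT x|lborel. of_real (gauss_deriv a M x) * mode \<xi> x)"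
proof -
  define E where "E x = mode \<xi> x" for x
  define G where "G x = of_real (gauss_deriv a M x) * E x" for x
  define g where "g x = of_real (gauss_deriv a (Suc M) x) * E x - (2 * pi * \<i> * \<xi>) * G x" for x
  obtain C where C: "\<And>x. \<bar>gauss_deriv a M x\<bar> \<le> C / (1 + x\<^sup>2)" using gauss_deriv_le[OF a] by metis
  have int: "integrable lborel G" "integrable lborel (\<lambda>x. of_real (gauss_deriv a (Suc M) x) * E x)"
    unfolding G_def E_def by (rule integrable_gauss_deriv_fourier[OF a])+
  have E: "(E has_vector_derivative - (2 * pi * \<i> * \<xi>) * E x) (at x)" for x
  proof -
    have "((\<lambda>z. exp (- 2 * pi * \<i> * (z * \<xi>))) has_field_derivative - (2 * pi * \<i> * \<xi>) * exp (- 2 * pi * \<i> * (of_real x * \<xi>))) (at (of_real x))"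
      by (auto intro!: derivative_eq_intros)
    from has_vector_derivative_real_field[OF this] show ?thesis by (simp add: E_def [abs_def])
  qed
  have normE: "cmod (E x) = 1" for x by (simp add: E_def)
  have bnd: "cmod (G x) \<le> C / (1 + x\<^sup>2)" for x using C by (simp add: G_def norm_mult normE)
  have "(LINT x|lborel. g x) = 0"
  proof (rule integral_derivative_eq_0)
    fix x
    show "(G has_vector_derivative g x) (at x)"
      using has_vector_derivative_mult[OF has_vector_derivative_of_real[OF gauss_deriv_derivative[of a M x]] E[of x]]
      by (simp add: G_def [abs_def] g_def algebra_simps)
  next
    show "continuous_on UNIV g" unfolding g_def G_def E_def
      by (intro continuous_intros gauss_deriv_continuous)
    show "integrable lborel g" unfolding g_def using int by auto
    have "((\<lambda>x::real. C / (1 + x\<^sup>2)) \<longlongrightarrow> 0) at_top" by real_asymp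
    thus "(G \<longlongrightarrow> 0) at_top" by (rule Lim_null_comparison[rotated]) (use bnd in auto)
    have "((\<lambda>x::real. C / (1 + x\<^sup>2)) \<longlongrightarrow> 0) at_bot" by real_asymp
    thus "(G \<longlongrightarrow> 0) at_bot" by (rule Lim_null_comparison[rotated]) (use bnd in auto)
  qed
  hence "(LINT x|lborel. of_real (gauss_deriv a (Suc M) x) * E x) - (2 * pi * \<i> * \<xi>) * (LINT x|lborel. G x) = 0"
    unfolding g_def using int by simp
  thus ?thesis by (simp add: G_def E_def)
qed

lemma gauss_deriv_fourier:
  assumes a: "a > 0"
  shows "(LINT x|lborel. of_real (gauss_deriv a M x) * mode \<xi> x) =
    (2 * pi * \<i> * \<xi>) ^ M * of_real (exp (- pi * \<xi>\<^sup>2 / a) / sqrt a)"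
proof (induction M)
  case 0
  show ?case using gaussian_fourier_1d[OF a, of \<xi>] by (simp add: gauss_deriv_0)
next
  case (Suc M)
  thus ?case unfolding gauss_deriv_fourier_Suc[OF a] by simp
qed

section \<open>Fourier transforms of Gaussian sums in dimension d\<close>

definition sqnorm :: "nat \<Rightarrow> (nat \<Rightarrow> real) \<Rightarrow> real" where
  "sqnorm d x = (\<Sum>i<d. (x i)\<^sup>2)"

lemma sqnorm_nonneg: "sqnorm d x \<ge> 0"
  by (simp add: sqnorm_def sum_nonneg)

lemma enorm_conv_sqnorm: "enorm d x = sqrt (sqnorm d x)"
  by (simp add: L2_set_def sqnorm_def)

lemma sqnorm_conv_enorm: "sqnorm d x = (enorm d x)\<^sup>2"
  by (simp add: enorm_conv_sqnorm sqnorm_nonneg)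

lemma
  fixes f :: "nat \<Rightarrow> real \<Rightarrow> 'a :: {real_normed_field, banach, second_countable_topology}"
  assumes "\<And>i. i < d \<Longrightarrow> integrable lborel (f i)"
  shows integrable_prod_euc: "integrable (lebesgue_euc d) (\<lambda>x. \<Prod>i<d. f i (x i))"
    and integral_prod_euc: "(LINT x|lebesgue_euc d. (\<Prod>i<d. f i (x i))) = (\<Prod>i<d. LINT t|lborel. f i t)"
proof -
  interpret product_sigma_finite "\<lambda>_::nat. lborel :: real measure" by standard
  show "integrable (lebesgue_euc d) (\<lambda>x. \<Prod>i<d. f i (x i))"
    unfolding lebesgue_euc_def by (rule product_integrable_prod) (use assms in auto)
  show "(LINT x|lebesgue_euc d. (\<Prod>i<d. f i (x i))) = (\<Prod>i<d. LINT t|lborel. f i t)"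
    unfolding lebesgue_euc_def by (rule product_integral_prod) (use assms in auto)
qed

definition character :: "nat \<Rightarrow> (nat \<Rightarrow> real) \<Rightarrow> (nat \<Rightarrow> real) \<Rightarrow> complex" where
  "character d \<xi> x = exp (- 2 * pi * \<i> * complex_of_real (\<Sum>i<d. x i * \<xi> i))"

lemma cmod_character [simp]: "cmod (character d \<xi> x) = 1"
  by (simp add: character_def)

text \<open>Each Gaussian exp(-pi i |x|^2) is replaced by its transform; the result is the transform
  of \<open>exp_sum c I 0\<close> at |x|^2, as a function of the squared norm u of the
  frequency.\<close>

definition exp_sum_hat :: "nat \<Rightarrow> (nat \<Rightarrow> complex) \<Rightarrow> nat \<Rightarrow> real \<Rightarrow> complex" where
  "exp_sum_hat d c I u = (\<Sum>i=1..I. c i * of_real (exp (- pi * u / real i) / sqrt (real i) ^ d))"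

text \<open>All M derivatives are taken in coordinate 0, so the integrand remains a product of
  one-variable factors. On the first axis the factor produced on the transform side has modulus (2
  pi |\<xi>|)^M.\<close>

lemma gauss_deriv_fourier_euc:
  assumes d: "d \<ge> 1" and a: "a > 0"
  shows "has_bochner_integral (lebesgue_euc d)
    (\<lambda>x. of_real (\<Sum>j\<le>M. poly (hermite M j) (x 0) * ((- pi * a) ^ j * exp (- pi * a * sqnorm d x))) * character d \<xi> x)
    ((2 * pi * \<i> * \<xi> 0) ^ M * of_real (exp (- pi * sqnorm d \<xi> / a) / sqrt a ^ d))"
proof -
  define f where "f i t = of_real (gauss_deriv a (if i = 0 then M else 0) t) * mode (\<xi> i) t" for i t
  have "{..<d} = insert 0 {1..<d}" using d by auto
  hence split0: "(\<Prod>i<d. h i) = h 0 * (\<Prod>i\<in>{1..<d}. h i)" "(\<Sum>i<d. g i) = g 0 + (\<Sum>i\<in>{1..<d}. g i)"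
    for h :: "nat \<Rightarrow> 'c::comm_monoid_mult" and g :: "nat \<Rightarrow> 'd::comm_monoid_add" by simp_all
  have eq: "(\<Prod>i<d. f i (x i)) =
      of_real (\<Sum>j\<le>M. poly (hermite M j) (x 0) * ((- pi * a) ^ j * exp (- pi * a * sqnorm d x))) * character d \<xi> x" for x
  proof -
    have "(\<Prod>i<d. f i (x i)) = of_real (\<Prod>i<d. gauss_deriv a (if i = 0 then M else 0) (x i)) *
        (\<Prod>i<d. mode (\<xi> i) (x i))"
      unfolding f_def prod.distrib of_real_prod ..
    also have "(\<Prod>i<d. mode (\<xi> i) (x i)) = character d \<xi> x"
      by (simp add: character_def sum_distrib_left flip: exp_sum)
    also have "(\<Prod>i<d. gauss_deriv a (if i = 0 then M else 0) (x i)) =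
        gauss_deriv a M (x 0) * (\<Prod>i\<in>{1..<d}. gauss_deriv a 0 (x i))"
      unfolding split0 by (intro arg_cong2[where f = "(*)"] prod.cong refl) auto
    also have "(\<Prod>i\<in>{1..<d}. gauss_deriv a 0 (x i)) = exp (\<Sum>i\<in>{1..<d}. - pi * a * (x i)\<^sup>2)"
      by (simp add: gauss_deriv_0 exp_sum)
    also have "gauss_deriv a M (x 0) * exp (\<Sum>i\<in>{1..<d}. - pi * a * (x i)\<^sup>2) =
        (\<Sum>j\<le>M. poly (hermite M j) (x 0) * ((- pi * a) ^ j * exp (- pi * a * sqnorm d x)))"
    proof -
      have "exp (- pi * a * (x 0)\<^sup>2) * exp (\<Sum>i\<in>{1..<d}. - pi * a * (x i)\<^sup>2) = exp (- pi * a * sqnorm d x)"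
        unfolding sqnorm_def split0 distrib_left exp_add sum_distrib_left ..
      thus ?thesis unfolding gauss_deriv_def sum_distrib_right by (simp only: mult.assoc)
    qed
    finally show ?thesis .
  qed
  have int: "integrable lborel (f i)" for i
    unfolding f_def [abs_def] by (rule integrable_gauss_deriv_fourier[OF a])
  have val: "(LINT t|lborel. f i t) = (2 * pi * \<i> * \<xi> i) ^ (if i = 0 then M else 0) * of_real (exp (- pi * (\<xi> i)\<^sup>2 / a) / sqrt a)" for i
    unfolding f_def [abs_def] by (rule gauss_deriv_fourier[OF a])
  have "(\<Prod>i<d. LINT t|lborel. f i t) =
      (\<Prod>i<d. (2 * pi * \<i> * \<xi> i) ^ (if i = 0 then M else 0)) * of_real (\<Prod>i<d. exp (- pi * (\<xi> i)\<^sup>2 / a) / sqrt a)"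
    unfolding val prod.distrib of_real_prod ..
  also have "(\<Prod>i<d. (2 * pi * \<i> * \<xi> i) ^ (if i = 0 then M else 0)) = (2 * pi * \<i> * \<xi> 0) ^ M"
    unfolding split0 by simp
  also have "(\<Prod>i<d. exp (- pi * (\<xi> i)\<^sup>2 / a) / sqrt a) = exp (- pi * sqnorm d \<xi> / a) / sqrt a ^ d"
    by (simp add: prod_dividef exp_sum[symmetric] sqnorm_def sum_distrib_left sum_divide_distrib sum_negf)
  finally have "(LINT x|lebesgue_euc d. (\<Prod>i<d. f i (x i))) =
      (2 * pi * \<i> * \<xi> 0) ^ M * of_real (exp (- pi * sqnorm d \<xi> / a) / sqrt a ^ d)"
    using integral_prod_euc[of d f, OF int] by simp
  moreover have "integrable (lebesgue_euc d) (\<lambda>x. \<Prod>i<d. f i (x i))" by (rule integrable_prod_euc[OF int])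
  ultimately have "has_bochner_integral (lebesgue_euc d) (\<lambda>x. \<Prod>i<d. f i (x i))
      ((2 * pi * \<i> * \<xi> 0) ^ M * of_real (exp (- pi * sqnorm d \<xi> / a) / sqrt a ^ d))"
    by (simp add: has_bochner_integral_iff)
  thus ?thesis unfolding eq .
qed

lemma exp_sum_fourier_euc:
  assumes d: "d \<ge> 1"
  shows "has_bochner_integral (lebesgue_euc d)
    (\<lambda>x. (\<Sum>j\<le>M. of_real (poly (hermite M j) (x 0)) * exp_sum c I j (sqnorm d x)) * character d \<xi> x)
    ((2 * pi * \<i> * \<xi> 0) ^ M * exp_sum_hat d c I (sqnorm d \<xi>))"
proof -
  have "has_bochner_integral (lebesgue_euc d)
    (\<lambda>x. \<Sum>i=1..I. c i * (of_real (\<Sum>j\<le>M. poly (hermite M j) (x 0) *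
       ((- pi * real i) ^ j * exp (- pi * real i * sqnorm d x))) * character d \<xi> x))
    (\<Sum>i=1..I. c i * ((2 * pi * \<i> * \<xi> 0) ^ M * of_real (exp (- pi * sqnorm d \<xi> / real i) / sqrt (real i) ^ d)))"
    by (intro has_bochner_integral_sum has_bochner_integral_mult_right gauss_deriv_fourier_euc[OF d]) auto
  moreover have "(\<Sum>i=1..I. c i * (of_real (\<Sum>j\<le>M. poly (hermite M j) (x 0) *
       ((- pi * real i) ^ j * exp (- pi * real i * sqnorm d x))) * character d \<xi> x)) =
     (\<Sum>j\<le>M. of_real (poly (hermite M j) (x 0)) * exp_sum c I j (sqnorm d x)) * character d \<xi> x" for x
  proof -
    have "(\<Sum>i=1..I. c i * (of_real (\<Sum>j\<le>M. poly (hermite M j) (x 0) *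
       ((- pi * real i) ^ j * exp (- pi * real i * sqnorm d x))) * character d \<xi> x)) =
       (\<Sum>i=1..I. \<Sum>j\<le>M. of_real (poly (hermite M j) (x 0)) *
         (c i * of_real ((- pi * real i) ^ j * exp (- pi * real i * sqnorm d x))) * character d \<xi> x)"
      unfolding of_real_sum of_real_mult sum_distrib_left sum_distrib_right
      by (intro sum.cong refl) (simp only: mult_ac)
    also have "\<dots> = (\<Sum>j\<le>M. of_real (poly (hermite M j) (x 0)) * exp_sum c I j (sqnorm d x)) * character d \<xi> x"
      unfolding exp_sum_def sum_distrib_left sum_distrib_right by (rule sum.swap)
    finally show ?thesis .
  qed
  moreover have "(\<Sum>i=1..I. c i * ((2 * pi * \<i> * \<xi> 0) ^ M * of_real (exp (- pi * sqnorm d \<xi> / real i) / sqrt (real i) ^ d))) =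
      (2 * pi * \<i> * \<xi> 0) ^ M * exp_sum_hat d c I (sqnorm d \<xi>)"
    unfolding exp_sum_hat_def sum_distrib_left by (intro sum.cong refl) (simp only: mult_ac)
  ultimately show ?thesis by simp
qed

lemma exp_sum_fourier:
  assumes d: "d \<ge> 1"
  shows "has_bochner_integral (lebesgue_euc d)
    (\<lambda>x. exp_sum c I 0 (sqnorm d x) * character d \<xi> x) (exp_sum_hat d c I (sqnorm d \<xi>))"
  using exp_sum_fourier_euc[OF d, of 0 c I \<xi>] by simp

text \<open>The product form makes it integrable by Fubini; it dominates (1 + |x|^2)^(-d).\<close>

definition cauchy_weight :: "nat \<Rightarrow> (nat \<Rightarrow> real) \<Rightarrow> real" where
  "cauchy_weight d x = (\<Prod>i<d. 1 / (1 + (x i)\<^sup>2))"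

lemma integrable_cauchy_weight: "integrable (lebesgue_euc d) (cauchy_weight d)"
  unfolding cauchy_weight_def [abs_def]
  by (rule integrable_prod_euc[where f = "\<lambda>_ t. 1 / (1 + t\<^sup>2)"]) (rule integrable_inverse_one_plus_square)

lemma inverse_power_le_cauchy_weight:
  assumes "L \<ge> d"
  shows "1 / (1 + sqnorm d x) ^ L \<le> cauchy_weight d x"
proof -
  have pos: "1 + t\<^sup>2 > 0" for t :: real by (simp add: add_pos_nonneg)
  have "(\<Prod>i<d. 1 + (x i)\<^sup>2) \<le> (\<Prod>i<d. 1 + sqnorm d x)"
  proof (intro prod_mono conjI)
    fix i assume "i \<in> {..<d}"
    thus "1 + (x i)\<^sup>2 \<le> 1 + sqnorm d x"
      unfolding sqnorm_def using member_le_sum[of i "{..<d}" "\<lambda>i. (x i)\<^sup>2"] by simp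
  qed auto
  also have "\<dots> = (1 + sqnorm d x) ^ d" by simp
  also have "\<dots> \<le> (1 + sqnorm d x) ^ L" by (rule power_increasing) (use assms sqnorm_nonneg in auto)
  finally have le: "(\<Prod>i<d. 1 + (x i)\<^sup>2) \<le> (1 + sqnorm d x) ^ L" .
  have "1 / (1 + sqnorm d x) ^ L \<le> 1 / (\<Prod>i<d. 1 + (x i)\<^sup>2)"
  proof (rule divide_left_mono[OF le])
    have "(\<Prod>i<d. 1 + (x i)\<^sup>2) > 0" by (intro prod_pos) (simp add: pos)
    moreover have "(1 + sqnorm d x) ^ L > 0" using sqnorm_nonneg[of d x] by simp
    ultimately show "0 < (1 + sqnorm d x) ^ L * (\<Prod>i<d. 1 + (x i)\<^sup>2)" by simp
  qed simp
  thus ?thesis by (simp add: cauchy_weight_def prod_dividef)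
qed

lemma sqnorm_axis_point: "d \<ge> 1 \<Longrightarrow> sqnorm d (axis_point d r) = r\<^sup>2"
  by (simp add: sqnorm_conv_enorm enorm_axis_point)

text \<open>The transform at a point of the first axis is estimated through M derivatives along that
  axis. \<open>L\<close> and \<open>K\<close> do not depend on \<open>c\<close> and
  \<open>I\<close>: this uniformity over all approximants is what the passage to the limit
  requires.\<close>

lemma exp_sum_hat_decay:
  assumes d: "d \<ge> 1"
  obtains L K where "L \<ge> d" "K \<ge> 0"
    "\<And>c I B \<rho>. (\<And>j u. j \<le> M \<Longrightarrow> u \<ge> 0 \<Longrightarrow> cmod (exp_sum c I j u) \<le> B / (1 + u) ^ L) \<Longrightarrow>
      (2 * pi * \<bar>\<rho>\<bar>) ^ M * cmod (exp_sum_hat d c I (\<rho>\<^sup>2)) \<le> B * K"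
proof -
  obtain C D where C: "C \<ge> 0" "\<And>j x. \<bar>poly (hermite M j) x\<bar> \<le> C * (1 + x\<^sup>2) ^ D"
    using hermite_le_power by metis
  define W where "W = (LINT x|lebesgue_euc d. cauchy_weight d x)"
  have wn: "cauchy_weight d x \<ge> 0" for x by (auto simp: cauchy_weight_def intro!: prod_nonneg)
  have W: "W \<ge> 0" unfolding W_def by (intro integral_nonneg_AE AE_I2 wn)
  \<comment> \<open>\<open>D\<close> powers absorb the growth of the polynomials
    \<open>hermite M j\<close>, and \<open>d\<close> powers give integrability.\<close>
  define L where "L = D + d"
  show ?thesis
  proof (rule that[of L "real (M + 1) * C * W"])
    fix c I B \<rho>
    assume bd: "\<And>j u. j \<le> M \<Longrightarrow> u \<ge> 0 \<Longrightarrow> cmod (exp_sum c I j u) \<le> B / (1 + u) ^ L"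
    have B: "B \<ge> 0" using order_trans[OF norm_ge_zero bd[of 0 0]] by simp
    define \<xi> where "\<xi> = axis_point d \<rho>"
    have xi: "\<xi> 0 = \<rho>" "sqnorm d \<xi> = \<rho>\<^sup>2" using sqnorm_axis_point[OF d] by (auto simp: \<xi>_def axis_point_def)
    let ?f = "\<lambda>x. (\<Sum>j\<le>M. of_real (poly (hermite M j) (x 0)) * exp_sum c I j (sqnorm d x)) * character d \<xi> x"
    note hb = exp_sum_fourier_euc[OF d, of M c I \<xi>]
    have "norm (LINT x|lebesgue_euc d. ?f x) \<le> (LINT x|lebesgue_euc d. norm (?f x))"
      by (rule integral_norm_bound)
    also have "\<dots> \<le> (LINT x|lebesgue_euc d. B * (real (M + 1) * C) * cauchy_weight d x)"
    proof (rule integral_mono)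
      have "integrable (lebesgue_euc d) ?f" using hb by (simp add: has_bochner_integral_iff)
      thus "integrable (lebesgue_euc d) (\<lambda>x. norm (?f x))" by (rule integrable_norm)
      show "integrable (lebesgue_euc d) (\<lambda>x. B * (real (M + 1) * C) * cauchy_weight d x)"
        by (intro integrable_mult_right integrable_cauchy_weight)
      fix x :: "nat \<Rightarrow> real"
      have x0: "1 + (x 0)\<^sup>2 \<le> 1 + sqnorm d x"
        unfolding sqnorm_def using member_le_sum[of 0 "{..<d}" "\<lambda>i. (x i)\<^sup>2"] d by simp
      have "norm (?f x) \<le> (\<Sum>j\<le>M. \<bar>poly (hermite M j) (x 0)\<bar> * cmod (exp_sum c I j (sqnorm d x)))"
        unfolding norm_mult cmod_character mult_1_right
        by (rule order_trans[OF norm_sum]) (simp add: norm_mult)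
      also have "\<dots> \<le> (\<Sum>j\<le>M. B * C * cauchy_weight d x)"
      proof (rule sum_mono)
        fix j assume j: "j \<in> {..M}"
        have "\<bar>poly (hermite M j) (x 0)\<bar> \<le> C * (1 + (x 0)\<^sup>2) ^ D" by (rule C)
        also have "\<dots> \<le> C * (1 + sqnorm d x) ^ D" by (intro mult_left_mono power_mono x0 C) auto
        finally have "\<bar>poly (hermite M j) (x 0)\<bar> * cmod (exp_sum c I j (sqnorm d x)) \<le>
            C * (1 + sqnorm d x) ^ D * (B / (1 + sqnorm d x) ^ L)"
          by (intro mult_mono bd) (use j sqnorm_nonneg C in auto)
        also have "\<dots> = B * C * (1 / (1 + sqnorm d x) ^ d)"
        proof -
          have "1 + sqnorm d x > 0" using sqnorm_nonneg[of d x] by simp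
          thus ?thesis by (simp add: L_def power_add)
        qed
        also have "\<dots> \<le> B * C * cauchy_weight d x"
          by (intro mult_left_mono inverse_power_le_cauchy_weight) (use B C in auto)
        finally show "\<bar>poly (hermite M j) (x 0)\<bar> * cmod (exp_sum c I j (sqnorm d x)) \<le> B * C * cauchy_weight d x" .
      qed
      also have "\<dots> = B * (real (M + 1) * C) * cauchy_weight d x" by simp
      finally show "norm (?f x) \<le> B * (real (M + 1) * C) * cauchy_weight d x" .
    qed
    finally have "norm (LINT x|lebesgue_euc d. ?f x) \<le> B * (real (M + 1) * C) * W"
      by (simp add: W_def)
    moreover have "(LINT x|lebesgue_euc d. ?f x) = (2 * pi * \<i> * \<rho>) ^ M * exp_sum_hat d c I (\<rho>\<^sup>2)"
      using hb by (simp add: has_bochner_integral_iff xi)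
    ultimately show "(2 * pi * \<bar>\<rho>\<bar>) ^ M * cmod (exp_sum_hat d c I (\<rho>\<^sup>2)) \<le> B * (real (M + 1) * C * W)"
      by (simp add: norm_mult norm_power mult_ac)
  qed (use C W in \<open>auto simp: L_def\<close>)
qed

section \<open>Radial Schwartz functions and their transforms as limits of Gaussian sums\<close>

lemma radial_value_eq:
  assumes d: "d \<ge> 1" and "\<rho> \<ge> 0" and f: "\<And>x. x \<in> euc d \<Longrightarrow> f x = F (enorm d x)"
  shows "radial_value d f \<rho> = F \<rho>"
  unfolding radial_value_def
proof (rule the_equality)
  have e: "enorm d (axis_point d \<rho>) = \<rho>" using enorm_axis_point[OF d, of \<rho>] assms(2) by simp
  fix c assume "\<forall>x\<in>euc d. enorm d x = \<rho> \<longrightarrow> f x = c"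
  hence "f (axis_point d \<rho>) = c" using axis_point_in_euc[OF d] e by blast
  thus "c = F \<rho>" using f[OF axis_point_in_euc[OF d]] e by simp
qed (use f in auto)

text \<open>The bounds hold with one \<open>B\<close> for all m; the decay of f and of its transform
  at the nodes is later inherited from them in the limit.\<close>

lemma schwartz_rad_gaussian_approximation:
  assumes d: "d \<ge> 1" and f: "f \<in> schwartz_rad d"
  obtains c I B where
    "\<And>\<rho>. \<rho> \<ge> 0 \<Longrightarrow> (\<lambda>m. exp_sum (c m) (I m) 0 (\<rho>\<^sup>2)) \<longlonglongrightarrow> radial_value d f \<rho>"
    "\<And>\<rho>. \<rho> \<ge> 0 \<Longrightarrow> (\<lambda>m. exp_sum_hat d (c m) (I m) (\<rho>\<^sup>2)) \<longlonglongrightarrow> radial_value d (fourier d f) \<rho>"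
    "\<And>x. x \<in> euc d \<Longrightarrow> f x = radial_value d f (enorm d x)"
    "\<And>m \<rho>. \<rho> \<ge> 0 \<Longrightarrow> \<rho> ^ (2 * N) * cmod (exp_sum (c m) (I m) 0 (\<rho>\<^sup>2)) \<le> B"
    "\<And>m \<rho>. \<rho> \<ge> 0 \<Longrightarrow> \<rho> ^ (2 * N) * cmod (exp_sum_hat d (c m) (I m) (\<rho>\<^sup>2)) \<le> B"
proof -
  define M where "M = 2 * N"
  obtain D where D: "rapid D" "\<And>r. D 0 (- r) = D 0 r" "\<And>x. x \<in> euc d \<Longrightarrow> f x = D 0 (enorm d x)"
    using radial_schwartz_profile[OF d f] by metis
  obtain \<Phi> where Phi0: "\<And>u. u \<ge> 0 \<Longrightarrow> \<Phi> 0 u = D 0 (sqrt u)"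
    and Phi: "\<And>j u. u > 0 \<Longrightarrow> (\<Phi> j has_vector_derivative \<Phi> (Suc j) u) (at u)"
      "\<And>j. continuous_on {0..} (\<Phi> j)"
      "\<And>j N. \<exists>C. \<forall>u\<ge>0. cmod (\<Phi> j u) \<le> C / (1 + u) ^ N"
    using rapid_function_of_square[OF D(1,2)] by metis
  obtain L K where LK: "L \<ge> d" "K \<ge> 0"
    "\<And>c I B \<rho>. (\<And>j u. j \<le> M \<Longrightarrow> u \<ge> 0 \<Longrightarrow> cmod (exp_sum c I j u) \<le> B / (1 + u) ^ L) \<Longrightarrow>
      (2 * pi * \<bar>\<rho>\<bar>) ^ M * cmod (exp_sum_hat d c I (\<rho>\<^sup>2)) \<le> B * K"
    using exp_sum_hat_decay[OF d, of M] by metis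
  \<comment> \<open>N further powers serve the weight \<rho>^(2 N) on the side of f; the transform
    gets its weight from M = 2 N derivatives.\<close>
  define L' where "L' = L + N"
  have "\<exists>c I. \<forall>j\<le>M. \<forall>u\<ge>0. cmod (\<Phi> j u - exp_sum c I j u) \<le> (1 / real (Suc m)) / (1 + u) ^ L'" for m
    by (rule simultaneous_exponential_approximation[where \<Phi> = \<Phi> and \<delta> = "1 / real (Suc m)" and M = M and L = L', OF Phi])
       auto
  then obtain c I where cI: "\<And>m j u. j \<le> M \<Longrightarrow> u \<ge> 0 \<Longrightarrow>
      cmod (\<Phi> j u - exp_sum (c m) (I m) j u) \<le> (1 / real (Suc m)) / (1 + u) ^ L'"
    by metis
  obtain C where C: "\<And>j u. u \<ge> 0 \<Longrightarrow> cmod (\<Phi> j u) \<le> C j / (1 + u) ^ L'"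
  proof -
    have "\<forall>j. \<exists>C. \<forall>u\<ge>0. cmod (\<Phi> j u) \<le> C / (1 + u) ^ L'" using Phi(3) by blast
    then obtain C where "\<forall>j. \<forall>u\<ge>0. cmod (\<Phi> j u) \<le> C j / (1 + u) ^ L'" by metis
    thus ?thesis using that by blast
  qed
  define B where "B = (\<Sum>j\<le>M. \<bar>C j\<bar>) + 1"
  have B: "B \<ge> 1" unfolding B_def by (simp add: sum_nonneg)
  have bd': "cmod (exp_sum (c m) (I m) j u) \<le> B / (1 + u) ^ L'" if "j \<le> M" "u \<ge> 0" for m j u
  proof -
    have "cmod (exp_sum (c m) (I m) j u) \<le> cmod (\<Phi> j u) + cmod (\<Phi> j u - exp_sum (c m) (I m) j u)"
      using norm_triangle_sub[of "exp_sum (c m) (I m) j u" "\<Phi> j u"] by (simp add: norm_minus_commute)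
    also have "\<dots> \<le> C j / (1 + u) ^ L' + (1 / real (Suc m)) / (1 + u) ^ L'"
      by (intro add_mono C cI that)
    also have "\<dots> = (C j + 1 / real (Suc m)) / (1 + u) ^ L'" by (simp only: add_divide_distrib)
    also have "\<dots> \<le> B / (1 + u) ^ L'"
    proof (rule divide_right_mono)
      have "C j \<le> \<bar>C j\<bar>" by simp
      also have "\<dots> \<le> (\<Sum>j\<le>M. \<bar>C j\<bar>)" by (rule member_le_sum) (use that in auto)
      finally show "C j + 1 / real (Suc m) \<le> B" by (auto simp: B_def intro!: add_mono)
    qed (use that in auto)
    finally show ?thesis .
  qed
  have bd: "cmod (exp_sum (c m) (I m) j u) \<le> B / (1 + u) ^ L" if "j \<le> M" "u \<ge> 0" for m j u
    by (rule order_trans[OF bd'[OF that]])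
       (intro divide_left_mono power_increasing, use that B in \<open>auto simp: L'_def\<close>)
  have lim: "(\<lambda>m. exp_sum (c m) (I m) 0 u) \<longlonglongrightarrow> \<Phi> 0 u" if "u \<ge> 0" for u
  proof -
    have "(\<lambda>m. exp_sum (c m) (I m) 0 u - \<Phi> 0 u) \<longlonglongrightarrow> 0"
    proof (rule Lim_null_comparison)
      show "\<forall>\<^sub>F m in sequentially. norm (exp_sum (c m) (I m) 0 u - \<Phi> 0 u) \<le> 1 / real (Suc m)"
      proof (intro always_eventually allI)
        fix m
        have "norm (exp_sum (c m) (I m) 0 u - \<Phi> 0 u) \<le> (1 / real (Suc m)) / (1 + u) ^ L'"
          using cI[of 0 u m] that by (simp add: norm_minus_commute)
        also have "\<dots> \<le> (1 / real (Suc m)) / 1"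
          by (rule divide_left_mono) (use that in auto)
        finally show "norm (exp_sum (c m) (I m) 0 u - \<Phi> 0 u) \<le> 1 / real (Suc m)" by simp
      qed
      show "(\<lambda>m. 1 / real (Suc m)) \<longlonglongrightarrow> 0" by real_asymp
    qed
    thus ?thesis by (rule LIM_zero_cancel)
  qed
  have fx: "f x = \<Phi> 0 (sqnorm d x)" if "x \<in> euc d" for x
    using D(3)[OF that] Phi0[of "sqnorm d x"] sqnorm_nonneg[of d x] by (simp add: enorm_conv_sqnorm)
  have sp: "space (lebesgue_euc d) = euc d" by (simp add: lebesgue_euc_def space_PiM euc_def)
  have flim: "(\<lambda>m. exp_sum_hat d (c m) (I m) (sqnorm d \<xi>)) \<longlonglongrightarrow> fourier d f \<xi>" for \<xi>
  proof -
    let ?g = "\<lambda>m x. exp_sum (c m) (I m) 0 (sqnorm d x) * character d \<xi> x"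
    have ptw: "(\<lambda>m. ?g m x) \<longlonglongrightarrow> f x * character d \<xi> x" if "x \<in> space (lebesgue_euc d)" for x
      using that by (intro tendsto_mult tendsto_const) (auto simp: sp fx intro!: lim sqnorm_nonneg)
    have gm: "?g m \<in> borel_measurable (lebesgue_euc d)" for m
      using exp_sum_fourier[OF d, of "c m" "I m" \<xi>] by (auto simp: has_bochner_integral_iff)
    have "(\<lambda>m. LINT x|lebesgue_euc d. ?g m x) \<longlonglongrightarrow> (LINT x|lebesgue_euc d. f x * character d \<xi> x)"
    proof (rule integral_dominated_convergence[where w = "\<lambda>x. B * cauchy_weight d x"])
      show "(\<lambda>x. f x * character d \<xi> x) \<in> borel_measurable (lebesgue_euc d)"
        by (rule borel_measurable_LIMSEQ_metric[OF gm ptw])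
      show "integrable (lebesgue_euc d) (\<lambda>x. B * cauchy_weight d x)"
        by (intro integrable_mult_right integrable_cauchy_weight)
      show "AE x in lebesgue_euc d. norm (?g m x) \<le> B * cauchy_weight d x" for m
      proof (rule AE_I2)
        fix x
        have "norm (?g m x) \<le> B / (1 + sqnorm d x) ^ L"
          using bd[of 0 "sqnorm d x" m] sqnorm_nonneg[of d x] by (simp add: norm_mult)
        also have "\<dots> = B * (1 / (1 + sqnorm d x) ^ L)" by simp
        also have "\<dots> \<le> B * cauchy_weight d x"
          by (intro mult_left_mono inverse_power_le_cauchy_weight LK) (use B in auto)
        finally show "norm (?g m x) \<le> B * cauchy_weight d x" .
      qed
    qed (use gm ptw in auto)
    moreover have "(LINT x|lebesgue_euc d. ?g m x) = exp_sum_hat d (c m) (I m) (sqnorm d \<xi>)" for m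
      using exp_sum_fourier[OF d, of "c m" "I m" \<xi>] by (simp add: has_bochner_integral_iff)
    ultimately show ?thesis by (simp add: fourier_def character_def)
  qed
  define F where "F \<rho> = \<Phi> 0 (\<rho>\<^sup>2)" for \<rho>
  define Fh where "Fh \<rho> = fourier d f (axis_point d \<rho>)" for \<rho>
  have rvf: "radial_value d f \<rho> = F \<rho>" if "\<rho> \<ge> 0" for \<rho>
    by (rule radial_value_eq[OF d that]) (simp add: fx F_def sqnorm_conv_enorm)
  \<comment> \<open>\<open>exp_sum_hat\<close> sees only the norm of \<open>\<xi>\<close>, so
    uniqueness of limits shows that the transform of f is radial.\<close>
  have four: "fourier d f \<xi> = Fh (enorm d \<xi>)" for \<xi>
  proof -
    have "sqnorm d (axis_point d (enorm d \<xi>)) = sqnorm d \<xi>"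
      unfolding sqnorm_axis_point[OF d] by (rule sqnorm_conv_enorm[symmetric])
    hence "(\<lambda>m. exp_sum_hat d (c m) (I m) (sqnorm d \<xi>)) \<longlonglongrightarrow> Fh (enorm d \<xi>)"
      using flim[of "axis_point d (enorm d \<xi>)"] by (simp add: Fh_def)
    from LIMSEQ_unique[OF flim[of \<xi>] this] show ?thesis .
  qed
  have rvh: "radial_value d (fourier d f) \<rho> = Fh \<rho>" if "\<rho> \<ge> 0" for \<rho>
    by (rule radial_value_eq[OF d that]) (rule four)
  show ?thesis
  proof (rule that[where c = c and I = I and B = "B + B * K"])
    fix \<rho> :: real assume rho: "\<rho> \<ge> 0"
    show "(\<lambda>m. exp_sum (c m) (I m) 0 (\<rho>\<^sup>2)) \<longlonglongrightarrow> radial_value d f \<rho>"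
      using lim[of "\<rho>\<^sup>2"] by (simp add: rvf[OF rho] F_def)
    show "(\<lambda>m. exp_sum_hat d (c m) (I m) (\<rho>\<^sup>2)) \<longlonglongrightarrow> radial_value d (fourier d f) \<rho>"
      using flim[of "axis_point d \<rho>"] by (simp add: rvh[OF rho] Fh_def sqnorm_axis_point[OF d])
  next
    fix x assume "x \<in> euc d"
    thus "f x = radial_value d f (enorm d x)"
      by (simp add: fx rvf L2_set_nonneg F_def sqnorm_conv_enorm)
  next
    fix m and \<rho> :: real assume rho: "\<rho> \<ge> 0"
    have "\<rho> ^ (2 * N) * cmod (exp_sum (c m) (I m) 0 (\<rho>\<^sup>2)) \<le> (1 + \<rho>\<^sup>2) ^ L' * (B / (1 + \<rho>\<^sup>2) ^ L')"
    proof (intro mult_mono bd')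
      have "\<rho> ^ (2 * N) = (\<rho>\<^sup>2) ^ N" by (simp add: power_mult)
      also have "\<dots> \<le> (1 + \<rho>\<^sup>2) ^ N" by (intro power_mono) auto
      also have "\<dots> \<le> (1 + \<rho>\<^sup>2) ^ L'" by (intro power_increasing) (auto simp: L'_def)
      finally show "\<rho> ^ (2 * N) \<le> (1 + \<rho>\<^sup>2) ^ L'" .
    qed auto
    also have "\<dots> = B"
    proof -
      have "1 + \<rho>\<^sup>2 > 0" by (simp add: add_pos_nonneg)
      thus ?thesis by simp
    qed
    also have "\<dots> \<le> B + B * K" using B LK by simp
    finally show "\<rho> ^ (2 * N) * cmod (exp_sum (c m) (I m) 0 (\<rho>\<^sup>2)) \<le> B + B * K" .
    have "\<rho> ^ (2 * N) * cmod (exp_sum_hat d (c m) (I m) (\<rho>\<^sup>2)) \<le>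
        (2 * pi * \<bar>\<rho>\<bar>) ^ M * cmod (exp_sum_hat d (c m) (I m) (\<rho>\<^sup>2))"
      unfolding M_def
    proof (intro mult_right_mono power_mono)
      have "1 * \<rho> \<le> 2 * pi * \<rho>" by (intro mult_right_mono) (use rho pi_gt3 in auto)
      thus "\<rho> \<le> 2 * pi * \<bar>\<rho>\<bar>" using rho by simp
    qed (use rho in auto)
    also have "\<dots> \<le> B * K" by (rule LK(3)) (rule bd)
    also have "\<dots> \<le> B + B * K" using B by simp
    finally show "\<rho> ^ (2 * N) * cmod (exp_sum_hat d (c m) (I m) (\<rho>\<^sup>2)) \<le> B + B * K" .
  qed
qed

section \<open>The interpolation formula\<close>

context interpolation
begin

text \<open>\<open>gaussian_interpolation\<close> is used at t = \<i> times a positive integer.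
  There the n-th exponential in t is the Gaussian at the node of square 2 n / l, and the n-th
  exponential in -1/t, with the factor (-\<i> t)^(-k), is its transform at the same node.\<close>

lemma exp_sum_interpolation:
  assumes k: "k = real d / 2"
  shows "(\<lambda>n. coeff_f k l (Suc n) (of_real r) * exp_sum c I 0 (2 * real (Suc n) / l) +
      coeff_fhat k l (Suc n) (of_real r) * exp_sum_hat d c I (2 * real (Suc n) / l)) sums exp_sum c I 0 (r\<^sup>2)"
proof -
  let ?p = "\<lambda>i n. complex_of_real (exp (- pi * real i * (2 * real (Suc n) / l)))"
  let ?q = "\<lambda>i n. complex_of_real (exp (- pi * (2 * real (Suc n) / l) / real i) / sqrt (real i) ^ d)"
  have single: "(\<lambda>n. coeff_f k l (Suc n) (of_real r) * ?p i n +
      coeff_fhat k l (Suc n) (of_real r) * ?q i n)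
      sums of_real (exp (- pi * real i * r\<^sup>2))" if i: "i \<ge> 1" for i
  proof -
    define t where "t = \<i> * of_real (real i)"
    have t: "Im t > 0" using i by (simp add: t_def)
    have 1: "exp (2 * of_real pi * \<i> * of_nat (Suc n) * t / of_real l) = ?p i n" for n
    proof -
      have "2 * of_real pi * \<i> * of_nat (Suc n) * t / of_real l = of_real (- pi * real i * (2 * real (Suc n) / l))"
        by (simp add: t_def algebra_simps)
      thus ?thesis by (simp only: exp_of_real)
    qed
    have 2: "exp (2 * of_real pi * \<i> * of_nat (Suc n) * (- 1 / t) / of_real l) = of_real (exp (- pi * (2 * real (Suc n) / l) / real i))" for n
    proof -
      have "- 1 / t = \<i> / of_real (real i)" using i by (simp add: t_def field_simps)
      hence "2 * of_real pi * \<i> * of_nat (Suc n) * (- 1 / t) / of_real l = of_real (- pi * (2 * real (Suc n) / l) / real i)"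
        by (simp add: mult_ac del: of_nat_Suc)
      thus ?thesis by (simp only: exp_of_real)
    qed
    have 3: "(- \<i> * t) powr (- of_real k) = of_real (1 / sqrt (real i) ^ d)"
    proof -
      have "(- \<i> * t) powr (- of_real k) = of_real (real i) powr of_real (- k)" by (simp add: t_def algebra_simps)
      also have "\<dots> = of_real (real i powr (- k))" by (rule powr_of_real) simp
      also have "real i powr (- k) = 1 / sqrt (real i) ^ d"
      proof -
        have "sqrt (real i) ^ d = (real i powr (1/2)) powr real d" using i by (simp add: powr_half_sqrt powr_realpow)
        also have "\<dots> = real i powr k" by (simp add: powr_powr k)
        finally show ?thesis by (simp add: powr_minus_divide)
      qed
      finally show ?thesis .
    qed
    have 4: "exp (\<i> * of_real pi * (of_real r)\<^sup>2 * t) = of_real (exp (- pi * real i * r\<^sup>2))"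
    proof -
      have "\<i> * of_real pi * (of_real r)\<^sup>2 * t = of_real (- pi * real i * r\<^sup>2)"
        by (simp add: t_def algebra_simps)
      thus ?thesis by (simp only: exp_of_real)
    qed
    have "(\<lambda>n. coeff_f k l (Suc n) (of_real r) * ?p i n +
        of_real (1 / sqrt (real i) ^ d) * (coeff_fhat k l (Suc n) (of_real r) * of_real (exp (- pi * (2 * real (Suc n) / l) / real i))))
        sums of_real (exp (- pi * real i * r\<^sup>2))"
      using gaussian_interpolation[OF t, of r] unfolding 1 2 3 4 .
    thus ?thesis by (simp add: mult_ac)
  qed
  have "(\<lambda>n. \<Sum>i=1..I. c i * (coeff_f k l (Suc n) (of_real r) * ?p i n +
      coeff_fhat k l (Suc n) (of_real r) * ?q i n))
      sums (\<Sum>i=1..I. c i * of_real (exp (- pi * real i * r\<^sup>2)))"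
    by (intro sums_sum sums_mult single) auto
  moreover have "(\<Sum>i=1..I. c i * (coeff_f k l (Suc n) (of_real r) * ?p i n +
      coeff_fhat k l (Suc n) (of_real r) * ?q i n)) =
      coeff_f k l (Suc n) (of_real r) * exp_sum c I 0 (2 * real (Suc n) / l) +
      coeff_fhat k l (Suc n) (of_real r) * exp_sum_hat d c I (2 * real (Suc n) / l)" for n
    unfolding exp_sum_def exp_sum_hat_def sum_distrib_left sum.distrib[symmetric]
    by (intro sum.cong refl) (simp add: algebra_simps)
  moreover have "(\<Sum>i=1..I. c i * of_real (exp (- pi * real i * r\<^sup>2))) = exp_sum c I 0 (r\<^sup>2)"
    by (simp add: exp_sum_def)
  ultimately show ?thesis by simp
qed

text \<open>The formula for the m-th approximant passes to f by Tannery's theorem, because its n-th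
  term is at most 2 C / n^2 uniformly in m.\<close>

lemma schwartz_rad_interpolation:
  assumes k: "k = real d / 2" and f: "f \<in> schwartz_rad d"
  defines "u \<equiv> \<lambda>n. radial_value d f (sqrt (2 * real n / l))"
    and "v \<equiv> \<lambda>n. radial_value d (fourier d f) (sqrt (2 * real n / l))"
  shows "abs_unif_convergent_on (euc d) (\<lambda>n x. coeff_f k l n (of_real (enorm d x)) * u n)"
    and "abs_unif_convergent_on (euc d) (\<lambda>n x. coeff_fhat k l n (of_real (enorm d x)) * v n)"
    and "x \<in> euc d \<Longrightarrow> f x = (\<Sum>n. coeff_f k l (Suc n) (of_real (enorm d x)) * u (Suc n)) +
      (\<Sum>n. coeff_fhat k l (Suc n) (of_real (enorm d x)) * v (Suc n))"
proof -
  have d: "d \<ge> 1" using k k_ge by (cases d) auto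
  \<comment> \<open>The coefficients grow at most like n^k <= n^d and the values at the nodes decay
    like n^(-N); N = d + 2 leaves the summable n^(-2).\<close>
  define N where "N = d + 2"
  define \<rho> where "\<rho> n = sqrt (2 * real n / l)" for n
  have lpos: "l > 0" using l_ge by simp
  have rho: "\<rho> n \<ge> 0" "(\<rho> n)\<^sup>2 = 2 * real n / l" for n using lpos by (auto simp: \<rho>_def)
  obtain c I B where lim:
    "\<And>\<rho>. \<rho> \<ge> 0 \<Longrightarrow> (\<lambda>m. exp_sum (c m) (I m) 0 (\<rho>\<^sup>2)) \<longlonglongrightarrow> radial_value d f \<rho>"
    "\<And>\<rho>. \<rho> \<ge> 0 \<Longrightarrow> (\<lambda>m. exp_sum_hat d (c m) (I m) (\<rho>\<^sup>2)) \<longlonglongrightarrow> radial_value d (fourier d f) \<rho>"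
    "\<And>x. x \<in> euc d \<Longrightarrow> f x = radial_value d f (enorm d x)"
    "\<And>m \<rho>. \<rho> \<ge> 0 \<Longrightarrow> \<rho> ^ (2 * N) * cmod (exp_sum (c m) (I m) 0 (\<rho>\<^sup>2)) \<le> B"
    "\<And>m \<rho>. \<rho> \<ge> 0 \<Longrightarrow> \<rho> ^ (2 * N) * cmod (exp_sum_hat d (c m) (I m) (\<rho>\<^sup>2)) \<le> B"
    using schwartz_rad_gaussian_approximation[OF d f, of N thesis] by blast
  define K where "K = 16 * lattice_const * 28 powr (9/4) * (8100 / k) powr (k / 2)"
  define C where "C = K * (B * (l / 2) ^ N)"
  have K: "K \<ge> 0" using lattice_const_nonneg by (simp add: K_def)
  have coeff: "cmod (coeff_f k l n (of_real r)) \<le> K * real n ^ d" "cmod (coeff_fhat k l n (of_real r)) \<le> K * real n ^ d"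
    if "n \<ge> 1" for n r
  proof -
    have "real n powr k \<le> real n powr real d" by (rule powr_mono) (use that k in auto)
    also have "\<dots> = real n ^ d" using that by (simp add: powr_realpow)
    finally have "K * real n powr k \<le> K * real n ^ d" using K by (rule mult_left_mono)
    thus "cmod (coeff_f k l n (of_real r)) \<le> K * real n ^ d" "cmod (coeff_fhat k l n (of_real r)) \<le> K * real n ^ d"
      using fourier_coeff_orbit_sum_sup[OF _ that, of odd_words r] fourier_coeff_orbit_sum_sup[OF _ that, of even_words r]
      unfolding coeff_f_def coeff_fhat_def K_def norm_minus_cancel by (auto simp: odd_words_def even_words_def)
  qed
  have decay: "cmod z \<le> B * (l / 2) ^ N / real n ^ N" if "n \<ge> 1" "\<rho> n ^ (2 * N) * cmod z \<le> B" for n z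
  proof -
    have "\<rho> n ^ (2 * N) = ((\<rho> n)\<^sup>2) ^ N" by (rule power_mult)
    also have "\<dots> = (real n / (l / 2)) ^ N" by (simp add: rho mult.commute)
    finally have "\<rho> n ^ (2 * N) = (real n / (l / 2)) ^ N" .
    hence "(real n ^ N / (l / 2) ^ N) * cmod z \<le> B" using that by (simp only: power_divide)
    thus ?thesis using that lpos by (simp add: field_simps)
  qed
  have term_le: "cmod (w * z) \<le> C / real n ^ 2"
    if n: "n \<ge> 1" and w: "cmod w \<le> K * real n ^ d" and z: "\<rho> n ^ (2 * N) * cmod z \<le> B" for n w z
  proof -
    have "cmod (w * z) \<le> (K * real n ^ d) * (B * (l / 2) ^ N / real n ^ N)"
      unfolding norm_mult by (intro mult_mono w decay n z) (use K in auto)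
    also have "\<dots> = C / real n ^ 2" using n by (simp add: C_def N_def power_add power2_eq_square field_simps)
    finally show ?thesis .
  qed
  have lim_le: "\<rho> n ^ (2 * N) * cmod (u n) \<le> B" "\<rho> n ^ (2 * N) * cmod (v n) \<le> B" for n
  proof -
    show "\<rho> n ^ (2 * N) * cmod (u n) \<le> B"
    proof (rule LIMSEQ_le_const2)
      show "(\<lambda>m. \<rho> n ^ (2 * N) * cmod (exp_sum (c m) (I m) 0 ((\<rho> n)\<^sup>2))) \<longlonglongrightarrow> \<rho> n ^ (2 * N) * cmod (u n)"
        unfolding u_def \<rho>_def[symmetric] by (intro tendsto_mult tendsto_const tendsto_norm lim rho)
    qed (use lim(4)[OF rho(1)] in blast)
    show "\<rho> n ^ (2 * N) * cmod (v n) \<le> B"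
    proof (rule LIMSEQ_le_const2)
      show "(\<lambda>m. \<rho> n ^ (2 * N) * cmod (exp_sum_hat d (c m) (I m) ((\<rho> n)\<^sup>2))) \<longlonglongrightarrow> \<rho> n ^ (2 * N) * cmod (v n)"
        unfolding v_def \<rho>_def[symmetric] by (intro tendsto_mult tendsto_const tendsto_norm lim rho)
    qed (use lim(5)[OF rho(1)] in blast)
  qed
  have sumC: "summable (\<lambda>n. C / real (Suc n) ^ 2)"
  proof -
    have "summable (\<lambda>n. inverse (real n ^ 2))" by (rule inverse_power_summable) simp
    hence "summable (\<lambda>n. C * inverse (real (Suc n) ^ 2))" by (intro summable_mult) (subst summable_Suc_iff)
    thus ?thesis by (simp only: divide_inverse)
  qed
  have conv: "abs_unif_convergent_on (euc d) g"
    if g: "\<And>n x. n \<ge> 1 \<Longrightarrow> cmod (g n x) \<le> C / real n ^ 2" for g :: "nat \<Rightarrow> (nat \<Rightarrow> real) \<Rightarrow> complex"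
    unfolding abs_unif_convergent_on_def
  proof (intro conjI ballI)
    have gS: "cmod (g (Suc n) x) \<le> C / real (Suc n) ^ 2" for n x by (rule g) simp
    fix x
    show "summable (\<lambda>n. cmod (g (Suc n) x))"
      by (rule summable_comparison_test'[OF sumC, of 0]) (simp only: real_norm_def abs_norm_cancel gS)
  next
    have "uniformly_convergent_on (euc d) (\<lambda>N x. \<Sum>n<N. g (Suc n) x)"
      by (rule Weierstrass_m_test'[OF g sumC]) simp
    moreover have "(\<Sum>n<N. g (Suc n) x) = (\<Sum>n=1..N. g n x)" for N x
      by (rule sum.reindex_bij_witness[of _ "\<lambda>n. n - 1" Suc]) auto
    ultimately show "uniformly_convergent_on (euc d) (\<lambda>N x. \<Sum>n=1..N. g n x)" by simp
  qed
  show "abs_unif_convergent_on (euc d) (\<lambda>n x. coeff_f k l n (of_real (enorm d x)) * u n)"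
    by (intro conv term_le coeff lim_le)
  show "abs_unif_convergent_on (euc d) (\<lambda>n x. coeff_fhat k l n (of_real (enorm d x)) * v n)"
    by (intro conv term_le coeff lim_le)
  show "f x = (\<Sum>n. coeff_f k l (Suc n) (of_real (enorm d x)) * u (Suc n)) +
      (\<Sum>n. coeff_fhat k l (Suc n) (of_real (enorm d x)) * v (Suc n))" if x: "x \<in> euc d"
  proof -
    define r where "r = enorm d x"
    have r: "r \<ge> 0" by (simp add: r_def L2_set_nonneg)
    define a where "a n = coeff_f k l (Suc n) (of_real r)" for n
    define b where "b n = coeff_fhat k l (Suc n) (of_real r)" for n
    define T where "T n m = a n * exp_sum (c m) (I m) 0 ((\<rho> (Suc n))\<^sup>2) +
        b n * exp_sum_hat d (c m) (I m) ((\<rho> (Suc n))\<^sup>2)" for n m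
    have T_lim: "(\<lambda>m. T n m) \<longlonglongrightarrow> a n * u (Suc n) + b n * v (Suc n)" for n
      unfolding T_def u_def v_def \<rho>_def[symmetric] by (intro tendsto_add tendsto_mult tendsto_const lim rho)
    have T_le: "norm (T n m) \<le> 2 * (C / real (Suc n) ^ 2)" for n m
    proof -
      have "cmod (a n * exp_sum (c m) (I m) 0 ((\<rho> (Suc n))\<^sup>2)) \<le> C / real (Suc n) ^ 2"
        "cmod (b n * exp_sum_hat d (c m) (I m) ((\<rho> (Suc n))\<^sup>2)) \<le> C / real (Suc n) ^ 2"
        unfolding a_def b_def by (intro term_le coeff lim rho; simp)+
      thus ?thesis unfolding T_def by (intro norm_triangle_le) linarith
    qed
    have "((\<lambda>m. suminf (\<lambda>n. T n m)) \<longlonglongrightarrow> suminf (\<lambda>n. a n * u (Suc n) + b n * v (Suc n)))"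
    proof -
      have "\<forall>\<^sub>F (n, m) in at_top \<times>\<^sub>F at_top. norm (T n m) \<le> 2 * (C / real (Suc n) ^ 2)"
        by (intro always_eventually) (use T_le in blast)
      from tannerys_theorem[OF T_lim this summable_mult[OF sumC]] show ?thesis by simp
    qed
    moreover have "suminf (\<lambda>n. T n m) = exp_sum (c m) (I m) 0 (r\<^sup>2)" for m
      using exp_sum_interpolation[OF k, of r "c m" "I m"]
      unfolding T_def rho a_def b_def by (rule sums_unique[symmetric])
    ultimately have "(\<lambda>m. exp_sum (c m) (I m) 0 (r\<^sup>2)) \<longlonglongrightarrow> suminf (\<lambda>n. a n * u (Suc n) + b n * v (Suc n))"
      by simp
    hence "radial_value d f r = suminf (\<lambda>n. a n * u (Suc n) + b n * v (Suc n))"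
      using lim(1)[OF r] LIMSEQ_unique by blast
    also have "\<dots> = (\<Sum>n. a n * u (Suc n)) + (\<Sum>n. b n * v (Suc n))"
    proof (rule suminf_add[symmetric])
      show "summable (\<lambda>n. a n * u (Suc n))"
        by (rule summable_comparison_test'[OF sumC, of 0]) (unfold a_def, intro term_le coeff lim_le; simp)
      show "summable (\<lambda>n. b n * v (Suc n))"
        by (rule summable_comparison_test'[OF sumC, of 0]) (unfold b_def, intro term_le coeff lim_le; simp)
    qed
    finally show ?thesis using lim(3)[OF x] by (simp add: r_def a_def b_def)
  qed
qed

end

theorem theorem3:
  shows "\<exists>C1>0. \<exists>C2>0. \<exists>C3>(0::real). \<forall>(l::real) (d::nat) (k::real).
    l \<ge> 2 \<longrightarrow> d \<ge> 5 \<longrightarrow> k = real d / 2 \<longrightarrow>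
    (\<exists>(a :: nat \<Rightarrow> complex \<Rightarrow> complex) (b :: nat \<Rightarrow> complex \<Rightarrow> complex).
      (\<forall>n\<ge>1. entire_even (a n) \<and> entire_even (b n)) \<and>
      (\<forall>f\<in>schwartz_rad d.
        abs_unif_convergent_on (euc d)
          (\<lambda>n x. a n (complex_of_real (enorm d x)) * radial_value d f (sqrt (2 * real n / l))) \<and>
        abs_unif_convergent_on (euc d)
          (\<lambda>n x. b n (complex_of_real (enorm d x)) * radial_value d (fourier d f) (sqrt (2 * real n / l))) \<and>
        (\<forall>x\<in>euc d. f x =
          (\<Sum>n. a (Suc n) (complex_of_real (enorm d x)) * radial_value d f (sqrt (2 * real (Suc n) / l))) +
          (\<Sum>n. b (Suc n) (complex_of_real (enorm d x)) * radial_value d (fourier d f) (sqrt (2 * real (Suc n) / l))))) \<and>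
      (\<forall>n\<ge>1.
        bdd_above (range (\<lambda>r::real. cmod (a n (complex_of_real r)))) \<and>
        bdd_above (range (\<lambda>r::real. cmod (b n (complex_of_real r)))) \<and>
        (SUP r::real. cmod (a n (complex_of_real r))) + (SUP r::real. cmod (b n (complex_of_real r)))
          \<le> C1 * (C2 / k) powr (k / 2) * real n powr k) \<and>
      (\<forall>n\<ge>1. \<forall>r::real. r > 0 \<longrightarrow>
        cmod (a n (complex_of_real r)) + cmod (b n (complex_of_real r))
          \<le> C3 * real n powr (k / 2 + 9 / 8) * r powr (- k + 9 / 4)))"
proof -
  \<comment> \<open>32 is twice 16, for the two coefficients. The summand 1 makes the constant
    positive, as \<open>lattice_const\<close> has only been shown to be nonnegative.\<close>
  define C where "C c = 32 * lattice_const * c powr (9/4) + 1" for c :: real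
  have C: "C c > 0" for c using lattice_const_nonneg by (simp add: C_def add_nonneg_pos)
  show ?thesis
  proof (rule exI[of _ "C 28"], intro conjI C, rule exI[of _ 8100], intro conjI,
      simp, rule exI[of _ "C 54"], intro conjI C allI impI, goal_cases)
    case (1 l d k)
    hence l: "l \<ge> 2" and d: "d \<ge> 5" and k: "k = real d / 2" by auto
    interpret interpolation k l by standard (use l d k in auto)
    have W: "odd_words \<subseteq> words" "even_words \<subseteq> words" by (auto simp: odd_words_def even_words_def)
    have norm_f: "cmod (coeff_f k l n z) = cmod (fourier_coeff l (orbit_sum k l odd_words z) n)" for n z
      by (simp add: coeff_f_def)
    define S where "S n = 16 * lattice_const * 28 powr (9/4) * (8100 / k) powr (k / 2) * real n powr k" for n
    have sup: "cmod (coeff_f k l n (of_real r)) \<le> S n" "cmod (coeff_fhat k l n (of_real r)) \<le> S n"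
      if "n \<ge> 1" for n r
      using fourier_coeff_orbit_sum_sup[OF W(1) that] fourier_coeff_orbit_sum_sup[OF W(2) that]
      unfolding norm_f coeff_fhat_def S_def by blast+
    show ?case
    proof (rule exI[of _ "coeff_f k l"], rule exI[of _ "coeff_fhat k l"], intro conjI allI impI ballI)
      fix n :: nat
      show "entire_even (coeff_f k l n)"
        using fourier_coeff_orbit_sum_entire_even[OF W(1), of n]
        by (auto simp: entire_even_def coeff_f_def [abs_def] intro: holomorphic_on_minus)
      show "entire_even (coeff_fhat k l n)"
        using fourier_coeff_orbit_sum_entire_even[OF W(2), of n] by (simp add: coeff_fhat_def [abs_def])
    next
      fix f assume f: "f \<in> schwartz_rad d"
      note * = schwartz_rad_interpolation[OF k f]
      show "abs_unif_convergent_on (euc d)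
          (\<lambda>n x. coeff_f k l n (of_real (enorm d x)) * radial_value d f (sqrt (2 * real n / l)))"
        by (rule *(1))
      show "abs_unif_convergent_on (euc d)
          (\<lambda>n x. coeff_fhat k l n (of_real (enorm d x)) * radial_value d (fourier d f) (sqrt (2 * real n / l)))"
        by (rule *(2))
      fix x assume "x \<in> euc d"
      thus "f x = (\<Sum>n. coeff_f k l (Suc n) (of_real (enorm d x)) * radial_value d f (sqrt (2 * real (Suc n) / l))) +
          (\<Sum>n. coeff_fhat k l (Suc n) (of_real (enorm d x)) * radial_value d (fourier d f) (sqrt (2 * real (Suc n) / l)))"
        by (rule *(3))
    next
      fix n :: nat assume n: "n \<ge> 1"
      show "bdd_above (range (\<lambda>r. cmod (coeff_f k l n (of_real r))))"
        "bdd_above (range (\<lambda>r. cmod (coeff_fhat k l n (of_real r))))"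
        by (rule bdd_aboveI2[of _ _ "S n"], rule sup[OF n])+
      have "(SUP r. cmod (coeff_f k l n (of_real r))) \<le> S n"
        "(SUP r. cmod (coeff_fhat k l n (of_real r))) \<le> S n"
        by (rule cSUP_least, simp, rule sup[OF n])+
      hence "(SUP r. cmod (coeff_f k l n (of_real r))) +
          (SUP r. cmod (coeff_fhat k l n (of_real r))) \<le>
          (C 28 - 1) * ((8100 / k) powr (k / 2) * real n powr k)"
        by (simp add: S_def C_def mult_ac)
      also have "\<dots> \<le> C 28 * ((8100 / k) powr (k / 2) * real n powr k)" by (rule mult_right_mono) auto
      finally show "(SUP r. cmod (coeff_f k l n (of_real r))) +
          (SUP r. cmod (coeff_fhat k l n (of_real r)))
          \<le> C 28 * (8100 / k) powr (k / 2) * real n powr k" by (simp only: mult.assoc)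
      fix r :: real assume r: "r > 0"
      have "cmod (coeff_f k l n (of_real r)) + cmod (coeff_fhat k l n (of_real r)) \<le>
          (C 54 - 1) * (real n powr (k / 2 + 9 / 8) * r powr (- k + 9 / 4))"
        using fourier_coeff_orbit_sum_decay[OF W(1) n r] fourier_coeff_orbit_sum_decay[OF W(2) n r]
        by (simp add: norm_f coeff_fhat_def C_def mult_ac)
      also have "\<dots> \<le> C 54 * (real n powr (k / 2 + 9 / 8) * r powr (- k + 9 / 4))" by (rule mult_right_mono) auto
      finally show "cmod (coeff_f k l n (of_real r)) + cmod (coeff_fhat k l n (of_real r))
          \<le> C 54 * real n powr (k / 2 + 9 / 8) * r powr (- k + 9 / 4)" by (simp only: mult.assoc)
    qed
  qed
qed

end
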